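(* Let $d\ge 3$ and let $Q$ be a positive definite quadratic form on $\mathbb{R}^{d-1}$ with symmetric coefficient matrix $A=(a_{ij})$, such that $a_{12}/a_{11}\in\mathbb{Q}$ and $a_{22}/a_{11}\in\mathbb{Q}$. For $c>0$ and $\vec{\beta}\in\mathbb{R}^{d-1}$ let $\mathcal{P}=\{(\vec{x},y)\in\mathbb{R}^{d-1}\times\mathbb{R}: |y|\le c-Q(\vec{x}+\vec{\beta})\}$ and $\mathcal{N}(R)=\#\{\vec{n}\in\mathbb{Z}^d: R^{-1}\vec{n}\in\mathcal{P}\}$. Then for each fixed $\epsilon>0$, \[\mathcal{N}(R)=|\mathcal{P}|R^d+O\big(R^{d-2+\epsilon}\big)\] uniformly for $0<c\ll 1<R$ and $\vec{\beta}\in\mathbb{R}^{d-1}$; that is, for every $C>0$ and $\epsilon>0$ there is $K$ (depending on $Q,C,\epsilon$) such that $|\mathcal{N}(R)-|\mathcal{P}|R^d|\le KR^{d-2+\epsilon}$ for all $0<c\le C$, $R>1$ and $\vec\beta\in\mathbb{R}^{d-1}$.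
   Context: $|\mathcal{P}|$ denotes the volume of $\mathcal{P}$. *)

theory Defs
  imports "HOL-Analysis.Analysis"
begin

definition quad_form :: "real ^ 'n ^ 'n \<Rightarrow> real ^ 'n \<Rightarrow> real"
  where "quad_form A x = (\<Sum>i\<in>UNIV. \<Sum>j\<in>UNIV. A $ i $ j * x $ i * x $ j)"

definition pos_def_form :: "real ^ 'n ^ 'n \<Rightarrow> bool"
  where "pos_def_form A \<longleftrightarrow> (\<forall>x. x \<noteq> 0 \<longrightarrow> quad_form A x > 0)"

(* The pairs (x, y) carry the product Euclidean structure of R^(d-1) x R, so that
   lborel on this type is d-dimensional Lebesgue measure, where d = CARD('n) + 1. *)
definition parab_body :: "real ^ 'n ^ 'n \<Rightarrow> real \<Rightarrow> real ^ 'n \<Rightarrow> ((real ^ 'n) \<times> real) set"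
  where "parab_body A c \<beta> = {(x, y). \<bar>y\<bar> \<le> c - quad_form A (x + \<beta>)}"

definition int_points :: "((real ^ 'n) \<times> real) set"
  where "int_points = {(x, y). (\<forall>i. x $ i \<in> \<int>) \<and> y \<in> \<int>}"

(* For a positive definite form the body is bounded and the set counted here is finite,
   so card is the true cardinality. *)
definition lattice_count :: "real ^ 'n ^ 'n \<Rightarrow> real \<Rightarrow> real ^ 'n \<Rightarrow> real \<Rightarrow> nat"
  where "lattice_count A c \<beta> R = card {n \<in> int_points. inverse R *\<^sub>R n \<in> parab_body A c \<beta>}"

end

theory Submission
  imports Defs "HOL-Computational_Algebra.Primes"
begin

text \<open>Scale by \<open>R\<close> and count over each lattice point \<open>n\<close> of \<open>\<int>\<^sup>d\<^sup>-\<^sup>1\<close> the integers of absolute value at most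
  the height \<open>h n\<close>; this number is \<open>2 max 0 (h n)\<close> plus a sawtooth defect. The sum of
  \<open>2 max 0 h\<close> hardly changes when the lattice is translated, because \<open>h\<close> is concave along lattice lines,
  and its average over all translates is the volume; the error is \<open>O(R ^ (d - 2))\<close>.

  The defect is summed over the planes parallel to the two distinguished axes, so a bound
  \<open>O(R powr (1 + \<epsilon>))\<close> on each plane is needed. There the defect is made periodic with a period \<open>P\<close> of size \<open>R\<close>
  and expanded into a trigonometric polynomial in \<open>h\<close>, so that the condition \<open>h \<ge> 0\<close> is absorbed in
  the coefficients and the exponential sums run over full squares. Weyl differencing bounds these sums
  by sums of \<open>min P (1 / \<parallel>\<mu> l j / P\<parallel>)\<close> over \<open>l\<close>, where rationality makes the frequencies \<open>l\<close> integral.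
  Writing \<open>j = h P + r\<close>, the sum over \<open>r\<close> costs a power of a logarithm, and collecting the products \<open>h l\<close> costs
  a divisor function.\<close>

section \<open>Distance to the nearest integer and exponential sums\<close>

text \<open>A plane carries about \<open>R ^ 2\<close> lattice points, so a bound of order
  \<open>R\<close> asks for square-root cancellation in both variables. Weyl differencing supplies
  it without loss: the squared sum is bounded by a double sum over two frequencies, and because the
  2 by 2 integer block is invertible these can be treated as independent. The double sum is then a
  perfect square, and its root is one sum of about \<open>R\<close> kernel values, of size
  \<open>R\<close> up to small factors on average over the frequency. Differencing turns the linear
  terms of the height into factors of modulus one. Hence neither \<beta> nor a small
  \<open>c\<close> harms the estimate, which is the source of the uniformity. All Fourier analysis
  is finite: coefficients are sums over a grid in one period, and the Fejer kernel averages grid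
  values. The jumps of the defect are therefore first replaced by ramps of width
  \<open>1 / P\<close>, which costs O(P) on a plane. The grid has \<open>P ^ 8\<close> points in a
  period; so fine a grid makes the approximation error harmless and is paid for only by logarithms
  and a divisor bound.\<close>

definition dist_int :: "real \<Rightarrow> real"
  where "dist_int x = \<bar>x - of_int (round x)\<bar>"

lemma dist_int_le: "dist_int x \<le> \<bar>x - of_int z\<bar>"
  unfolding dist_int_def by (rule round_diff_minimal)

lemma dist_int_nonneg [simp]: "0 \<le> dist_int x"
  by (simp add: dist_int_def)

lemma dist_int_le_half: "dist_int x \<le> 1 / 2"
  unfolding dist_int_def using of_int_round_abs_le[of x] by (simp add: abs_minus_commute)

lemma dist_int_le_abs: "dist_int x \<le> \<bar>x\<bar>"
  using dist_int_le[of x 0] by simp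

lemma dist_int_triangle: "dist_int (x + y) \<le> dist_int x + dist_int y"
proof -
  have "dist_int (x + y) \<le> \<bar>x + y - of_int (round x + round y)\<bar>" by (rule dist_int_le)
  also have "\<dots> \<le> dist_int x + dist_int y" unfolding dist_int_def by simp
  finally show ?thesis .
qed

lemma dist_int_minus [simp]: "dist_int (- x) = dist_int x"
proof -
  have "dist_int (- x) \<le> dist_int x" for x
    using dist_int_le[of "-x" "- round x"] by (simp add: dist_int_def)
  from this[of x] this[of "-x"] show ?thesis by simp
qed

lemma dist_int_of_int [simp]: "dist_int (of_int z) = 0"
  using dist_int_le[of "of_int z" z] dist_int_nonneg[of "of_int z"] by simp

lemma dist_int_add_of_int [simp]: "dist_int (x + of_int z) = dist_int x"
  using dist_int_triangle[of x "of_int z"] dist_int_triangle[of "x + of_int z" "- of_int z"] by simp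

text \<open>Jordan's inequality: sine is concave on \<open>{0..pi}\<close> and so lies above its
  chord from \<open>0\<close> to \<open>pi / 2\<close>.\<close>

lemma sin_ge_line:
  fixes y :: real assumes "0 \<le> y" "y \<le> 1 / 2" shows "2 * y \<le> sin (pi * y)"
proof -
  have cs: "concave_on {0..pi} sin"
    by (rule f''_le0_imp_concave[where f' = cos and f'' = "\<lambda>x. - sin x"])
       (auto intro!: derivative_eq_intros sin_ge_zero)
  have "sin ((1 - 2 * y) *\<^sub>R 0 + (2 * y) *\<^sub>R (pi / 2)) \<ge> (1 - 2 * y) * sin 0 + (2 * y) * sin (pi / 2)"
    using assms by (intro concave_onD[OF cs]) auto
  thus ?thesis by (simp add: mult.commute)
qed

lemma sin_ge_dist_int: "2 * dist_int x \<le> \<bar>sin (pi * x)\<bar>"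
proof -
  define y where "y = x - of_int (round x)"
  have x: "x = y + of_int (round x)" by (simp add: y_def)
  have "\<bar>sin (pi * x)\<bar> = \<bar>sin (pi * y)\<bar>"
    by (subst x) (simp add: distrib_left sin_add abs_mult)
  also have "\<dots> = sin (pi * \<bar>y\<bar>)"
  proof (cases "y \<ge> 0")
    case True
    have "sin (pi * y) \<ge> 0"
      using True of_int_round_abs_le[of x] by (intro sin_ge_zero) (auto simp: y_def abs_if split: if_splits)
    thus ?thesis using True by simp
  next
    case False
    have "sin (pi * (-y)) \<ge> 0"
      using False of_int_round_abs_le[of x] by (intro sin_ge_zero) (auto simp: y_def abs_if split: if_splits)
    thus ?thesis using False by simp
  qed
  also have "\<dots> \<ge> 2 * \<bar>y\<bar>"
    using dist_int_le_half[of x] by (intro sin_ge_line) (auto simp: dist_int_def y_def)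
  finally show ?thesis by (simp add: dist_int_def y_def)
qed

definition echar :: "real \<Rightarrow> complex"
  where "echar x = cis (2 * pi * x)"

lemma echar_add: "echar (x + y) = echar x * echar y"
  by (simp add: echar_def cis_mult distrib_left)

lemma echar_minus: "echar (- x) = cnj (echar x)"
  by (simp add: echar_def cis_cnj)

lemma echar_diff: "echar (x - y) = echar x * cnj (echar y)"
  using echar_add[of x "-y"] by (simp add: echar_minus)

lemma echar_0 [simp]: "echar 0 = 1"
  by (simp add: echar_def)

lemma norm_echar [simp]: "norm (echar x) = 1"
  by (simp add: echar_def)

lemma echar_of_int [simp]: "echar (of_int z) = 1"
  by (simp add: echar_def cis_multiple_2pi)

lemma norm_one_minus_echar: "norm (1 - echar x) = 2 * \<bar>sin (pi * x)\<bar>"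
proof -
  have "(norm (1 - echar x))\<^sup>2 = (1 - cos (2 * (pi * x)))\<^sup>2 + (sin (2 * (pi * x)))\<^sup>2"
    by (simp add: echar_def cmod_power2 mult.assoc)
  also have "\<dots> = (2 * \<bar>sin (pi * x)\<bar>)\<^sup>2"
    unfolding sin_double cos_double power_mult_distrib power2_abs
    using sin_cos_squared_add[of "pi * x"] by algebra
  finally have "(norm (1 - echar x))\<^sup>2 = (2 * \<bar>sin (pi * x)\<bar>)\<^sup>2" .
  thus ?thesis by (subst (asm) power2_eq_iff_nonneg) auto
qed

lemma norm_one_minus_echar_ge: "4 * dist_int x \<le> norm (1 - echar x)"
  using sin_ge_dist_int[of x] by (simp add: norm_one_minus_echar)

lemma norm_one_minus_echar_le: "norm (1 - echar x) \<le> 2 * pi * \<bar>x\<bar>"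
  using abs_sin_x_le_abs_x[of "pi * x"] by (simp add: norm_one_minus_echar abs_mult)

lemma sum_int_shift:
  fixes g :: "int \<Rightarrow> 'a::comm_monoid_add"
  shows "(\<Sum>s\<in>{a..b}. g (s + k)) = (\<Sum>s\<in>{a + k..b + k}. g s)"
  by (rule sum.reindex_bij_witness[of _ "\<lambda>s. s - k" "\<lambda>s. s + k"]) auto

text \<open>Abel summation: multiplying by \<open>1 - echar x\<close> turns the values of
  \<open>v\<close> into increments. Since \<open>v\<close> vanishes on both sides of the interval
  there are no boundary terms; the extra point \<open>b + 1\<close> carries the last jump.\<close>

lemma exp_sum_variation:
  fixes v :: "int \<Rightarrow> real"
  assumes "\<And>s. s \<notin> {a..b} \<Longrightarrow> v s = 0"
  shows "4 * dist_int x * norm (\<Sum>s\<in>{a..b}. of_real (v s) * echar (x * of_int s))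
       \<le> (\<Sum>s\<in>{a..b + 1}. \<bar>v s - v (s - 1)\<bar>)"
proof -
  let ?S = "\<Sum>s\<in>{a..b}. of_real (v s) * echar (x * of_int s)"
  have 1: "(\<Sum>s\<in>{a..b + 1}. of_real (v s) * echar (x * of_int s)) = ?S"
    using assms by (intro sum.mono_neutral_right) auto
  have "(\<Sum>s\<in>{a..b + 1}. of_real (v (s - 1)) * echar (x * of_int s))
      = (\<Sum>s\<in>{a + 1..b + 1}. of_real (v (s - 1)) * echar (x * of_int s))"
    using assms by (intro sum.mono_neutral_right) auto
  also have "\<dots> = (\<Sum>s\<in>{a..b}. of_real (v s) * echar (x * of_int (s + 1)))"
    using sum_int_shift[of "\<lambda>s. of_real (v (s - 1)) * echar (x * of_int s)" 1 a b] by simp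
  also have "\<dots> = echar x * ?S"
    by (simp add: sum_distrib_left distrib_left echar_add mult_ac)
  finally have 2: "(\<Sum>s\<in>{a..b + 1}. of_real (v (s - 1)) * echar (x * of_int s)) = echar x * ?S" .
  have "(1 - echar x) * ?S = (\<Sum>s\<in>{a..b + 1}. of_real (v s - v (s - 1)) * echar (x * of_int s))"
    using 1 2 by (simp add: algebra_simps sum_subtractf)
  hence "norm (1 - echar x) * norm ?S = norm (\<Sum>s\<in>{a..b + 1}. of_real (v s - v (s - 1)) * echar (x * of_int s))"
    by (simp only: norm_mult[symmetric])
  also have "\<dots> \<le> (\<Sum>s\<in>{a..b + 1}. \<bar>v s - v (s - 1)\<bar>)"
    by (rule order_trans[OF norm_sum]) (simp add: norm_mult del: of_real_diff)
  finally have "norm (1 - echar x) * norm ?S \<le> (\<Sum>s\<in>{a..b + 1}. \<bar>v s - v (s - 1)\<bar>)" .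
  moreover have "4 * dist_int x * norm ?S \<le> norm (1 - echar x) * norm ?S"
    by (intro mult_right_mono norm_one_minus_echar_ge) auto
  ultimately show ?thesis by linarith
qed

text \<open>Comparable to \<open>min P (1 / \<parallel>x\<parallel>)\<close>, but without a junk value at integers.\<close>
definition peak :: "real \<Rightarrow> real \<Rightarrow> real"
  where "peak P x = 1 / (1 / P + dist_int x)"

lemma peak_nonneg: "0 < P \<Longrightarrow> 0 \<le> peak P x"
  by (simp add: peak_def)

lemma peak_minus [simp]: "peak P (- x) = peak P x"
  by (simp add: peak_def)

lemma peak_add_of_int [simp]: "peak P (x + of_int z) = peak P x"
  by (simp add: peak_def)

lemma peak_zero: "0 < P \<Longrightarrow> peak P 0 = P"
  using dist_int_of_int[of 0] by (simp add: peak_def)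

lemma min_le_peak:
  assumes "0 < P" "s \<le> P" "2 * dist_int x * s \<le> 1"
  shows "s \<le> 2 * peak P x"
proof -
  have pos: "0 < 1 / P + dist_int x" using assms by (simp add: add_pos_nonneg)
  have "s * (1 / P) \<le> 1" using assms by (simp add: divide_simps)
  moreover have "s * dist_int x \<le> 1" using assms by (simp add: mult_ac)
  ultimately have "s * (1 / P + dist_int x) \<le> 2" by (simp add: algebra_simps)
  thus ?thesis using pos by (simp add: peak_def pos_le_divide_eq)
qed

text \<open>The indicator of an interval has total variation 2, so this is a case of
  \<open>exp_sum_variation\<close>. The product form stays meaningful when \<open>x\<close> is an
  integer.\<close>

lemma geometric_exp_sum_dist_int:
  "2 * dist_int x * norm (\<Sum>s\<in>{a..b}. echar (x * of_int s)) \<le> 1"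
proof (cases "a \<le> b")
  case False
  thus ?thesis by simp
next
  case True
  define v :: "int \<Rightarrow> real" where "v s = (if s \<in> {a..b} then 1 else 0)" for s
  have eq: "(\<Sum>s\<in>{a..b}. of_real (v s) * echar (x * of_int s)) = (\<Sum>s\<in>{a..b}. echar (x * of_int s))"
    by (intro sum.cong) (auto simp: v_def)
  have "(\<Sum>s\<in>{a..b + 1}. \<bar>v s - v (s - 1)\<bar>) = (\<Sum>s\<in>{a, b + 1}. \<bar>v s - v (s - 1)\<bar>)"
    using True by (intro sum.mono_neutral_right) (auto simp: v_def)
  also have "\<dots> = 2" using True by (simp add: v_def)
  finally have tv: "(\<Sum>s\<in>{a..b + 1}. \<bar>v s - v (s - 1)\<bar>) = 2" .
  have "4 * dist_int x * norm (\<Sum>s\<in>{a..b}. echar (x * of_int s)) \<le> 2"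
    using exp_sum_variation[of a b v x] unfolding eq tv by (auto simp: v_def)
  thus ?thesis by simp
qed

lemma geometric_exp_sum:
  assumes "0 < P" "of_int (b - a + 1) \<le> P"
  shows "norm (\<Sum>s\<in>{a..b}. echar (x * of_int s)) \<le> 2 * peak P x"
proof (cases "a \<le> b")
  case False
  thus ?thesis using peak_nonneg[OF assms(1), of x] by simp
next
  case True
  have "norm (\<Sum>s\<in>{a..b}. echar (x * of_int s)) \<le> of_int (b - a + 1)"
    using True by (intro order_trans[OF norm_sum]) simp
  thus ?thesis using assms geometric_exp_sum_dist_int[of x a b] by (intro min_le_peak) auto
qed

section \<open>Sums of the peak kernel\<close>

text \<open>Here \<open>g\<close> ranks the points by their distance from an integer. Rank 0 costs
  the full height \<open>P\<close> of the kernel, rank \<open>i\<close> at most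
  \<open>1 / (i * \<sigma>)\<close>, and distinct ranks add up to a harmonic sum.\<close>

lemma sum_inj_le_harm:
  fixes w :: "'a \<Rightarrow> real" and g :: "'a \<Rightarrow> nat"
  assumes "finite A" "inj_on g A" "\<And>r. r \<in> A \<Longrightarrow> g r \<le> I"
    and "\<And>r. r \<in> A \<Longrightarrow> w r \<le> 1 / (1 / P + real (g r) * \<sigma>)" and "0 < P" "0 < \<sigma>"
  shows "sum w A \<le> P + harm I / \<sigma>"
proof -
  have "sum w A \<le> (\<Sum>r\<in>A. 1 / (1 / P + real (g r) * \<sigma>))"
    using assms by (intro sum_mono)
  also have "\<dots> = (\<Sum>i\<in>g ` A. 1 / (1 / P + real i * \<sigma>))"
    using assms by (simp add: sum.reindex)
  also have "\<dots> \<le> (\<Sum>i\<in>{0..I}. 1 / (1 / P + real i * \<sigma>))"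
    using assms by (intro sum_mono2) (auto intro!: divide_nonneg_nonneg add_nonneg_nonneg)
  also have "\<dots> = P + (\<Sum>i\<in>{1..I}. 1 / (1 / P + real i * \<sigma>))"
    by (subst sum.atLeast_Suc_atMost) auto
  also have "(\<Sum>i\<in>{1..I}. 1 / (1 / P + real i * \<sigma>)) \<le> (\<Sum>i\<in>{1..I}. inverse (real i) / \<sigma>)"
  proof (intro sum_mono)
    fix i assume "i \<in> {1..I}"
    hence "0 < real i * \<sigma>" using assms by simp
    hence "1 / (1 / P + real i * \<sigma>) \<le> 1 / (real i * \<sigma>)"
      using assms by (intro divide_left_mono) (auto intro!: mult_pos_pos add_pos_pos)
    thus "1 / (1 / P + real i * \<sigma>) \<le> inverse (real i) / \<sigma>" by (simp add: field_simps)
  qed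
  also have "\<dots> = harm I / \<sigma>"
    by (simp add: harm_def sum_divide_distrib)
  finally show ?thesis by simp
qed

text \<open>The points to the right of \<open>z\<close> are ranked by counting from the smallest of
  them, those to the left from the largest. Consecutive points are \<sigma> apart and none is
  further than 1/2 from \<open>z\<close>, so ranks do not exceed \<open>1 / \<sigma>\<close>. The
  factor 2 stands for the two sides.\<close>

lemma peak_sum_near_integer:
  fixes A :: "nat set"
  assumes "finite A" "\<And>r. r \<in> A \<Longrightarrow> round (x + \<sigma> * real r) = z" "0 < P" "0 < \<sigma>"
  shows "(\<Sum>r\<in>A. peak P (x + \<sigma> * real r)) \<le> 2 * (P + harm (nat \<lfloor>1 / \<sigma>\<rfloor>) / \<sigma>)"
proof -
  define y where "y r = x + \<sigma> * real r - of_int z" for r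
  have dist_int: "dist_int (x + \<sigma> * real r) = \<bar>y r\<bar>" if "r \<in> A" for r
    using assms(2)[OF that] by (simp add: dist_int_def y_def)
  have half: "\<bar>y r\<bar> \<le> 1 / 2" if "r \<in> A" for r
    using dist_int[OF that] dist_int_le_half by metis
  have diff: "y r - y s = \<sigma> * (real r - real s)" for r s
    by (simp add: y_def algebra_simps)
  have le1: "n \<le> nat \<lfloor>1 / \<sigma>\<rfloor>" if "\<sigma> * real n \<le> 1" for n
    using that assms by (simp add: le_nat_floor field_simps)
  have one: "(\<Sum>r\<in>B. peak P (x + \<sigma> * real r)) \<le> P + harm (nat \<lfloor>1 / \<sigma>\<rfloor>) / \<sigma>"
    if "B \<subseteq> A" "rz \<in> B" "\<And>r. r \<in> B \<Longrightarrow> \<bar>y r\<bar> \<ge> \<sigma> * real (g r)" "inj_on g B" for B rz and g :: "nat \<Rightarrow> nat"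
  proof (rule sum_inj_le_harm[where g = g])
    fix r assume r: "r \<in> B"
    have le: "\<sigma> * real (g r) \<le> \<bar>y r\<bar>" using that(3)[OF r] .
    have "r \<in> A" using r that by auto
    from le half[OF this] show "g r \<le> nat \<lfloor>1 / \<sigma>\<rfloor>" by (intro le1) linarith
    show "peak P (x + \<sigma> * real r) \<le> 1 / (1 / P + real (g r) * \<sigma>)"
      unfolding peak_def dist_int[OF \<open>r \<in> A\<close>] using le assms
      by (intro divide_left_mono mult_pos_pos add_pos_nonneg) (auto simp: mult.commute)
  qed (use that assms in \<open>auto intro: finite_subset\<close>)
  have bnd0: "0 \<le> P + harm (nat \<lfloor>1 / \<sigma>\<rfloor>) / \<sigma>"
    using assms harm_nonneg[of "nat \<lfloor>1 / \<sigma>\<rfloor>", where ?'a = real] by (intro add_nonneg_nonneg) auto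
  have pos: "(\<Sum>r\<in>{r \<in> A. 0 \<le> y r}. peak P (x + \<sigma> * real r)) \<le> P + harm (nat \<lfloor>1 / \<sigma>\<rfloor>) / \<sigma>" (is "sum _ ?B \<le> _")
  proof (cases "?B = {}")
    case True
    show ?thesis unfolding True using bnd0 by simp
  next
    case False
    have fin: "finite ?B" using assms by auto
    define rz where "rz = Min ?B"
    have rz: "rz \<in> ?B" "\<And>r. r \<in> ?B \<Longrightarrow> rz \<le> r" using Min_in[OF fin False] Max_in[OF fin False] fin unfolding rz_def by auto
    show ?thesis
    proof (rule one[where g = "\<lambda>r. r - rz" and rz = rz])
      show "\<sigma> * real (r - rz) \<le> \<bar>y r\<bar>" if "r \<in> ?B" for r
        using rz(1) rz(2)[OF that] that diff[of r rz] by (simp add: of_nat_diff)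
      show "inj_on (\<lambda>r. r - rz) ?B"
      proof (rule inj_onI)
        fix r s assume "r \<in> ?B" "s \<in> ?B" "r - rz = s - rz"
        thus "r = s" using rz(2)[of r] rz(2)[of s] by (simp only: eq_diff_iff)
      qed
    qed (use rz in auto)
  qed
  have neg: "(\<Sum>r\<in>{r \<in> A. y r < 0}. peak P (x + \<sigma> * real r)) \<le> P + harm (nat \<lfloor>1 / \<sigma>\<rfloor>) / \<sigma>" (is "sum _ ?B \<le> _")
  proof (cases "?B = {}")
    case True
    show ?thesis unfolding True using bnd0 by simp
  next
    case False
    have fin: "finite ?B" using assms by auto
    define rz where "rz = Max ?B"
    have rz: "rz \<in> ?B" "\<And>r. r \<in> ?B \<Longrightarrow> r \<le> rz" using Min_in[OF fin False] Max_in[OF fin False] fin unfolding rz_def by auto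
    show ?thesis
    proof (rule one[where g = "\<lambda>r. rz - r" and rz = rz])
      show "\<sigma> * real (rz - r) \<le> \<bar>y r\<bar>" if "r \<in> ?B" for r
        using rz(1) rz(2)[OF that] that diff[of rz r] by (simp add: of_nat_diff)
      show "inj_on (\<lambda>r. rz - r) ?B" using rz(2) by (auto simp: inj_on_def) (metis diff_diff_cancel)
    qed (use rz in auto)
  qed
  have "(\<Sum>r\<in>A. peak P (x + \<sigma> * real r)) = (\<Sum>r\<in>{r \<in> A. 0 \<le> y r}. peak P (x + \<sigma> * real r))
      + (\<Sum>r\<in>{r \<in> A. y r < 0}. peak P (x + \<sigma> * real r))"
    using assms by (subst sum.union_disjoint[symmetric]) (auto intro!: sum.cong)
  thus ?thesis using pos neg by simp
qed

text \<open>The cost of all points of a progression with step \<sigma> that share their nearest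
  integer; the harmonic number plays the role of a logarithm of \<open>1 / \<sigma>\<close>.\<close>

definition peak_mass :: "real \<Rightarrow> real \<Rightarrow> real"
  where "peak_mass P \<sigma> = 2 * (P + harm (nat \<lfloor>1 / \<sigma>\<rfloor>) / \<sigma>)"

lemma peak_mass_nonneg: "0 < P \<Longrightarrow> 0 < \<sigma> \<Longrightarrow> 0 \<le> peak_mass P \<sigma>"
  using harm_nonneg[of "nat \<lfloor>1 / \<sigma>\<rfloor>", where ?'a = real] by (auto simp: peak_mass_def)

text \<open>Grouping by nearest integer: a stretch of length \<open>K * \<sigma>\<close> has at most
  \<open>K * \<sigma> + 2\<close> of them, and each group costs one
  \<open>peak_mass\<close>.\<close>

lemma peak_sum_spaced:
  assumes "0 < P" "0 < \<sigma>"
  shows "(\<Sum>r<K. peak P (x + \<sigma> * real r)) \<le> (real K * \<sigma> + 2) * peak_mass P \<sigma>"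
proof -
  let ?Z = "{round x..round (x + \<sigma> * real K)}"
  let ?y = "\<lambda>r::nat. round (x + \<sigma> * real r)"
  have "(\<Sum>r<K. peak P (x + \<sigma> * real r)) = (\<Sum>z\<in>?Z. \<Sum>r\<in>{r \<in> {..<K}. ?y r = z}. peak P (x + \<sigma> * real r))"
    using assms by (intro sum.group[symmetric]) (auto intro!: round_mono)
  also have "\<dots> \<le> (\<Sum>z\<in>?Z. peak_mass P \<sigma>)"
    unfolding peak_mass_def using assms by (intro sum_mono peak_sum_near_integer) auto
  also have "\<dots> = real (card ?Z) * peak_mass P \<sigma>" by simp
  also have "real (card ?Z) \<le> real K * \<sigma> + 2"
  proof -
    have "round x \<le> round (x + \<sigma> * real K)" using assms by (intro round_mono) auto
    moreover have "of_int (round (x + \<sigma> * real K)) - of_int (round x) \<le> \<sigma> * real K + 1"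
      using of_int_round_abs_le[of x] of_int_round_abs_le[of "x + \<sigma> * real K"] by linarith
    ultimately show ?thesis by (simp add: mult.commute)
  qed
  finally show ?thesis using peak_mass_nonneg[OF assms] by (simp add: mult_right_mono)
qed

lemma peak_sum_window:
  assumes "0 < P" "0 < \<sigma>"
  shows "(\<Sum>r\<in>{- int n..int n}. peak P (x + \<sigma> * of_int r)) \<le> ((2 * real n + 1) * \<sigma> + 2) * peak_mass P \<sigma>"
proof -
  have "(\<Sum>r\<in>{- int n..int n}. peak P (x + \<sigma> * of_int r))
      = (\<Sum>r<2 * n + 1. peak P ((x - \<sigma> * real n) + \<sigma> * real r))"
    by (rule sum.reindex_bij_witness[of _ "\<lambda>i. int i - int n" "\<lambda>r. nat (r + int n)"])
       (auto simp: algebra_simps of_nat_nat)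
  also have "\<dots> \<le> (real (2 * n + 1) * \<sigma> + 2) * peak_mass P \<sigma>"
    by (rule peak_sum_spaced[OF assms])
  finally show ?thesis by (simp add: add.commute)
qed

lemma sum_inverse_window: "(\<Sum>r\<in>{- int n..int n}. 1 / (\<bar>of_int r\<bar> + 1)) \<le> 2 * (harm (n + 1) :: real)"
proof -
  have "(\<Sum>r\<in>{- int n..int n}. 1 / (\<bar>of_int r\<bar> + 1) :: real)
      \<le> (\<Sum>r\<in>{0..int n}. 1 / (\<bar>of_int r\<bar> + 1)) + (\<Sum>r\<in>{- int n..0}. 1 / (\<bar>of_int r\<bar> + 1))"
  proof -
    have "{- int n..int n} = {0..int n} \<union> {- int n..-1}" by auto
    hence "(\<Sum>r\<in>{- int n..int n}. 1 / (\<bar>of_int r\<bar> + 1) :: real)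
        = (\<Sum>r\<in>{0..int n}. 1 / (\<bar>of_int r\<bar> + 1)) + (\<Sum>r\<in>{- int n..-1}. 1 / (\<bar>of_int r\<bar> + 1))"
      by (simp only:) (rule sum.union_disjoint, auto)
    also have "(\<Sum>r\<in>{- int n..-1}. 1 / (\<bar>of_int r\<bar> + 1) :: real) \<le> (\<Sum>r\<in>{- int n..0}. 1 / (\<bar>of_int r\<bar> + 1))"
      by (intro sum_mono2) auto
    finally show ?thesis by simp
  qed
  also have "(\<Sum>r\<in>{- int n..0}. 1 / (\<bar>of_int r\<bar> + 1) :: real) = (\<Sum>r\<in>{0..int n}. 1 / (\<bar>of_int r\<bar> + 1))"
    by (rule sum.reindex_bij_witness[of _ uminus uminus]) auto
  also have "(\<Sum>r\<in>{0..int n}. 1 / (\<bar>of_int r\<bar> + 1) :: real) = harm (n + 1)"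
    unfolding harm_def
    by (rule sum.reindex_bij_witness[of _ "\<lambda>k. int k - 1" "\<lambda>r. nat r + 1"]) (auto simp: field_simps)
  finally show ?thesis by simp
qed

text \<open>The kernel is, up to logarithms, its own maximal function: weighted averages around \<open>x\<close>
  at any scale are controlled by the value at \<open>x\<close>.\<close>
lemma peak_weighted_window:
  assumes "0 < P" "0 < \<sigma>"
  shows "(\<Sum>r\<in>{- int n..int n}. peak P (x + \<sigma> * of_int r) / (\<bar>of_int r\<bar> + 1))
       \<le> peak P x * (4 * harm (n + 1) + 4 * \<sigma> * ((2 * real n + 1) * \<sigma> + 2) * peak_mass P \<sigma>)"
proof -
  have pos: "0 < 1 / P + dist_int y" for y using assms by (simp add: add_pos_nonneg)
  \<comment> \<open>A dichotomy. If the shifted point is not much closer to an integer than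
    \<open>x\<close>, the kernel at most doubles. Otherwise the shift itself has at least half the
    length \<open>dist_int x\<close>, and then the weight \<open>1 / (\<bar>r\<bar> + 1)\<close> is
    at most \<open>4 * \<sigma> * peak P x\<close>.\<close>
  have pt: "peak P (x + \<sigma> * of_int r) / (\<bar>of_int r\<bar> + 1)
      \<le> 2 * peak P x * (1 / (\<bar>of_int r\<bar> + 1)) + 4 * \<sigma> * peak P x * peak P (x + \<sigma> * of_int r)" for r
  proof (cases "dist_int x \<le> 1 / P \<or> dist_int x \<le> 2 * dist_int (x + \<sigma> * of_int r)")
    case True
    have "1 / P + dist_int x \<le> 2 * (1 / P + dist_int (x + \<sigma> * of_int r))"
    proof -
      have "0 \<le> 1 / P" using assms(1) by simp
      thus ?thesis using True dist_int_nonneg[of "x + \<sigma> * of_int r"] by (smt (verit))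
    qed
    hence "peak P (x + \<sigma> * of_int r) \<le> 2 * peak P x"
      unfolding peak_def using pos[of x] pos[of "x + \<sigma> * of_int r"] by (simp add: field_simps)
    hence "peak P (x + \<sigma> * of_int r) / (\<bar>of_int r\<bar> + 1) \<le> 2 * peak P x / (\<bar>of_int r\<bar> + 1)"
      by (intro divide_right_mono) auto
    moreover have "0 \<le> 4 * \<sigma> * peak P x * peak P (x + \<sigma> * of_int r)"
      using assms by (intro mult_nonneg_nonneg peak_nonneg) auto
    ultimately show ?thesis by simp
  next
    case False
    hence nx: "1 / P < dist_int x" "2 * dist_int (x + \<sigma> * of_int r) < dist_int x" by auto
    have "dist_int x \<le> dist_int (x + \<sigma> * of_int r) + dist_int (- (\<sigma> * of_int r))"
      using dist_int_triangle[of "x + \<sigma> * of_int r" "- (\<sigma> * of_int r)"] by simp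
    hence "dist_int x \<le> 2 * (\<sigma> * \<bar>of_int r\<bar>)"
      using nx dist_int_le_abs[of "\<sigma> * of_int r"] assms by (simp add: abs_mult)
    hence a: "1 / P + dist_int x \<le> 4 * \<sigma> * (\<bar>of_int r\<bar> + 1)"
      using nx assms by (simp add: algebra_simps)
    have "1 / (\<bar>of_int r\<bar> + 1) \<le> 4 * \<sigma> * peak P x"
      unfolding peak_def using a pos[of x] by (simp add: field_simps)
    hence "peak P (x + \<sigma> * of_int r) * (1 / (\<bar>of_int r\<bar> + 1)) \<le> peak P (x + \<sigma> * of_int r) * (4 * \<sigma> * peak P x)"
      using peak_nonneg[OF assms(1)] by (intro mult_left_mono)
    moreover have "0 \<le> 2 * peak P x * (1 / (\<bar>of_int r\<bar> + 1))"
      using peak_nonneg[OF assms(1)] by simp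
    ultimately show ?thesis by (simp add: mult_ac)
  qed
  have "(\<Sum>r\<in>{- int n..int n}. peak P (x + \<sigma> * of_int r) / (\<bar>of_int r\<bar> + 1))
      \<le> 2 * peak P x * (\<Sum>r\<in>{- int n..int n}. 1 / (\<bar>of_int r\<bar> + 1))
        + 4 * \<sigma> * peak P x * (\<Sum>r\<in>{- int n..int n}. peak P (x + \<sigma> * of_int r))"
    unfolding sum_distrib_left sum.distrib[symmetric] by (intro sum_mono pt)
  also have "\<dots> \<le> 2 * peak P x * (2 * harm (n + 1))
        + 4 * \<sigma> * peak P x * (((2 * real n + 1) * \<sigma> + 2) * peak_mass P \<sigma>)"
    using assms peak_nonneg[OF assms(1)]
    by (intro add_mono mult_left_mono sum_inverse_window peak_sum_window) auto
  finally show ?thesis by (simp add: algebra_simps)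
qed

section \<open>The divisor bound and sums over products\<close>

lemma card_divisors_le:
  fixes \<epsilon> :: real assumes "0 < \<epsilon>"
  obtains C where "1 \<le> C" "\<And>n::nat. 0 < n \<Longrightarrow> real (card {d. d dvd n}) \<le> C * real n powr \<epsilon>"
proof -
  \<comment> \<open>Primes from \<open>B\<close> on satisfy
    \<open>p powr \<epsilon> \<ge> 2\<close>. Then \<open>a + 1 \<le> 2 ^ a\<close> is absorbed by
    the factor that \<open>p ^ a\<close> contributes to \<open>n powr \<epsilon>\<close>, and such
    primes cost nothing.\<close>
  define B where "B = nat \<lceil>2 powr (1 / \<epsilon>)\<rceil>"
  have B: "2 \<le> real p powr \<epsilon>" if "B \<le> p" for p
  proof -
    have "2 powr (1 / \<epsilon>) \<le> real p" using that unfolding B_def by linarith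
    hence "(2 powr (1 / \<epsilon>)) powr \<epsilon> \<le> real p powr \<epsilon>" using assms by (intro powr_mono2) auto
    thus ?thesis using assms by (simp add: powr_powr)
  qed
  \<comment> \<open>The price of one prime below \<open>B\<close>: by
    \<open>1 + u \<le> exp u\<close>, the factor \<open>a + 1\<close> is at most
    \<open>C0 * 2 powr (a * \<epsilon>)\<close> for every exponent \<open>a\<close>.\<close>
  define C0 where "C0 = max 1 (1 / (\<epsilon> * ln 2))"
  have C01: "1 \<le> C0" by (simp add: C0_def)
  have C0: "real (a + 1) \<le> C0 * 2 powr (real a * \<epsilon>)" for a
  proof -
    have "1 \<le> C0 * (\<epsilon> * ln 2)"
      using assms by (auto simp: C0_def max_def field_simps)
    hence "real a * 1 \<le> real a * (C0 * (\<epsilon> * ln 2))" by (intro mult_left_mono) auto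
    hence "real (a + 1) \<le> C0 * (1 + real a * \<epsilon> * ln 2)"
      using C01 by (simp add: algebra_simps)
    also have "\<dots> \<le> C0 * exp (real a * \<epsilon> * ln 2)"
      using C01 by (intro mult_left_mono exp_ge_add_one_self) auto
    finally show ?thesis by (simp add: powr_def)
  qed
  define s where "s n = {p. prime p \<and> p < B \<and> p dvd n}" for n
  have fs: "finite (s n)" for n by (rule finite_subset[of _ "{..<B}"]) (auto simp: s_def)
  \<comment> \<open>Strong induction that splits off the full power \<open>p ^ a\<close> of one
    prime: the number of divisors grows by a factor of at most \<open>a + 1\<close>, and
    \<open>s n\<close> gains \<open>p\<close> precisely when \<open>p < B\<close>.\<close>
  have main: "real (card {d. d dvd n}) \<le> C0 ^ card (s n) * real n powr \<epsilon>" if "0 < n" for n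
    using that
  proof (induction n rule: less_induct)
    case (less n)
    show ?case
    proof (cases "n = 1")
      case True
      have "s 1 = {}" by (auto simp: s_def)
      thus ?thesis using True by simp
    next
      case False
      then obtain p where p: "prime p" "p dvd n" using prime_factor_nat by blast
      define a where "a = multiplicity p n"
      have "\<not> is_unit p" "n \<noteq> 0" using p less.prems by auto
      then obtain m where m: "n = p ^ a * m" "\<not> p dvd m"
        unfolding a_def using multiplicity_decompose'[of n p] by metis
      have a1: "1 \<le> a" using p m by (cases a) auto
      have m0: "0 < m" using m less.prems by (cases m) auto
      have "1 < p ^ a" using p a1 by (intro one_less_power prime_gt_1_nat) auto
      hence mn: "m < n" using m m0 by simp
      note IH = less.IH[OF mn m0]
      have sub: "{d. d dvd n} \<subseteq> (\<lambda>(i, e). p ^ i * e) ` ({..a} \<times> {e. e dvd m})"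
      proof
        fix d assume "d \<in> {d. d dvd n}"
        hence "d dvd p ^ a * m" using m by simp
        then obtain b c where bc: "d = b * c" "b dvd p ^ a" "c dvd m"
          using division_decomp by blast
        then obtain i where "i \<le> a" "b = p ^ i" using p divides_primepow_nat by blast
        thus "d \<in> (\<lambda>(i, e). p ^ i * e) ` ({..a} \<times> {e. e dvd m})" using bc by auto
      qed
      have fm: "finite {e. e dvd m}" using m0 by simp
      have "card {d. d dvd n} \<le> card ({..a} \<times> {e. e dvd m})"
        using sub fm by (meson card_image_le card_mono finite_SigmaI finite_atMost finite_imageI le_trans)
      hence "card {d. d dvd n} \<le> (a + 1) * card {e. e dvd m}"
        by (simp add: card_cartesian_product)
      hence c1: "real (card {d. d dvd n}) \<le> real (a + 1) * real (card {e. e dvd m})"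
        by (metis of_nat_le_iff of_nat_mult)
      have np: "real n powr \<epsilon> = real p powr (real a * \<epsilon>) * real m powr \<epsilon>"
        using p m0 by (simp add: m powr_mult powr_powr prime_gt_0_nat flip: powr_realpow)
      have qdvd: "q dvd n \<longleftrightarrow> q = p \<or> q dvd m" if q: "prime q" for q
      proof -
        have "q dvd n \<longleftrightarrow> q dvd p ^ a \<or> q dvd m"
          unfolding m(1) by (rule prime_dvd_mult_iff[OF q])
        also have "q dvd p ^ a \<longleftrightarrow> q dvd p"
          using prime_dvd_power_iff[OF q] a1 by simp
        also have "q dvd p \<longleftrightarrow> q = p"
          using primes_dvd_imp_eq[OF q p(1)] by auto
        finally show ?thesis .
      qed
      have "real (a + 1) * C0 ^ card (s m) \<le> C0 ^ card (s n) * real p powr (real a * \<epsilon>)"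
      proof (cases "p < B")
        case True
        have "s n = insert p (s m)"
          unfolding s_def using p(1) True by (auto simp: qdvd)
        moreover have "p \<notin> s m" using m by (auto simp: s_def)
        ultimately have cs: "card (s n) = Suc (card (s m))" using fs by simp
        have "real (a + 1) \<le> C0 * 2 powr (real a * \<epsilon>)" by (rule C0)
        also have "\<dots> \<le> C0 * real p powr (real a * \<epsilon>)"
          using C01 assms prime_ge_2_nat[OF p(1)] by (intro mult_left_mono powr_mono2) auto
        finally have "real (a + 1) * C0 ^ card (s m) \<le> C0 * real p powr (real a * \<epsilon>) * C0 ^ card (s m)"
          using C01 by (intro mult_right_mono) auto
        thus ?thesis by (simp add: cs mult_ac)
      next
        case False
        have "s n = s m"
          unfolding s_def using p(1) False by (auto simp: qdvd)
        moreover have "real (a + 1) \<le> real p powr (real a * \<epsilon>)"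
        proof -
          have "a + 1 \<le> 2 ^ a" unfolding Suc_eq_plus1[symmetric] by (intro Suc_leI less_exp)
          hence "real (a + 1) \<le> 2 ^ a" by (metis of_nat_le_iff of_nat_numeral of_nat_power)
          also have "\<dots> \<le> (real p powr \<epsilon>) ^ a" using B False by (intro power_mono) auto
          also have "\<dots> = real p powr (real a * \<epsilon>)"
            using p by (simp add: powr_powr mult.commute prime_gt_0_nat flip: powr_realpow)
          finally show ?thesis .
        qed
        ultimately show ?thesis using C01 by (simp add: mult.commute mult_right_mono)
      qed
      hence "real (a + 1) * C0 ^ card (s m) * real m powr \<epsilon> \<le> C0 ^ card (s n) * real n powr \<epsilon>"
        unfolding np by (simp add: mult_right_mono flip: mult.assoc)
      moreover have "real (a + 1) * real (card {e. e dvd m}) \<le> real (a + 1) * (C0 ^ card (s m) * real m powr \<epsilon>)"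
        by (intro mult_left_mono IH) auto
      ultimately show ?thesis using c1 unfolding mult.assoc by linarith
    qed
  qed
  show ?thesis
  proof (rule that[of "C0 ^ B"])
    show "1 \<le> C0 ^ B" using C01 by (rule one_le_power)
    fix n :: nat assume n: "0 < n"
    have "card (s n) \<le> card {..<B}" by (rule card_mono) (auto simp: s_def)
    hence "C0 ^ card (s n) \<le> C0 ^ B" using C01 by (intro power_increasing) auto
    thus "real (card {d. d dvd n}) \<le> C0 ^ B * real n powr \<epsilon>"
      using main[OF n] by (meson mult_right_mono order_trans powr_ge_zero)
  qed
qed

text \<open>The kernel sees only the product \<open>k = h * l\<close>, and each \<open>k\<close> has
  at most \<tau> representations. Since \<open>l \<le> L\<close>, the factor \<open>1 / h\<close> is
  at most \<open>1 / (k div L)\<close>, which is constant on blocks of length \<open>L\<close>;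
  every block is a progression with step \<mu>, and the blocks add up harmonically.\<close>

lemma peak_hyperbola_sum:
  fixes H L :: nat
  assumes "0 < P" "0 < \<mu>" and \<tau>: "\<And>k. 0 < k \<Longrightarrow> k \<le> H * L \<Longrightarrow> real (card {d. d dvd k}) \<le> \<tau>" and "0 \<le> \<tau>"
  shows "(\<Sum>h\<in>{1..H}. \<Sum>l\<in>{1..L}. peak P (\<mu> * real l * real h) / real h)
       \<le> \<tau> * (1 + harm H) * ((real L * \<mu> + 2) * peak_mass P \<mu>)"
proof (cases "L = 0")
  case True
  show ?thesis using True assms peak_mass_nonneg[OF assms(1,2)] harm_nonneg[of H, where ?'a = real] by auto
next
  case False
  hence L: "0 < L" by simp
  \<comment> \<open>The \<open>max 1\<close> serves the block \<open>k < L\<close>, where the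
    quotient is 0 but \<open>h \<ge> 1\<close> still holds.\<close>
  define w where "w k = peak P (\<mu> * real k) / real (max 1 (k div L))" for k
  have w0: "0 \<le> w k" for k unfolding w_def using peak_nonneg[OF assms(1)] by auto
  let ?A = "{1..H} \<times> {1..L}"
  let ?f = "\<lambda>(h, l). h * l"
  have "(\<Sum>h\<in>{1..H}. \<Sum>l\<in>{1..L}. peak P (\<mu> * real l * real h) / real h)
      = (\<Sum>(h, l)\<in>?A. peak P (\<mu> * real l * real h) / real h)"
    by (simp add: sum.cartesian_product)
  also have "\<dots> \<le> (\<Sum>z\<in>?A. w (?f z))"
  proof (intro sum_mono, clarify)
    fix h l assume hl: "h \<in> {1..H}" "l \<in> {1..L}"
    have "h * l div L \<le> h * L div L" using hl by (intro div_le_mono mult_le_mono2) auto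
    hence "h * l div L \<le> h" using L by simp
    hence "max 1 (h * l div L) \<le> h" using hl by auto
    thus "peak P (\<mu> * real l * real h) / real h \<le> w (h * l)"
      unfolding w_def using peak_nonneg[OF assms(1)]
      by (simp only: of_nat_mult mult_ac) (intro divide_left_mono, auto)
  qed
  also have "\<dots> = (\<Sum>k\<in>{1..H * L}. \<Sum>z\<in>{z \<in> ?A. ?f z = k}. w (?f z))"
    by (intro sum.group[symmetric]) (auto intro!: mult_le_mono, (metis Suc_leI mult_pos_pos Suc_le_lessD One_nat_def)?)
  also have "\<dots> = (\<Sum>k\<in>{1..H * L}. real (card {z \<in> ?A. ?f z = k}) * w k)"
    by (intro sum.cong refl) simp
  also have "\<dots> \<le> (\<Sum>k\<in>{1..H * L}. \<tau> * w k)"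
  proof (intro sum_mono mult_right_mono w0)
    fix k assume k: "k \<in> {1..H * L}"
    have "card {z \<in> ?A. ?f z = k} \<le> card {d. d dvd k}"
    proof (rule card_inj_on_le[where f = fst])
      show "inj_on fst {z \<in> ?A. ?f z = k}" by (auto simp: inj_on_def)
      show "finite {d. d dvd k}" using k by simp
    qed auto
    thus "real (card {z \<in> ?A. ?f z = k}) \<le> \<tau>" using \<tau>[of k] k by force
  qed
  also have "\<dots> \<le> (\<Sum>k<(H + 1) * L. \<tau> * w k)"
    using assms w0 L by (intro sum_mono2) (auto intro!: mult_nonneg_nonneg)
  also have "\<dots> = \<tau> * (\<Sum>k<(H + 1) * L. w k)"
    by (simp only: sum_distrib_left)
  finally have 1: "(\<Sum>h\<in>{1..H}. \<Sum>l\<in>{1..L}. peak P (\<mu> * real l * real h) / real h)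
      \<le> \<tau> * (\<Sum>k<(H + 1) * L. w k)" .
  have "(\<Sum>k<(H + 1) * L. w k) = (\<Sum>i<H + 1. \<Sum>k\<in>{i * L..<i * L + L}. w k)"
    by (rule sum.nat_group[symmetric])
  also have "\<dots> \<le> (\<Sum>i<H + 1. (real L * \<mu> + 2) * peak_mass P \<mu> * (1 / real (max 1 i)))"
  proof (intro sum_mono)
    fix i
    have "(\<Sum>k\<in>{i * L..<i * L + L}. w k) = (\<Sum>r<L. peak P (\<mu> * real (i * L) + \<mu> * real r) * (1 / real (max 1 i)))"
    proof (rule sum.reindex_bij_witness[of _ "\<lambda>r. i * L + r" "\<lambda>k. k - i * L"])
      fix k assume k: "k \<in> {i * L..<i * L + L}"
      have "k div L = i" using k L by (intro div_nat_eqI) (auto simp: mult.commute add.commute)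
      moreover have "real k = real (i * L) + real (k - i * L)" using k by (auto simp flip: of_nat_add)
      ultimately show "peak P (\<mu> * real (i * L) + \<mu> * real (k - i * L)) * (1 / real (max 1 i)) = w k"
        unfolding w_def by (simp flip: distrib_left)
    qed auto
    also have "\<dots> = (\<Sum>r<L. peak P (\<mu> * real (i * L) + \<mu> * real r)) * (1 / real (max 1 i))"
      by (simp only: sum_distrib_right)
    also have "\<dots> \<le> (real L * \<mu> + 2) * peak_mass P \<mu> * (1 / real (max 1 i))"
      using assms by (intro mult_right_mono peak_sum_spaced) auto
    finally show "(\<Sum>k\<in>{i * L..<i * L + L}. w k) \<le> (real L * \<mu> + 2) * peak_mass P \<mu> * (1 / real (max 1 i))" .
  qed
  also have "\<dots> = (real L * \<mu> + 2) * peak_mass P \<mu> * (\<Sum>i<H + 1. 1 / real (max 1 i))"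
    by (simp only: sum_distrib_left)
  also have "(\<Sum>i<H + 1. 1 / real (max 1 i)) = 1 + harm H"
    by (simp only: lessThan_Suc_atMost Suc_eq_plus1[symmetric] atMost_atLeast0 sum.atLeast_Suc_atMost[of 0 H] harm_def)
       (simp add: max_def inverse_eq_divide)
  finally have "(\<Sum>k<(H + 1) * L. w k) \<le> (real L * \<mu> + 2) * peak_mass P \<mu> * (1 + harm H)" .
  from mult_left_mono[OF this \<open>0 \<le> \<tau>\<close>] 1 show ?thesis by (simp only: mult_ac)
qed

section \<open>Weyl differencing\<close>

lemma sum_differences:
  fixes G :: "int \<Rightarrow> int \<Rightarrow> 'a::comm_monoid_add"
  shows "(\<Sum>z\<in>{a..b}. \<Sum>w\<in>{a..b}. G z w)
       = (\<Sum>k\<in>{-(b - a)..b - a}. \<Sum>z\<in>{max a (a - k)..min b (b - k)}. G z (z + k))"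
proof -
  have "(\<Sum>z\<in>{a..b}. \<Sum>w\<in>{a..b}. G z w) = (\<Sum>(z, w)\<in>{a..b} \<times> {a..b}. G z w)"
    by (simp add: sum.cartesian_product)
  also have "\<dots> = (\<Sum>(k, z)\<in>(SIGMA k:{-(b - a)..b - a}. {max a (a - k)..min b (b - k)}). G z (z + k))"
    by (rule sum.reindex_bij_witness[of _ "\<lambda>(k, z). (z, z + k)" "\<lambda>(z, w). (w - z, z)"]) auto
  also have "\<dots> = (\<Sum>k\<in>{-(b - a)..b - a}. \<Sum>z\<in>{max a (a - k)..min b (b - k)}. G z (z + k))"
    by (simp add: sum.Sigma)
  finally show ?thesis .
qed

text \<open>The shape of the height on a plane. With the factor \<open>\<mu> / 2\<close>, a
  difference of two values is linear in the base point with coefficients that are integer multiples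
  of \<mu>.\<close>

definition quad2 :: "int \<Rightarrow> int \<Rightarrow> int \<Rightarrow> real \<Rightarrow> real \<Rightarrow> real \<Rightarrow> real \<Rightarrow> int \<Rightarrow> int \<Rightarrow> real"
  where "quad2 D B E \<mu> g0 g1 g2 z1 z2 = g0 + g1 * of_int z1 + g2 * of_int z2
    - \<mu> / 2 * of_int (D * z1\<^sup>2 + 2 * B * z1 * z2 + E * z2\<^sup>2)"

definition peak_total :: "real \<Rightarrow> nat \<Rightarrow> real \<Rightarrow> real"
  where "peak_total P L x = (\<Sum>l\<in>{- int L..int L}. peak P (x * of_int l))"

lemma peak_total_nonneg: "0 < P \<Longrightarrow> 0 \<le> peak_total P L x"
  unfolding peak_total_def by (intro sum_nonneg peak_nonneg)

text \<open>Weyl differencing on a square: the inner sums have linear phases in both variables,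
  and nondegeneracy makes the two frequencies independent.\<close>
lemma weyl_quad2:
  fixes D B E :: int and N L :: nat
  assumes "D * E \<noteq> B\<^sup>2" "0 < P" "2 * real N + 1 \<le> P"
    and L: "(\<bar>D\<bar> + \<bar>B\<bar>) * (2 * int N) \<le> int L" "(\<bar>B\<bar> + \<bar>E\<bar>) * (2 * int N) \<le> int L"
  shows "norm (\<Sum>z1\<in>{- int N..int N}. \<Sum>z2\<in>{- int N..int N}. echar (w * quad2 D B E \<mu> g0 g1 g2 z1 z2))
      \<le> 2 * peak_total P L (\<mu> * w)"
proof -
  let ?I = "{- int N..int N}" and ?K = "{-(int N - - int N)..int N - - int N}"
  let ?J = "\<lambda>k. {max (- int N) (- int N - k)..min (int N) (int N - k)}"
  define f where "f = quad2 D B E \<mu> g0 g1 g2"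
  define S where "S = (\<Sum>z1\<in>?I. \<Sum>z2\<in>?I. echar (w * f z1 z2))"
  define l1 where "l1 k1 k2 = D * k1 + B * k2" for k1 k2
  define l2 where "l2 k1 k2 = B * k1 + E * k2" for k1 k2
  define q where "q z1 z2 k1 k2 = echar (w * f (z1 + k1) (z2 + k2)) * cnj (echar (w * f z1 z2))" for z1 z2 k1 k2
  define c where "c k1 k2 = f k1 k2 - g0" for k1 k2
  have diff: "f (z1 + k1) (z2 + k2) - f z1 z2 = c k1 k2 - \<mu> * of_int (l1 k1 k2) * of_int z1 - \<mu> * of_int (l2 k1 k2) * of_int z2"
    for z1 z2 k1 k2
    by (simp add: f_def c_def quad2_def l1_def l2_def) (simp add: field_simps power2_eq_square)
  have q: "q z1 z2 k1 k2 = echar (w * c k1 k2) * echar (- (\<mu> * w * of_int (l1 k1 k2)) * of_int z1)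
      * echar (- (\<mu> * w * of_int (l2 k1 k2)) * of_int z2)" for z1 z2 k1 k2
  proof -
    have "q z1 z2 k1 k2 = echar (w * (f (z1 + k1) (z2 + k2) - f z1 z2))"
      by (simp add: q_def echar_diff right_diff_distrib)
    also have "w * (f (z1 + k1) (z2 + k2) - f z1 z2)
        = w * c k1 k2 + (- (\<mu> * w * of_int (l1 k1 k2)) * of_int z1) + (- (\<mu> * w * of_int (l2 k1 k2)) * of_int z2)"
      unfolding diff by (simp add: algebra_simps)
    finally show ?thesis by (simp only: echar_add)
  qed
  have "S * cnj S = (\<Sum>z1\<in>?I. \<Sum>w1\<in>?I. \<Sum>z2\<in>?I. \<Sum>w2\<in>?I. echar (w * f w1 w2) * cnj (echar (w * f z1 z2)))"
  proof -
    have "S * cnj S = (\<Sum>z1\<in>?I. cnj (\<Sum>z2\<in>?I. echar (w * f z1 z2)) * S)"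
      by (simp add: S_def sum_distrib_right sum_distrib_left mult.commute)
    also have "\<dots> = (\<Sum>z1\<in>?I. \<Sum>w1\<in>?I. cnj (\<Sum>z2\<in>?I. echar (w * f z1 z2)) * (\<Sum>w2\<in>?I. echar (w * f w1 w2)))"
      by (simp add: S_def sum_distrib_left)
    also have "\<dots> = (\<Sum>z1\<in>?I. \<Sum>w1\<in>?I. \<Sum>z2\<in>?I. \<Sum>w2\<in>?I. echar (w * f w1 w2) * cnj (echar (w * f z1 z2)))"
      by (intro sum.cong refl, simp only: cnj_sum sum_product, intro sum.cong refl, rule mult.commute)
    finally show ?thesis .
  qed
  also have "\<dots> = (\<Sum>k1\<in>?K. \<Sum>z1\<in>?J k1. \<Sum>z2\<in>?I. \<Sum>w2\<in>?I. echar (w * f (z1 + k1) w2) * cnj (echar (w * f z1 z2)))"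
    by (rule sum_differences)
  also have "\<dots> = (\<Sum>k1\<in>?K. \<Sum>z1\<in>?J k1. \<Sum>k2\<in>?K. \<Sum>z2\<in>?J k2. q z1 z2 k1 k2)"
    unfolding q_def by (rule sum.cong[OF refl], rule sum.cong[OF refl], rule sum_differences)
  also have "\<dots> = (\<Sum>k1\<in>?K. \<Sum>k2\<in>?K. \<Sum>z1\<in>?J k1. \<Sum>z2\<in>?J k2. q z1 z2 k1 k2)"
    by (rule sum.cong[OF refl], rule sum.swap)
  also have "\<dots> = (\<Sum>k1\<in>?K. \<Sum>k2\<in>?K. echar (w * c k1 k2)
      * (\<Sum>z1\<in>?J k1. echar (- (\<mu> * w * of_int (l1 k1 k2)) * of_int z1))
      * (\<Sum>z2\<in>?J k2. echar (- (\<mu> * w * of_int (l2 k1 k2)) * of_int z2)))"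
    by (simp only: q sum_distrib_left[symmetric] sum_distrib_right[symmetric])
  finally have SS: "S * cnj S = \<dots>" .
  have geo: "norm (\<Sum>z\<in>?J k. echar (- (\<mu> * w * of_int l) * of_int z)) \<le> 2 * peak P (\<mu> * w * of_int l)" for k l
  proof -
    have "of_int (min (int N) (int N - k) - max (- int N) (- int N - k) + 1) \<le> P"
    proof -
      have "min (int N) (int N - k) - max (- int N) (- int N - k) + 1 \<le> 2 * int N + 1"
        by (simp add: min_def max_def)
      hence "of_int (min (int N) (int N - k) - max (- int N) (- int N - k) + 1) \<le> (of_int (2 * int N + 1) :: real)"
        by (simp only: of_int_le_iff)
      thus ?thesis using assms(3) by simp
    qed
    from geometric_exp_sum[OF assms(2) this, of "- (\<mu> * w * of_int l)"]
    show ?thesis by (simp only: peak_minus)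
  qed
  have "(norm S)\<^sup>2 = norm (S * cnj S)"
    by (simp add: norm_mult power2_eq_square)
  also have "\<dots> \<le> (\<Sum>k1\<in>?K. \<Sum>k2\<in>?K. 4 * (peak P (\<mu> * w * of_int (l1 k1 k2)) * peak P (\<mu> * w * of_int (l2 k1 k2))))"
    unfolding SS
  proof (intro order_trans[OF norm_sum] sum_mono)
    fix k1 k2
    have "norm (\<Sum>z1\<in>?J k1. echar (- (\<mu> * w * of_int (l1 k1 k2)) * of_int z1))
      * norm (\<Sum>z2\<in>?J k2. echar (- (\<mu> * w * of_int (l2 k1 k2)) * of_int z2))
      \<le> (2 * peak P (\<mu> * w * of_int (l1 k1 k2))) * (2 * peak P (\<mu> * w * of_int (l2 k1 k2)))"
      using peak_nonneg[OF assms(2)] by (intro mult_mono geo) auto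
    thus "norm (echar (w * c k1 k2) * (\<Sum>z1\<in>?J k1. echar (- (\<mu> * w * of_int (l1 k1 k2)) * of_int z1))
      * (\<Sum>z2\<in>?J k2. echar (- (\<mu> * w * of_int (l2 k1 k2)) * of_int z2)))
      \<le> 4 * (peak P (\<mu> * w * of_int (l1 k1 k2)) * peak P (\<mu> * w * of_int (l2 k1 k2)))"
      by (simp add: norm_mult)
  qed
  also have "\<dots> = 4 * (\<Sum>(k1, k2)\<in>?K \<times> ?K. peak P (\<mu> * w * of_int (l1 k1 k2)) * peak P (\<mu> * w * of_int (l2 k1 k2)))"
    by (simp add: sum.cartesian_product sum_distrib_left case_prod_unfold)
  also have "(\<Sum>(k1, k2)\<in>?K \<times> ?K. peak P (\<mu> * w * of_int (l1 k1 k2)) * peak P (\<mu> * w * of_int (l2 k1 k2)))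
      = (\<Sum>z\<in>(\<lambda>(k1, k2). (l1 k1 k2, l2 k1 k2)) ` (?K \<times> ?K). peak P (\<mu> * w * of_int (fst z)) * peak P (\<mu> * w * of_int (snd z)))"
  proof (subst sum.reindex)
    show "inj_on (\<lambda>(k1, k2). (l1 k1 k2, l2 k1 k2)) (?K \<times> ?K)"
    proof (rule inj_onI, clarify)
      fix a b a' b' :: int
      assume "l1 a b = l1 a' b'" "l2 a b = l2 a' b'"
      hence e1: "D * (a - a') + B * (b - b') = 0" and e2: "B * (a - a') + E * (b - b') = 0"
        by (simp_all add: l1_def l2_def algebra_simps)
      have "(D * E - B\<^sup>2) * (a - a') = 0" "(D * E - B\<^sup>2) * (b - b') = 0"
        using e1 e2 by algebra+
      thus "a = a' \<and> b = b'" using assms(1) by simp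
    qed
  qed (auto intro!: sum.cong)
  \<comment> \<open>Enlarging the image to a whole square decouples the two frequencies. The sum
    becomes the square of \<open>peak_total\<close>, so taking the root of
    \<open>(norm S)\<^sup>2\<close> loses nothing.\<close>
  also have "\<dots> \<le> (\<Sum>z\<in>{- int L..int L} \<times> {- int L..int L}. peak P (\<mu> * w * of_int (fst z)) * peak P (\<mu> * w * of_int (snd z)))"
  proof (rule sum_mono2)
    have b: "\<bar>u * k1 + v * k2\<bar> \<le> int L"
      if "\<bar>k1\<bar> \<le> 2 * int N" "\<bar>k2\<bar> \<le> 2 * int N" "(\<bar>u\<bar> + \<bar>v\<bar>) * (2 * int N) \<le> int L" for u v k1 k2
    proof -
      have "\<bar>u * k1\<bar> \<le> \<bar>u\<bar> * (2 * int N)" "\<bar>v * k2\<bar> \<le> \<bar>v\<bar> * (2 * int N)"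
        using that by (auto simp: abs_mult intro!: mult_left_mono)
      thus ?thesis using that(3) by (simp add: distrib_right)
    qed
    show "(\<lambda>(k1, k2). (l1 k1 k2, l2 k1 k2)) ` (?K \<times> ?K) \<subseteq> {- int L..int L} \<times> {- int L..int L}"
    proof clarify
      fix k1 k2 assume k: "k1 \<in> ?K" "k2 \<in> ?K"
      have "\<bar>l1 k1 k2\<bar> \<le> int L" "\<bar>l2 k1 k2\<bar> \<le> int L"
        unfolding l1_def l2_def using k L by (auto intro!: b)
      thus "l1 k1 k2 \<in> {- int L..int L} \<and> l2 k1 k2 \<in> {- int L..int L}" by auto
    qed
  qed (use peak_nonneg[OF assms(2)] in auto)
  also have "\<dots> = (peak_total P L (\<mu> * w))\<^sup>2"
    by (simp add: peak_total_def power2_eq_square sum_product sum.cartesian_product case_prod_unfold)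
  finally have "(norm S)\<^sup>2 \<le> (2 * peak_total P L (\<mu> * w))\<^sup>2"
    by (simp add: power_mult_distrib)
  hence "norm S \<le> 2 * peak_total P L (\<mu> * w)"
    by (rule power2_le_imp_le) (simp add: peak_total_nonneg[OF assms(2)])
  thus ?thesis by (simp add: S_def f_def)
qed

section \<open>A piecewise linear sawtooth and the Fejer kernel\<close>

definition ramp :: "real \<Rightarrow> real"
  where "ramp x = max 0 (min 1 x)"

lemma ramp_bounds: "0 \<le> ramp x" "ramp x \<le> 1"
  by (auto simp: ramp_def)

lemma ramp_mono: "x \<le> y \<Longrightarrow> ramp x \<le> ramp y"
  by (auto simp: ramp_def)

lemma ramp_lipschitz: "\<bar>ramp x - ramp y\<bar> \<le> \<bar>x - y\<bar>"
  by (auto simp: ramp_def)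

lemma ramp_reflect: "ramp (1 - x) = 1 - ramp x"
  by (auto simp: ramp_def)

lemma ramp_eq: "x \<le> 0 \<Longrightarrow> ramp x = 0" "1 \<le> x \<Longrightarrow> ramp x = 1" "0 \<le> x \<Longrightarrow> x \<le> 1 \<Longrightarrow> ramp x = x"
  by (auto simp: ramp_def)

text \<open>The graph joins \<open>(- \<delta>, 0)\<close>, \<open>(0, 1)\<close>, \<open>(1 - \<delta>, - 1)\<close> and \<open>(1, 0)\<close>, so that the integer
  translates of \<open>tooth\<close> add up to a Lipschitz version of \<open>defect\<close> below.\<close>
definition tooth :: "real \<Rightarrow> real \<Rightarrow> real"
  where "tooth \<delta> t = ramp ((t + \<delta>) / \<delta>) - 2 * ramp (t / (1 - \<delta>)) + ramp ((t - 1 + \<delta>) / \<delta>)"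

lemma tooth_zero:
  assumes "0 < \<delta>" "\<delta> \<le> 1 / 2" "t \<le> - \<delta> \<or> 1 \<le> t"
  shows "tooth \<delta> t = 0"
proof (cases "t \<le> - \<delta>")
  case True
  thus ?thesis using assms by (simp add: tooth_def ramp_eq divide_simps)
next
  case False
  hence "1 \<le> t" using assms by auto
  thus ?thesis using assms by (simp add: tooth_def ramp_eq divide_simps)
qed

lemma tooth_abs_le: "\<bar>tooth \<delta> t\<bar> \<le> 2"
  using ramp_bounds[of "(t + \<delta>) / \<delta>"] ramp_bounds[of "t / (1 - \<delta>)"] ramp_bounds[of "(t - 1 + \<delta>) / \<delta>"]
  by (simp add: tooth_def)

text \<open>The graph is point symmetric about \<open>((1 - \<delta>) / 2, 0)\<close>; this is what
  makes the grid sum vanish in \<open>tooth_sum_zero\<close>.\<close>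

lemma tooth_reflect:
  assumes "0 < \<delta>" "\<delta> \<le> 1 / 2"
  shows "tooth \<delta> (1 - \<delta> - t) = - tooth \<delta> t"
proof -
  have "(1 - \<delta> - t + \<delta>) / \<delta> = 1 - (t - 1 + \<delta>) / \<delta>" "(1 - \<delta> - t) / (1 - \<delta>) = 1 - t / (1 - \<delta>)"
    "(1 - \<delta> - t - 1 + \<delta>) / \<delta> = 1 - (t + \<delta>) / \<delta>"
    using assms by (simp_all add: field_simps)
  thus ?thesis by (simp add: tooth_def ramp_reflect)
qed

lemma tooth_lipschitz:
  assumes "0 < \<delta>" "\<delta> \<le> 1 / 2"
  shows "\<bar>tooth \<delta> t - tooth \<delta> s\<bar> \<le> 4 / \<delta> * \<bar>t - s\<bar>"
proof -
  have 1: "\<bar>ramp ((t + \<delta>) / \<delta>) - ramp ((s + \<delta>) / \<delta>)\<bar> \<le> 1 / \<delta> * \<bar>t - s\<bar>"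
    using ramp_lipschitz[of "(t + \<delta>) / \<delta>" "(s + \<delta>) / \<delta>"] assms
    by (simp add: abs_divide flip: diff_divide_distrib)
  have 3: "\<bar>ramp ((t - 1 + \<delta>) / \<delta>) - ramp ((s - 1 + \<delta>) / \<delta>)\<bar> \<le> 1 / \<delta> * \<bar>t - s\<bar>"
    using ramp_lipschitz[of "(t - 1 + \<delta>) / \<delta>" "(s - 1 + \<delta>) / \<delta>"] assms
    by (simp add: abs_divide flip: diff_divide_distrib)
  have "\<bar>ramp (t / (1 - \<delta>)) - ramp (s / (1 - \<delta>))\<bar> \<le> 1 / (1 - \<delta>) * \<bar>t - s\<bar>"
    using ramp_lipschitz[of "t / (1 - \<delta>)" "s / (1 - \<delta>)"] assms
    by (simp add: abs_divide flip: diff_divide_distrib)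
  also have "\<dots> \<le> 1 / \<delta> * \<bar>t - s\<bar>"
    using assms by (intro mult_right_mono divide_left_mono) auto
  finally have 2: "\<bar>ramp (t / (1 - \<delta>)) - ramp (s / (1 - \<delta>))\<bar> \<le> 1 / \<delta> * \<bar>t - s\<bar>" .
  have "4 / \<delta> * \<bar>t - s\<bar> = 4 * (1 / \<delta> * \<bar>t - s\<bar>)" by simp
  with 1 2 3 show ?thesis unfolding tooth_def by linarith
qed

lemma ramp_variation:
  assumes "\<And>s::int. g (s - 1) \<le> g s" "a \<le> b"
  shows "(\<Sum>s\<in>{a..b}. \<bar>ramp (g s) - ramp (g (s - 1))\<bar>) \<le> 1"
proof -
  have "(\<Sum>s\<in>{a..b}. \<bar>ramp (g s) - ramp (g (s - 1))\<bar>) = (\<Sum>s\<in>{a..b}. ramp (g s) - ramp (g (s - 1)))"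
    using assms ramp_mono by (intro sum.cong) auto
  also have "\<dots> = ramp (g b) - ramp (g (a - 1))"
    using assms(2)
  proof (induction rule: int_ge_induct)
    case (step i)
    have "{a..i + 1} = insert (i + 1) {a..i}" using step.hyps by auto
    thus ?case using step.IH by simp
  qed simp
  also have "\<dots> \<le> 1" using ramp_bounds[of "g b"] ramp_bounds[of "g (a - 1)"] by simp
  finally show ?thesis .
qed

text \<open>Three monotone ramps with coefficients 1, 2 and 1 give \<open>1 + 2 + 1\<close>. Unlike
  the Lipschitz constant, this bound does not grow as \<delta> shrinks, so the steep ramps do not
  spoil the decay of the coefficients.\<close>

lemma tooth_variation:
  assumes "0 < \<delta>" "\<delta> \<le> 1 / 2" "0 < M" "a \<le> b"
  shows "(\<Sum>s\<in>{a..b}. \<bar>tooth \<delta> (of_int s / M) - tooth \<delta> (of_int (s - 1) / M)\<bar>) \<le> 4"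
proof -
  define g1 where "g1 s = (of_int s / M + \<delta>) / \<delta>" for s :: int
  define g2 where "g2 s = (of_int s / M) / (1 - \<delta>)" for s :: int
  define g3 where "g3 s = (of_int s / M - 1 + \<delta>) / \<delta>" for s :: int
  have m: "g1 (s - 1) \<le> g1 s" "g2 (s - 1) \<le> g2 s" "g3 (s - 1) \<le> g3 s" for s
    using assms unfolding g1_def g2_def g3_def by (auto intro!: divide_right_mono)
  have t: "tooth \<delta> (of_int s / M) = ramp (g1 s) - 2 * ramp (g2 s) + ramp (g3 s)" for s
    by (simp add: tooth_def g1_def g2_def g3_def)
  have abs3: "\<bar>a - 2 * b + c - (a' - 2 * b' + c')\<bar> \<le> \<bar>a - a'\<bar> + 2 * \<bar>b - b'\<bar> + \<bar>c - c'\<bar>"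
    for a b c a' b' c' :: real by (smt (verit))
  have "(\<Sum>s\<in>{a..b}. \<bar>tooth \<delta> (of_int s / M) - tooth \<delta> (of_int (s - 1) / M)\<bar>)
      \<le> (\<Sum>s\<in>{a..b}. \<bar>ramp (g1 s) - ramp (g1 (s - 1))\<bar> + 2 * \<bar>ramp (g2 s) - ramp (g2 (s - 1))\<bar>
          + \<bar>ramp (g3 s) - ramp (g3 (s - 1))\<bar>)"
    unfolding t by (intro sum_mono abs3)
  also have "\<dots> = (\<Sum>s\<in>{a..b}. \<bar>ramp (g1 s) - ramp (g1 (s - 1))\<bar>)
      + 2 * (\<Sum>s\<in>{a..b}. \<bar>ramp (g2 s) - ramp (g2 (s - 1))\<bar>) + (\<Sum>s\<in>{a..b}. \<bar>ramp (g3 s) - ramp (g3 (s - 1))\<bar>)"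
    by (simp add: sum.distrib sum_distrib_left)
  also have "\<dots> \<le> 4"
    using ramp_variation[of g1, OF m(1) assms(4)] ramp_variation[of g2, OF m(2) assms(4)] ramp_variation[of g3, OF m(3) assms(4)]
    by linarith
  finally show ?thesis .
qed

text \<open>The number of integers of absolute value at most \<open>t\<close>, minus the length
  \<open>2 * max 0 t\<close> of the interval they are taken from.\<close>

definition defect :: "real \<Rightarrow> real"
  where "defect t = (if 0 \<le> t then 2 * of_int \<lfloor>t\<rfloor> + 1 - 2 * t else 0)"

text \<open>Starting the translates at 0 builds the cutoff \<open>t \<ge> 0\<close> into the
  function. Stopping at \<open>T\<close> gives bounded support, so that it fits into one period;
  only arguments below \<open>T - 1\<close> are ever used to approximate
  \<open>defect\<close>.\<close>

definition saw :: "real \<Rightarrow> nat \<Rightarrow> real \<Rightarrow> real"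
  where "saw \<delta> T t = (\<Sum>y<T. tooth \<delta> (t - real y))"

lemma saw_lipschitz:
  assumes "0 < \<delta>" "\<delta> \<le> 1 / 2"
  shows "\<bar>saw \<delta> T t - saw \<delta> T s\<bar> \<le> real T * (4 / \<delta>) * \<bar>t - s\<bar>"
proof -
  have "\<bar>saw \<delta> T t - saw \<delta> T s\<bar> \<le> (\<Sum>y<T. \<bar>tooth \<delta> (t - real y) - tooth \<delta> (s - real y)\<bar>)"
    unfolding saw_def sum_subtractf[symmetric] by (rule sum_abs)
  also have "\<dots> \<le> (\<Sum>y<T. 4 / \<delta> * \<bar>(t - real y) - (s - real y)\<bar>)"
    by (intro sum_mono tooth_lipschitz assms)
  finally show ?thesis by simp
qed

text \<open>Every rise of \<open>saw\<close> is completed where \<open>defect\<close> jumps upwards,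
  so \<open>saw\<close> is ahead at the jumps. In between, the slopes
  \<open>- 2 / (1 - \<delta>)\<close> and \<open>- 2\<close> drift apart by at most
  \<open>2 * \<delta>\<close>.\<close>

lemma defect_le_saw:
  assumes "0 < \<delta>" "\<delta> \<le> 1 / 2" "t < real T - 1"
  shows "defect t \<le> saw \<delta> T t + 2 * \<delta>"
proof (cases "0 \<le> t")
  case False
  have "0 \<le> tooth \<delta> (t - real y)" for y
  proof -
    have "ramp ((t - real y) / (1 - \<delta>)) = 0"
      using False assms by (intro ramp_eq) (auto simp: divide_simps)
    thus ?thesis unfolding tooth_def
      using ramp_bounds(1)[of "(t - real y + \<delta>) / \<delta>"] ramp_bounds(1)[of "(t - real y - 1 + \<delta>) / \<delta>"] by simp
  qed
  thus ?thesis using False assms by (auto simp: defect_def saw_def intro!: sum_nonneg add_nonneg_nonneg)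
next
  case True
  define y where "y = nat \<lfloor>t\<rfloor>"
  define s where "s = t - real y"
  have y: "real y = of_int \<lfloor>t\<rfloor>" using True by (simp add: y_def)
  have s: "0 \<le> s" "s < 1" unfolding s_def y by linarith+
  have yT: "y + 1 < T" using assms(3) s unfolding s_def by linarith
  have "saw \<delta> T t = (\<Sum>k\<in>{y, y + 1}. tooth \<delta> (t - real k))"
    unfolding saw_def
  proof (rule sum.mono_neutral_right)
    show "\<forall>k\<in>{..<T} - {y, y + 1}. tooth \<delta> (t - real k) = 0"
    proof (rule ballI, rule tooth_zero[OF assms(1,2)])
      fix k assume "k \<in> {..<T} - {y, y + 1}"
      hence "k + 1 \<le> y \<or> y + 2 \<le> k" by auto
      hence "real k + 1 \<le> real y \<or> real y + 2 \<le> real k" by linarith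
      thus "t - real k \<le> - \<delta> \<or> 1 \<le> t - real k" using s assms unfolding s_def by auto
    qed
  qed (use yT in auto)
  also have "\<dots> = tooth \<delta> s + tooth \<delta> (s - 1)" by (simp add: s_def algebra_simps)
  finally have saw: "saw \<delta> T t = tooth \<delta> s + tooth \<delta> (s - 1)" .
  have d: "defect t = 1 - 2 * s" using True by (simp add: defect_def s_def y)
  have e1: "ramp ((s + \<delta>) / \<delta>) = 1" using s assms by (intro ramp_eq) (auto simp: divide_simps)
  have e2: "ramp ((s - 1) / (1 - \<delta>)) = 0" using s assms by (intro ramp_eq) (auto simp: divide_simps)
  have r0: "0 \<le> ramp ((s - 1 + \<delta>) / \<delta>)" "0 \<le> ramp ((s - 1 - 1 + \<delta>) / \<delta>)" by (simp_all add: ramp_bounds)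
  have "2 * ramp (s / (1 - \<delta>)) \<le> 2 * s + 2 * \<delta>"
  proof (cases "s \<le> 1 - \<delta>")
    case True
    have "s * \<delta> \<le> (1 - \<delta>) * \<delta>" using True assms by (intro mult_right_mono) auto
    hence "s \<le> (s + \<delta>) * (1 - \<delta>)" by (simp add: algebra_simps)
    hence "s / (1 - \<delta>) \<le> s + \<delta>" using assms by (simp add: pos_divide_le_eq)
    moreover have "ramp (s / (1 - \<delta>)) \<le> s / (1 - \<delta>)" using s assms by (auto simp: ramp_def)
    ultimately show ?thesis by simp
  next
    case False
    thus ?thesis using ramp_bounds(2)[of "s / (1 - \<delta>)"] by simp
  qed
  hence "1 - 2 * s - 2 * \<delta> \<le> tooth \<delta> s + tooth \<delta> (s - 1)"
    using e1 e2 r0 unfolding tooth_def by simp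
  thus ?thesis unfolding d saw by simp
qed

text \<open>The opposite bound: a delay by \<delta> makes each rise start at the jump of
  \<open>defect\<close>, so \<open>saw\<close> now lags behind. Within a rise it is at most 1, while
  \<open>defect\<close> has dropped by no more than \<open>2 * \<delta>\<close>.\<close>

lemma saw_le_defect:
  assumes "0 < \<delta>" "\<delta> \<le> 1 / 2" "t < real T - 1"
  shows "saw \<delta> T (t - \<delta>) \<le> defect t + 2 * \<delta>"
proof (cases "0 \<le> t")
  case False
  have "tooth \<delta> (t - \<delta> - real y) = 0" for y
    using False assms by (intro tooth_zero) auto
  thus ?thesis using False assms by (simp add: defect_def saw_def)
next
  case True
  define y where "y = nat \<lfloor>t\<rfloor>"
  define s where "s = t - real y"
  have y: "real y = of_int \<lfloor>t\<rfloor>" using True by (simp add: y_def)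
  have s: "0 \<le> s" "s < 1" unfolding s_def y by linarith+
  have yT: "y + 1 < T" using assms(3) s unfolding s_def by linarith
  have "saw \<delta> T (t - \<delta>) \<le> tooth \<delta> (s - \<delta>) + max 0 (tooth \<delta> (s - \<delta> + 1))"
  proof -
    have "saw \<delta> T (t - \<delta>) = (\<Sum>k\<in>{y} \<union> {k. k + 1 = y}. tooth \<delta> (t - \<delta> - real k))"
      unfolding saw_def
    proof (rule sum.mono_neutral_right)
      show "\<forall>k\<in>{..<T} - ({y} \<union> {k. k + 1 = y}). tooth \<delta> (t - \<delta> - real k) = 0"
      proof (rule ballI, rule tooth_zero[OF assms(1,2)])
        fix k assume "k \<in> {..<T} - ({y} \<union> {k. k + 1 = y})"
        hence "k + 2 \<le> y \<or> y + 1 \<le> k" by auto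
        hence "real k + 2 \<le> real y \<or> real y + 1 \<le> real k" by linarith
        thus "t - \<delta> - real k \<le> - \<delta> \<or> 1 \<le> t - \<delta> - real k" using s assms unfolding s_def by auto
      qed
    qed (use yT in auto)
    also have "\<dots> = tooth \<delta> (s - \<delta>) + (if y = 0 then 0 else tooth \<delta> (s - \<delta> + 1))"
    proof (cases y)
      case 0
      thus ?thesis by (simp add: s_def)
    next
      case (Suc k)
      hence "{y} \<union> {k. k + 1 = y} = {y, k}" by auto
      thus ?thesis using Suc by (simp add: s_def algebra_simps)
    qed
    finally show ?thesis by simp
  qed
  moreover have "defect t = 1 - 2 * s" using True by (simp add: defect_def s_def y)
  moreover have "tooth \<delta> (s - \<delta>) + max 0 (tooth \<delta> (s - \<delta> + 1)) \<le> 1 - 2 * s + 2 * \<delta>"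
  proof (cases "s \<le> \<delta>")
    case True
    have "ramp ((s - \<delta>) / (1 - \<delta>)) = 0" "ramp ((s - \<delta> - 1 + \<delta>) / \<delta>) = 0"
      using s True assms by (auto intro!: ramp_eq simp: divide_simps)
    moreover have "ramp ((s - \<delta> + 1) / (1 - \<delta>)) = 1"
      using s True assms by (intro ramp_eq) (auto simp: divide_simps)
    ultimately have "tooth \<delta> (s - \<delta>) \<le> 1" "tooth \<delta> (s - \<delta> + 1) \<le> 0"
      unfolding tooth_def using ramp_bounds[of "(s - \<delta> + \<delta>) / \<delta>"]
        ramp_bounds[of "(s - \<delta> + 1 + \<delta>) / \<delta>"] ramp_bounds[of "(s - \<delta> + 1 - 1 + \<delta>) / \<delta>"] by auto
    thus ?thesis using True by simp
  next
    case False
    have z: "tooth \<delta> (s - \<delta> + 1) = 0" using False assms by (intro tooth_zero) auto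
    have r: "ramp ((s - \<delta> - 1 + \<delta>) / \<delta>) = 0" using s assms by (intro ramp_eq) (auto simp: divide_simps)
    have "s - \<delta> \<le> (s - \<delta>) / (1 - \<delta>)"
      using False assms by (simp add: divide_simps mult_left_le)
    hence "s - \<delta> \<le> ramp ((s - \<delta>) / (1 - \<delta>))"
      using False s by (auto simp: ramp_def)
    thus ?thesis unfolding z using ramp_bounds[of "(s - \<delta> + \<delta>) / \<delta>"] r by (simp add: tooth_def)
  qed
  ultimately show ?thesis by linarith
qed

section \<open>The normalised Fejer kernel and approximation by grid averages\<close>

definition fejer :: "int \<Rightarrow> real \<Rightarrow> real"
  where "fejer J x = (norm (\<Sum>r\<in>{0..J - 1}. echar (x * of_int r)))\<^sup>2 / (of_int J)\<^sup>2"

lemma fejer_nonneg: "0 \<le> fejer J x"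
  by (simp add: fejer_def)

lemma fejer_expand:
  "complex_of_real (fejer J x)
    = (\<Sum>j\<in>{-(J - 1)..J - 1}. of_real (of_int (J - \<bar>j\<bar>) / (of_int J)\<^sup>2) * echar (x * of_int j))"
proof -
  let ?S = "\<Sum>r\<in>{0..J - 1}. echar (x * of_int r)"
  have "complex_of_real ((norm ?S)\<^sup>2) = cnj ?S * ?S"
    by (metis complex_norm_square mult.commute)
  also have "\<dots> = (\<Sum>z\<in>{0..J - 1}. \<Sum>w\<in>{0..J - 1}. echar (x * of_int (w - z)))"
    unfolding right_diff_distrib of_int_diff echar_diff cnj_sum sum_product
    by (intro sum.cong refl mult.commute)
  also have "\<dots> = (\<Sum>j\<in>{-(J - 1)..J - 1}. \<Sum>z\<in>{max 0 (0 - j)..min (J - 1) (J - 1 - j)}. echar (x * of_int j))"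
    by (subst sum_differences) simp
  also have "\<dots> = (\<Sum>j\<in>{-(J - 1)..J - 1}. of_int (J - \<bar>j\<bar>) * echar (x * of_int j))"
  proof (intro sum.cong refl)
    fix j assume j: "j \<in> {-(J - 1)..J - 1}"
    have "int (card {max 0 (0 - j)..min (J - 1) (J - 1 - j)}) = J - \<bar>j\<bar>" using j by auto
    thus "(\<Sum>z\<in>{max 0 (0 - j)..min (J - 1) (J - 1 - j)}. echar (x * of_int j)) = of_int (J - \<bar>j\<bar>) * echar (x * of_int j)"
      by (simp only: sum_constant) (metis of_int_of_nat_eq)
  qed
  finally have "complex_of_real ((norm ?S)\<^sup>2) = (\<Sum>j\<in>{-(J - 1)..J - 1}. of_int (J - \<bar>j\<bar>) * echar (x * of_int j))" .
  thus ?thesis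
    by (simp only: fejer_def of_real_divide of_real_power of_real_of_int_eq sum_divide_distrib times_divide_eq_left)
qed

lemma dist_int_pos_fraction:
  assumes "j \<noteq> 0" "\<bar>j\<bar> < J"
  shows "0 < dist_int (of_int j / of_int J)"
proof (rule ccontr)
  assume "\<not> 0 < dist_int (of_int j / of_int J)"
  hence "dist_int (of_int j / of_int J) = 0" using dist_int_nonneg[of "of_int j / of_int J"] by linarith
  then obtain z where "of_int j / of_int J = (of_int z :: real)" by (auto simp: dist_int_def)
  hence "(of_int j :: real) = of_int (z * J)" using assms by (simp add: field_simps)
  hence "j = z * J" by linarith
  hence "\<bar>j\<bar> = \<bar>z\<bar> * \<bar>J\<bar>" "z \<noteq> 0" using assms by (auto simp: abs_mult)
  moreover have "1 * \<bar>J\<bar> \<le> \<bar>z\<bar> * \<bar>J\<bar>" using \<open>z \<noteq> 0\<close> by (intro mult_right_mono) auto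
  ultimately show False using assms by linarith
qed

lemma roots_of_unity_sum:
  assumes "j \<noteq> 0" "\<bar>j\<bar> < J"
  shows "(\<Sum>g\<in>{a..a + J - 1}. echar (of_int j / of_int J * of_int g)) = 0"
proof -
  let ?x = "of_int j / of_int J :: real"
  let ?S = "\<Sum>g\<in>{a..a + J - 1}. echar (?x * of_int g)"
  have J: "0 < J" using assms by linarith
  have step: "echar ?x * echar (?x * of_int g) = echar (?x * of_int (g + 1))" for g
    unfolding echar_add[symmetric] by (rule arg_cong[where f = echar]) (simp only: of_int_add of_int_1 distrib_left mult_1_right add.commute)
  have "echar ?x * ?S = (\<Sum>g\<in>{a..a + J - 1}. echar (?x * of_int (g + 1)))"
    by (simp only: sum_distrib_left step)
  also have "\<dots> = (\<Sum>g\<in>{a + 1..a + J}. echar (?x * of_int g))"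
    using sum_int_shift[of "\<lambda>g. echar (?x * of_int g)" 1 a "a + J - 1"] by simp
  also have "{a + 1..a + J} = insert (a + J) {a + 1..a + J - 1}" using J by auto
  also have "(\<Sum>g\<in>insert (a + J) {a + 1..a + J - 1}. echar (?x * of_int g))
      = echar (?x * of_int (a + J)) + (\<Sum>g\<in>{a + 1..a + J - 1}. echar (?x * of_int g))"
    by (subst sum.insert) auto
  also have "echar (?x * of_int (a + J)) = echar (?x * of_int a)"
  proof -
    have "?x * of_int (a + J) = ?x * of_int a + of_int j" using J by (simp add: distrib_left)
    thus ?thesis by (simp only: echar_add echar_of_int mult_1_right)
  qed
  also have "echar (?x * of_int a) + (\<Sum>g\<in>{a + 1..a + J - 1}. echar (?x * of_int g))
      = (\<Sum>g\<in>insert a {a + 1..a + J - 1}. echar (?x * of_int g))"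
    by (subst sum.insert) auto
  also have "insert a {a + 1..a + J - 1} = {a..a + J - 1}" using J by auto
  finally have "(1 - echar ?x) * ?S = 0" by (simp add: left_diff_distrib)
  moreover have "1 - echar ?x \<noteq> 0"
    using norm_one_minus_echar_ge[of ?x] dist_int_pos_fraction[OF assms] by auto
  ultimately show ?thesis by simp
qed

text \<open>All nonzero frequencies of the kernel are smaller than \<open>J\<close> in absolute
  value, so summation over the \<open>J\<close> translates annihilates them. The normalisation by
  \<open>(of_int J)\<^sup>2\<close> makes the remaining constant term 1.\<close>

lemma fejer_partition:
  assumes "0 < J"
  shows "(\<Sum>g\<in>{a..a + J - 1}. fejer J (x - of_int g / of_int J)) = 1"
proof -
  let ?c = "\<lambda>j. complex_of_real (of_int (J - \<bar>j\<bar>) / (of_int J)\<^sup>2)"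
  have "complex_of_real (\<Sum>g\<in>{a..a + J - 1}. fejer J (x - of_int g / of_int J))
      = (\<Sum>j\<in>{-(J - 1)..J - 1}. \<Sum>g\<in>{a..a + J - 1}. ?c j * echar ((x - of_int g / of_int J) * of_int j))"
    unfolding of_real_sum fejer_expand by (rule sum.swap)
  also have "\<dots> = (\<Sum>j\<in>{-(J - 1)..J - 1}. ?c j * echar (x * of_int j) * (\<Sum>g\<in>{a..a + J - 1}. echar (of_int (- j) / of_int J * of_int g)))"
    unfolding sum_distrib_left mult.assoc echar_add[symmetric]
    by (intro sum.cong refl arg_cong2[where f = "(*)"] arg_cong[where f = echar]) (simp add: field_simps)
  also have "\<dots> = (\<Sum>j\<in>{0}. ?c j * echar (x * of_int j) * (\<Sum>g\<in>{a..a + J - 1}. echar (of_int (- j) / of_int J * of_int g)))"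
  proof (rule sum.mono_neutral_right)
    show "\<forall>j\<in>{-(J - 1)..J - 1} - {0}. ?c j * echar (x * of_int j) * (\<Sum>g\<in>{a..a + J - 1}. echar (of_int (- j) / of_int J * of_int g)) = 0"
      using roots_of_unity_sum[of "- j" J a for j] by auto
  qed (use assms in auto)
  also have "\<dots> = 1" using assms by (simp add: power2_eq_square)
  finally show ?thesis by (metis of_real_eq_1_iff)
qed

lemma fejer_tail:
  assumes "0 < J"
  shows "(dist_int x)\<^sup>2 * fejer J x \<le> 1 / (4 * (of_int J)\<^sup>2)"
proof -
  have "(2 * dist_int x * norm (\<Sum>r\<in>{0..J - 1}. echar (x * of_int r)))\<^sup>2 \<le> 1\<^sup>2"
    using geometric_exp_sum_dist_int[of x 0 "J - 1"] by (intro power_mono) auto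
  thus ?thesis using assms by (simp add: fejer_def power_mult_distrib divide_simps)
qed

text \<open>The kernel values are the weights of an average of grid values, so the error is at most
  \<Lambda> times the mean distance to a grid point. The hypothesis \<open>window\<close> allows a
  function that is not periodic: in the relevant range, true distance and distance modulo
  \<open>P\<close> agree up to a factor 3.\<close>

lemma fejer_approx:
  fixes J M :: int and \<Phi> :: "real \<Rightarrow> real"
  assumes "0 < M" "0 < P" "of_int J = P * of_int M" "0 \<le> \<Lambda>"
    and lip: "\<And>t s. \<bar>\<Phi> t - \<Phi> s\<bar> \<le> \<Lambda> * \<bar>t - s\<bar>"
    and window: "\<And>g. g \<in> {a..a + J - 1} \<Longrightarrow> \<bar>t - of_int g / of_int M\<bar> \<le> 3 * P * dist_int (t / P - of_int g / of_int J)"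
  shows "\<bar>\<Phi> t - (\<Sum>g\<in>{a..a + J - 1}. \<Phi> (of_int g / of_int M) * fejer J (t / P - of_int g / of_int J))\<bar>
      \<le> 3 * P * \<Lambda> / sqrt (of_int J)"
proof -
  let ?I = "{a..a + J - 1}"
  let ?n = "\<lambda>g. dist_int (t / P - of_int g / of_int J)" and ?k = "\<lambda>g. fejer J (t / P - of_int g / of_int J)"
  have J: "0 < J" using assms by (metis mult_pos_pos of_int_0_less_iff)
  have sq: "0 < sqrt (of_int J)" using J by simp
  \<comment> \<open>By \<open>n \<le> 1 / (2 * s) + s / 2 * n\<^sup>2\<close> with
    \<open>s = sqrt J\<close>, the mean distance is reduced to the second moment, to which
    \<open>fejer_tail\<close> lets each of the \<open>J\<close> grid points contribute at most
    \<open>1 / (4 * J\<^sup>2)\<close>.\<close>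
  have dist_int_sum: "(\<Sum>g\<in>?I. ?n g * ?k g) \<le> 1 / sqrt (of_int J)"
  proof -
    have "?n g * ?k g \<le> 1 / (2 * sqrt (of_int J)) * ?k g + sqrt (of_int J) / (8 * (of_int J)\<^sup>2)" for g
    proof -
      have "n \<le> 1 / (2 * s) + s / 2 * n\<^sup>2" if "0 < s" for n s :: real
      proof -
        have "0 \<le> (1 - s * n)\<^sup>2" by simp
        thus ?thesis using that by (simp add: field_simps power2_eq_square)
      qed
      from this[OF sq, of "?n g"]
      have "?n g * ?k g \<le> (1 / (2 * sqrt (of_int J)) + sqrt (of_int J) / 2 * (?n g)\<^sup>2) * ?k g"
        by (intro mult_right_mono fejer_nonneg)
      also have "\<dots> = 1 / (2 * sqrt (of_int J)) * ?k g + sqrt (of_int J) / 2 * ((?n g)\<^sup>2 * ?k g)"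
        by (simp add: algebra_simps)
      also have "\<dots> \<le> 1 / (2 * sqrt (of_int J)) * ?k g + sqrt (of_int J) / 2 * (1 / (4 * (of_int J)\<^sup>2))"
        using fejer_tail[OF J] sq by (intro add_left_mono mult_left_mono) auto
      finally show ?thesis by simp
    qed
    hence "(\<Sum>g\<in>?I. ?n g * ?k g) \<le> (\<Sum>g\<in>?I. 1 / (2 * sqrt (of_int J)) * ?k g + sqrt (of_int J) / (8 * (of_int J)\<^sup>2))"
      by (intro sum_mono)
    also have "\<dots> = 1 / (2 * sqrt (of_int J)) * (\<Sum>g\<in>?I. ?k g) + of_int J * (sqrt (of_int J) / (8 * (of_int J)\<^sup>2))"
      using J by (simp add: sum.distrib sum_distrib_left)
    also have "\<dots> = 1 / (2 * sqrt (of_int J)) + sqrt (of_int J) / (8 * of_int J)"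
      using fejer_partition[OF J, of "t / P" a] J by (simp add: power2_eq_square)
    also have "sqrt (of_int J) / (8 * of_int J) = 1 / (8 * sqrt (of_int J))"
      using J by (simp add: real_div_sqrt divide_simps)
    also have "1 / (2 * sqrt (of_int J)) + 1 / (8 * sqrt (of_int J)) \<le> 1 / sqrt (of_int J)"
      using sq by (simp add: field_simps)
    finally show ?thesis .
  qed
  have "\<Phi> t - (\<Sum>g\<in>?I. \<Phi> (of_int g / of_int M) * ?k g) = (\<Sum>g\<in>?I. (\<Phi> t - \<Phi> (of_int g / of_int M)) * ?k g)"
    using fejer_partition[OF J, of "t / P" a] by (simp add: left_diff_distrib sum_subtractf flip: sum_distrib_left)
  also have "\<bar>\<dots>\<bar> \<le> (\<Sum>g\<in>?I. \<bar>(\<Phi> t - \<Phi> (of_int g / of_int M)) * ?k g\<bar>)" by (rule sum_abs)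
  also have "\<dots> \<le> (\<Sum>g\<in>?I. \<Lambda> * (3 * P * ?n g) * ?k g)"
  proof (intro sum_mono)
    fix g assume g: "g \<in> ?I"
    have "\<bar>\<Phi> t - \<Phi> (of_int g / of_int M)\<bar> \<le> \<Lambda> * (3 * P * ?n g)"
      using lip[of t "of_int g / of_int M"] mult_left_mono[OF window[OF g] \<open>0 \<le> \<Lambda>\<close>] by linarith
    thus "\<bar>(\<Phi> t - \<Phi> (of_int g / of_int M)) * ?k g\<bar> \<le> \<Lambda> * (3 * P * ?n g) * ?k g"
      using fejer_nonneg by (simp add: abs_mult mult_right_mono)
  qed
  also have "\<dots> = 3 * P * \<Lambda> * (\<Sum>g\<in>?I. ?n g * ?k g)"
    unfolding sum_distrib_left by (intro sum.cong refl) (simp only: mult_ac)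
  also have "\<dots> \<le> 3 * P * \<Lambda> * (1 / sqrt (of_int J))"
    using assms by (intro mult_left_mono dist_int_sum) auto
  finally show ?thesis by simp
qed

section \<open>Fourier coefficients of the sawtooth\<close>

lemma dist_int_ge_min: "\<bar>x\<bar> \<le> 1 \<Longrightarrow> min \<bar>x\<bar> (1 - \<bar>x\<bar>) \<le> dist_int x"
proof -
  assume x: "\<bar>x\<bar> \<le> 1"
  show ?thesis
  proof (cases "round x = 0")
    case True
    thus ?thesis by (simp add: dist_int_def)
  next
    case False
    hence "1 \<le> \<bar>round x\<bar>" by linarith
    hence "1 \<le> \<bar>of_int (round x) :: real\<bar>" by linarith
    thus ?thesis unfolding dist_int_def by linarith
  qed
qed

lemma dist_int_eq_abs: "\<bar>x\<bar> \<le> 1 / 2 \<Longrightarrow> dist_int x = \<bar>x\<bar>"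
  using dist_int_ge_min[of x] dist_int_le_abs[of x] by linarith

text \<open>One period has length \<open>P = 4 * T\<close>: \<open>saw\<close> lives on
  \<open>{- \<delta>..T}\<close> and is evaluated on \<open>{- T..T}\<close>, which leaves room
  against wrapping around. There are \<open>M\<close> grid points per unit and \<open>J\<close> per
  period. The width \<delta> is exactly \<open>w\<close> grid steps, so the symmetry of
  \<open>tooth\<close> respects the grid, and a large \<open>w\<close> refines the grid at
  will.\<close>

locale saw_fourier =
  fixes T :: nat and w :: int
  assumes T_ge: "2 \<le> T" and w_pos: "0 < w"
begin

definition P :: real where "P = 4 * real T"
definition M :: int where "M = 4 * int T * w"
definition J :: int where "J = 4 * int T * M"
definition \<delta> :: real where "\<delta> = 1 / P"

lemma P_ge: "8 \<le> P" and P_pos: "0 < P"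
  using T_ge by (simp_all add: P_def)

lemma M_pos: "0 < M" and J_pos: "0 < J"
  using T_ge w_pos by (simp_all add: M_def J_def)

lemma M_eq: "of_int M = P * of_int w" and J_eq: "of_int J = P * of_int M"
  by (simp_all add: M_def J_def P_def)

lemma w_le_M: "w \<le> M"
  using T_ge w_pos by (simp add: M_def)

lemma w_div_M: "of_int w / of_int M = \<delta>"
  using w_pos P_pos by (simp add: M_eq \<delta>_def)

lemma delta: "0 < \<delta>" "\<delta> \<le> 1 / 2"
  using P_ge by (simp_all add: \<delta>_def divide_simps)

definition tooth_coeff :: "int \<Rightarrow> complex"
  where "tooth_coeff j = (\<Sum>s\<in>{- w..M}. of_real (tooth \<delta> (of_int s / of_int M)) * echar (- (of_int j / of_int J) * of_int s))"

definition saw_coeff :: "int \<Rightarrow> complex"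
  where "saw_coeff j = (\<Sum>g\<in>{- 2 * int T * M..- 2 * int T * M + J - 1}.
    of_real (saw \<delta> T (of_int g / of_int M)) * echar (- (of_int j / of_int J) * of_int g))"

text \<open>The modulus of the coefficient of \<open>echar (j * x / P)\<close> in the trigonometric
  polynomial that replaces \<open>saw\<close>: a Fejer coefficient times a discrete Fourier
  coefficient.\<close>

definition weight :: "int \<Rightarrow> real"
  where "weight j = of_int (J - \<bar>j\<bar>) / (of_int J)\<^sup>2 * norm (saw_coeff j)"

lemma tooth_outside: "s \<notin> {- w..M} \<Longrightarrow> tooth \<delta> (of_int s / of_int M) = 0"
proof (rule tooth_zero[OF delta])
  assume "s \<notin> {- w..M}"
  hence "s \<le> - w \<or> M \<le> s" by auto
  thus "of_int s / of_int M \<le> - \<delta> \<or> 1 \<le> of_int s / (of_int M :: real)"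
  proof
    assume "s \<le> - w"
    hence "of_int s / of_int M \<le> of_int (- w) / (of_int M :: real)"
      using M_pos by (intro divide_right_mono) (simp_all only: of_int_le_iff of_int_0_le_iff)
    thus ?thesis using w_div_M by simp
  next
    assume "M \<le> s"
    thus ?thesis using M_pos by simp
  qed
qed

text \<open>Translation by an integer \<open>y\<close> is translation by \<open>y * M\<close> grid
  steps, hence a phase. The \<open>T\<close> phases form a geometric sum, which concentrates the
  coefficients near multiples of \<open>P\<close>.\<close>

lemma saw_coeff_factor:
  "saw_coeff j = (\<Sum>y\<in>{0..int T - 1}. echar (- (of_int j / P) * of_int y)) * tooth_coeff j"
proof -
  let ?I = "{- 2 * int T * M..- 2 * int T * M + J - 1}"
  let ?e = "\<lambda>g::int. echar (- (of_int j / of_int J) * of_int g)"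
  have saw: "saw \<delta> T t = (\<Sum>y\<in>{0..int T - 1}. tooth \<delta> (t - of_int y))" for t
    unfolding saw_def by (rule sum.reindex_bij_witness[of _ nat int]) auto
  have "saw_coeff j = (\<Sum>g\<in>?I. \<Sum>y\<in>{0..int T - 1}. of_real (tooth \<delta> (of_int g / of_int M - of_int y)) * ?e g)"
    unfolding saw_coeff_def saw by (simp add: sum_distrib_right)
  also have "\<dots> = (\<Sum>y\<in>{0..int T - 1}. \<Sum>g\<in>?I. of_real (tooth \<delta> (of_int g / of_int M - of_int y)) * ?e g)"
    by (rule sum.swap)
  also have "\<dots> = (\<Sum>y\<in>{0..int T - 1}. echar (- (of_int j / P) * of_int y) * tooth_coeff j)"
  proof (rule sum.cong[OF refl])
    fix y assume y: "y \<in> {0..int T - 1}"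
    have shift: "of_int g / of_int M - of_int y = (of_int (g - y * M) / of_int M :: real)" for g
      using M_pos by (simp add: field_simps)
    have "(\<Sum>g\<in>?I. of_real (tooth \<delta> (of_int g / of_int M - of_int y)) * ?e g)
        = (\<Sum>g\<in>{- w + y * M..M + y * M}. of_real (tooth \<delta> (of_int (g - y * M) / of_int M)) * ?e g)"
      unfolding shift
    proof (rule sum.mono_neutral_right)
      have "0 \<le> y * M" "(y + 1) * M \<le> int T * M" "1 * M \<le> int T * M" using y M_pos T_ge by (auto intro!: mult_right_mono)
      thus "{- w + y * M..M + y * M} \<subseteq> ?I"
        using M_pos w_le_M by (auto simp: J_def algebra_simps)
      show "\<forall>g\<in>?I - {- w + y * M..M + y * M}. of_real (tooth \<delta> (of_int (g - y * M) / of_int M)) * ?e g = 0"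
      proof
        fix g assume "g \<in> ?I - {- w + y * M..M + y * M}"
        hence "g - y * M \<notin> {- w..M}" by auto
        from tooth_outside[OF this] show "of_real (tooth \<delta> (of_int (g - y * M) / of_int M)) * ?e g = 0" by simp
      qed
    qed auto
    also have "\<dots> = (\<Sum>s\<in>{- w..M}. of_real (tooth \<delta> (of_int s / of_int M)) * ?e (s + y * M))"
      by (subst sum_int_shift[symmetric]) simp
    also have "\<dots> = (\<Sum>s\<in>{- w..M}. echar (- (of_int j / P) * of_int y) * (of_real (tooth \<delta> (of_int s / of_int M)) * ?e s))"
    proof (rule sum.cong[OF refl])
      fix s
      have "- (of_int j / of_int J) * of_int (s + y * M) = - (of_int j / P) * of_int y + - (of_int j / of_int J) * (of_int s :: real)"
        using M_pos P_pos by (simp add: J_eq field_simps)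
      thus "of_real (tooth \<delta> (of_int s / of_int M)) * ?e (s + y * M)
          = echar (- (of_int j / P) * of_int y) * (of_real (tooth \<delta> (of_int s / of_int M)) * ?e s)"
        by (simp only: echar_add mult_ac)
    qed
    also have "\<dots> = echar (- (of_int j / P) * of_int y) * tooth_coeff j"
      by (simp only: tooth_coeff_def sum_distrib_left)
    finally show "(\<Sum>g\<in>?I. of_real (tooth \<delta> (of_int g / of_int M - of_int y)) * ?e g) = echar (- (of_int j / P) * of_int y) * tooth_coeff j" .
  qed
  finally show ?thesis by (simp only: sum_distrib_right)
qed

lemma norm_saw_coeff_le: "norm (saw_coeff j) \<le> 2 * peak P (of_int j / P) * norm (tooth_coeff j)"
proof -
  have "norm (\<Sum>y\<in>{0..int T - 1}. echar (- (of_int j / P) * of_int y)) \<le> 2 * peak P (- (of_int j / P))"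
    using T_ge P_pos by (intro geometric_exp_sum) (auto simp: P_def)
  thus ?thesis unfolding saw_coeff_factor norm_mult by (intro mult_right_mono) auto
qed

lemma tooth_coeff_variation: "dist_int (of_int j / of_int J) * norm (tooth_coeff j) \<le> 1"
proof -
  have "4 * dist_int (- (of_int j / of_int J)) * norm (tooth_coeff j)
      \<le> (\<Sum>s\<in>{- w..M + 1}. \<bar>tooth \<delta> (of_int s / of_int M) - tooth \<delta> (of_int (s - 1) / of_int M)\<bar>)"
    unfolding tooth_coeff_def by (rule exp_sum_variation[OF tooth_outside])
  also have "\<dots> \<le> 4"
    using M_pos w_pos by (intro tooth_variation delta) auto
  finally show ?thesis by simp
qed

text \<open>The reflection \<open>s \<mapsto> M - w - s\<close> permutes the grid points of the
  support and changes the sign of \<open>tooth\<close>.\<close>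

lemma tooth_sum_zero: "(\<Sum>s\<in>{- w..M}. tooth \<delta> (of_int s / of_int M)) = 0"
proof -
  have "(\<Sum>s\<in>{- w..M}. tooth \<delta> (of_int s / of_int M)) = (\<Sum>s\<in>{- w..M}. tooth \<delta> (of_int (M - w - s) / of_int M))"
    by (rule sum.reindex_bij_witness[of _ "\<lambda>s. M - w - s" "\<lambda>s. M - w - s"]) auto
  also have "\<dots> = (\<Sum>s\<in>{- w..M}. - tooth \<delta> (of_int s / of_int M))"
  proof (rule sum.cong[OF refl])
    fix s
    have "of_int (M - w - s) / of_int M = 1 - \<delta> - of_int s / of_int M"
      using M_pos by (simp add: w_div_M[symmetric] diff_divide_distrib)
    thus "tooth \<delta> (of_int (M - w - s) / of_int M) = - tooth \<delta> (of_int s / of_int M)"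
      using tooth_reflect[OF delta] by simp
  qed
  finally show ?thesis by (simp add: sum_negf)
qed

text \<open>Because the mean is zero, each exponential may be replaced by its difference from 1,
  which is O(\<bar>j\<bar> / P) on the support; there are at most \<open>3 * M\<close> grid points
  and \<open>\<bar>tooth\<bar> \<le> 2\<close>.\<close>

lemma norm_tooth_coeff_small: "norm (tooth_coeff j) \<le> 12 * pi * of_int M * \<bar>of_int j\<bar> / P"
proof -
  let ?t = "\<lambda>s. tooth \<delta> (of_int s / of_int M)" and ?e = "\<lambda>s. echar (- (of_int j / of_int J) * of_int s)"
  have "complex_of_real (\<Sum>s\<in>{- w..M}. ?t s) = 0" by (simp only: tooth_sum_zero of_real_0)
  hence "tooth_coeff j = (\<Sum>s\<in>{- w..M}. of_real (?t s) * (?e s - 1))"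
    by (simp add: tooth_coeff_def right_diff_distrib sum_subtractf)
  also have "norm \<dots> \<le> (\<Sum>s\<in>{- w..M}. norm (of_real (?t s) * (?e s - 1)))" by (rule norm_sum)
  also have "\<dots> \<le> (\<Sum>s\<in>{- w..M}. 2 * (2 * pi * (\<bar>of_int j\<bar> / P)))"
  proof (rule sum_mono)
    fix s assume s: "s \<in> {- w..M}"
    hence "\<bar>s\<bar> \<le> M" using w_le_M by auto
    hence "\<bar>of_int s :: real\<bar> \<le> of_int M" by linarith
    hence "\<bar>of_int s\<bar> * \<bar>of_int j\<bar> \<le> of_int M * \<bar>of_int j :: real\<bar>" by (intro mult_right_mono) auto
    hence "\<bar>- (of_int j / of_int J) * of_int s\<bar> \<le> \<bar>of_int j\<bar> / P"
      using M_pos P_pos by (simp add: J_eq abs_mult divide_simps mult_ac)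
    hence "norm (1 - ?e s) \<le> 2 * pi * (\<bar>of_int j\<bar> / P)"
      using norm_one_minus_echar_le[of "- (of_int j / of_int J) * of_int s"]
      by (meson mult_left_mono order_trans pi_ge_zero zero_le_mult_iff zero_le_numeral)
    thus "norm (of_real (?t s) * (?e s - 1)) \<le> 2 * (2 * pi * (\<bar>of_int j\<bar> / P))"
      unfolding norm_mult norm_of_real using tooth_abs_le[of \<delta> "of_int s / of_int M"]
      by (intro mult_mono) (auto simp: norm_minus_commute)
  qed
  also have "\<dots> = of_int (M + w + 1) * (4 * pi * (\<bar>of_int j\<bar> / P))"
    using M_pos w_pos by simp
  also have "\<dots> \<le> (3 * of_int M) * (4 * pi * (\<bar>of_int j\<bar> / P))"
  proof (rule mult_right_mono)
    have "M + w + 1 \<le> 3 * M" using M_pos w_le_M by linarith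
    thus "of_int (M + w + 1) \<le> 3 * (of_int M :: real)" by linarith
  qed (use P_pos in auto)
  finally show ?thesis by (simp add: mult_ac)
qed

lemma weight_nonneg: "\<bar>j\<bar> < J \<Longrightarrow> 0 \<le> weight j"
  unfolding weight_def by (intro mult_nonneg_nonneg divide_nonneg_nonneg) auto

lemma weight_zero: "weight 0 = 0"
  using norm_saw_coeff_le[of 0] norm_tooth_coeff_small[of 0] by (simp add: weight_def)

lemma weight_le:
  assumes "j \<noteq> 0" "\<bar>j\<bar> < J"
  shows "weight j \<le> 2 * peak P (of_int j / P) / \<bar>of_int j\<bar>"
proof -
  define a where "a = \<bar>of_int j\<bar> / (of_int J :: real)"
  have a: "0 < a" "a < 1" using assms J_pos by (auto simp: a_def)
  have "\<bar>of_int j / of_int J :: real\<bar> = a" using J_pos by (simp add: a_def)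
  hence "min a (1 - a) \<le> dist_int (of_int j / of_int J)" using dist_int_ge_min[of "of_int j / of_int J"] a by simp
  \<comment> \<open>For \<open>a\<close> near 1 the fraction \<open>j / J\<close> comes close to an
    integer and the variation bound degenerates. The Fejer factor \<open>1 - a\<close> in
    \<open>weight\<close> makes up for precisely this.\<close>
  moreover have "a * (1 - a) \<le> min a (1 - a)" using a by (auto simp: mult_left_le mult_left_le_one_le)
  ultimately have "a * (1 - a) * norm (tooth_coeff j) \<le> 1"
    using tooth_coeff_variation[of j] by (smt (verit) mult_right_mono norm_ge_zero)
  hence t: "(1 - a) * norm (tooth_coeff j) \<le> 1 / a" using a by (simp add: field_simps)
  have "weight j = (1 - a) / of_int J * norm (saw_coeff j)"
    using J_pos by (simp add: weight_def a_def field_simps power2_eq_square)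
  also have "\<dots> \<le> (1 - a) / of_int J * (2 * peak P (of_int j / P) * norm (tooth_coeff j))"
    using a J_pos by (intro mult_left_mono norm_saw_coeff_le) auto
  also have "\<dots> = 2 * peak P (of_int j / P) / of_int J * ((1 - a) * norm (tooth_coeff j))" by simp
  also have "\<dots> \<le> 2 * peak P (of_int j / P) / of_int J * (1 / a)"
    using J_pos peak_nonneg[OF P_pos] by (intro mult_left_mono t) auto
  also have "\<dots> = 2 * peak P (of_int j / P) / \<bar>of_int j\<bar>"
    using J_pos by (simp add: a_def)
  finally show ?thesis .
qed

lemma peak_fraction: "2 * \<bar>of_int r\<bar> \<le> P \<Longrightarrow> peak P (of_int r / P) = P / (1 + \<bar>of_int r\<bar>)"
  using P_pos by (subst peak_def, subst dist_int_eq_abs) (auto simp: divide_simps)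

text \<open>The factor \<open>\<bar>j\<bar>\<close> gained from the vanishing mean cancels the decay
  \<open>P / (1 + \<bar>j\<bar>)\<close> of the kernel. For the lowest frequencies
  \<open>weight_le\<close> alone would only give a bound of order \<open>P\<close>.\<close>

lemma weight_small:
  assumes "2 * \<bar>of_int j\<bar> \<le> P" "\<bar>j\<bar> < J"
  shows "weight j \<le> 96 / P"
proof -
  have J: "(0::real) < of_int J" using J_pos by simp
  have "weight j \<le> 1 / of_int J * norm (saw_coeff j)"
    unfolding weight_def
  proof (rule mult_right_mono)
    have "of_int (J - \<bar>j\<bar>) / (of_int J)\<^sup>2 \<le> of_int J / (of_int J :: real)\<^sup>2"
      by (intro divide_right_mono) auto
    thus "of_int (J - \<bar>j\<bar>) / (of_int J)\<^sup>2 \<le> 1 / (of_int J :: real)"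
      using J by (simp add: power2_eq_square)
  qed simp
  also have "\<dots> \<le> 1 / of_int J * (2 * peak P (of_int j / P) * (12 * pi * of_int M * \<bar>of_int j\<bar> / P))"
    using J peak_nonneg[OF P_pos]
    by (intro mult_left_mono order_trans[OF norm_saw_coeff_le] norm_tooth_coeff_small) auto
  also have "\<dots> = 24 * pi / P * (\<bar>of_int j\<bar> / (1 + \<bar>of_int j\<bar>))"
    unfolding peak_fraction[OF assms(1)] using P_pos M_pos by (simp add: J_eq divide_simps)
  also have "\<dots> \<le> 24 * pi / P * 1"
    using P_pos by (intro mult_left_mono) (auto simp: divide_simps)
  also have "\<dots> \<le> 96 / P"
    using P_pos pi_less_4 by (auto simp: divide_simps)
  finally show ?thesis .
qed

lemma saw_sum_le:
  assumes "finite Z" "\<And>z. z \<in> Z \<Longrightarrow> \<bar>f z\<bar> \<le> real T"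
  shows "\<bar>\<Sum>z\<in>Z. saw \<delta> T (f z)\<bar>
      \<le> (\<Sum>j\<in>{-(J - 1)..J - 1}. weight j * norm (\<Sum>z\<in>Z. echar (of_int j / P * f z)))
        + real (card Z) * (3 * P ^ 3 / sqrt (of_int J))"
proof -
  let ?I = "{- 2 * int T * M..- 2 * int T * M + J - 1}"
  define A where "A z = (\<Sum>g\<in>?I. saw \<delta> T (of_int g / of_int M) * fejer J (f z / P - of_int g / of_int J))" for z
  let ?c = "\<lambda>j. complex_of_real (of_int (J - \<bar>j\<bar>) / (of_int J)\<^sup>2)"
  let ?s = "\<lambda>g. complex_of_real (saw \<delta> T (of_int g / of_int M))"
  let ?E = "\<lambda>j. \<Sum>z\<in>Z. echar (of_int j / P * f z)"
  let ?G = "\<lambda>z j g. ?s g * (?c j * echar ((f z / P - of_int g / of_int J) * of_int j))"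
  have approx: "\<bar>saw \<delta> T (f z) - A z\<bar> \<le> 3 * P ^ 3 / sqrt (of_int J)" if z: "z \<in> Z" for z
  proof -
    have "\<bar>saw \<delta> T (f z) - A z\<bar> \<le> 3 * P * (real T * (4 / \<delta>)) / sqrt (of_int J)"
      unfolding A_def
    proof (rule fejer_approx[OF M_pos P_pos J_eq])
      fix g assume g: "g \<in> ?I"
      hence "- 2 * int T * M \<le> g" "g \<le> 2 * int T * M" by (auto simp: J_def)
      hence "\<bar>g\<bar> \<le> 2 * int T * M" by auto
      hence "of_int \<bar>g\<bar> \<le> (of_int (2 * int T * M) :: real)" by (simp only: of_int_le_iff)
      hence "\<bar>of_int g :: real\<bar> \<le> 2 * real T * of_int M" by simp
      hence "\<bar>of_int g / of_int M :: real\<bar> \<le> 2 * real T" using M_pos by (simp add: divide_simps)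
      \<comment> \<open>A height is at most \<open>P / 4\<close> and a grid point at most
        \<open>P / 2\<close> in absolute value. An offset of at most three quarters of a period is
        within a factor 3 of its distance modulo the period.\<close>
      hence u: "\<bar>f z - of_int g / of_int M\<bar> \<le> 3 / 4 * P" using assms(2)[OF z] unfolding P_def by linarith
      define x where "x = f z / P - of_int g / of_int J"
      have x: "f z - of_int g / of_int M = P * x"
        using P_pos M_pos by (simp add: x_def J_eq field_simps)
      have "\<bar>x\<bar> \<le> 3 / 4" using u P_pos unfolding x by (simp add: abs_mult)
      hence "\<bar>x\<bar> \<le> 3 * dist_int x" using dist_int_ge_min[of x] by linarith
      thus "\<bar>f z - of_int g / of_int M\<bar> \<le> 3 * P * dist_int (f z / P - of_int g / of_int J)"
        unfolding x x_def[symmetric] using P_pos by (simp add: abs_mult)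
    qed (use saw_lipschitz[OF delta] delta in auto)
    also have "3 * P * (real T * (4 / \<delta>)) = 3 * P ^ 3"
      by (simp add: \<delta>_def P_def power3_eq_cube)
    finally show ?thesis .
  qed
  have "complex_of_real (\<Sum>z\<in>Z. A z) = (\<Sum>z\<in>Z. \<Sum>g\<in>?I. \<Sum>j\<in>{-(J - 1)..J - 1}. ?G z j g)"
    unfolding A_def of_real_sum of_real_mult fejer_expand sum_distrib_left ..
  also have "\<dots> = (\<Sum>z\<in>Z. \<Sum>j\<in>{-(J - 1)..J - 1}. \<Sum>g\<in>?I. ?G z j g)"
    by (rule sum.cong[OF refl], rule sum.swap)
  also have "\<dots> = (\<Sum>j\<in>{-(J - 1)..J - 1}. \<Sum>z\<in>Z. \<Sum>g\<in>?I. ?G z j g)"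
    by (rule sum.swap)
  also have "\<dots> = (\<Sum>j\<in>{-(J - 1)..J - 1}. \<Sum>z\<in>Z. \<Sum>g\<in>?I. ?c j * echar (of_int j / P * f z) * (?s g * echar (- (of_int j / of_int J) * of_int g)))"
  proof (intro sum.cong refl)
    fix j z g
    have "(f z / P - of_int g / of_int J) * of_int j = of_int j / P * f z + - (of_int j / of_int J) * of_int g"
      using P_pos J_pos by (simp add: field_simps)
    thus "?G z j g
        = ?c j * echar (of_int j / P * f z) * (?s g * echar (- (of_int j / of_int J) * of_int g))"
      by (simp only: echar_add mult_ac)
  qed
  also have "\<dots> = (\<Sum>j\<in>{-(J - 1)..J - 1}. ?c j * saw_coeff j * ?E j)"
    unfolding sum_distrib_left[symmetric] saw_coeff_def[symmetric] sum_distrib_right[symmetric]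
    by (simp only: mult_ac)
  finally have "norm (complex_of_real (\<Sum>z\<in>Z. A z)) \<le> (\<Sum>j\<in>{-(J - 1)..J - 1}. norm (?c j * saw_coeff j * ?E j))"
    by (simp only: norm_sum)
  also have "\<dots> = (\<Sum>j\<in>{-(J - 1)..J - 1}. weight j * norm (?E j))"
  proof (intro sum.cong refl)
    fix j assume "j \<in> {-(J - 1)..J - 1}"
    hence "norm (?c j) = of_int (J - \<bar>j\<bar>) / (of_int J)\<^sup>2"
      unfolding norm_of_real by (intro abs_of_nonneg divide_nonneg_nonneg) auto
    thus "norm (?c j * saw_coeff j * ?E j) = weight j * norm (?E j)"
      unfolding norm_mult weight_def by simp
  qed
  finally have 1: "\<bar>\<Sum>z\<in>Z. A z\<bar> \<le> (\<Sum>j\<in>{-(J - 1)..J - 1}. weight j * norm (?E j))"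
    by (simp only: norm_of_real)
  have "\<bar>(\<Sum>z\<in>Z. saw \<delta> T (f z)) - (\<Sum>z\<in>Z. A z)\<bar> \<le> (\<Sum>z\<in>Z. \<bar>saw \<delta> T (f z) - A z\<bar>)"
    unfolding sum_subtractf[symmetric] by (rule sum_abs)
  also have "\<dots> \<le> real (card Z) * (3 * P ^ 3 / sqrt (of_int J))"
    by (rule sum_bounded_above[OF approx])
  finally show ?thesis using 1 by linarith
qed

end

section \<open>The two-dimensional estimate\<close>

lemma harm_le_powr:
  assumes "0 < \<eta>" "1 \<le> n"
  shows "harm n \<le> (1 + 1 / \<eta>) * real n powr \<eta>"
proof -
  have "harm n \<le> 1 + ln (real n)"
    using assms(2)
  proof (induction n rule: nat_induct_at_least)
    case base
    show ?case by (simp add: harm_def)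
  next
    case (Suc n)
    have "inverse (real (Suc n)) \<le> ln (real (Suc n)) - ln (real n)"
      using ln_inverse_approx_ge[of "real n" "real (Suc n)"] Suc.hyps ln_diff_le[of "real n" "real (Suc n)"]
      by (simp add: field_simps)
    thus ?case using Suc.IH by (simp add: harm_Suc)
  qed
  also have "ln (real n) \<le> real n powr \<eta> / \<eta>"
    using assms ln_powr_bound[of "real n" \<eta>] by simp
  also have "1 + real n powr \<eta> / \<eta> \<le> (1 + 1 / \<eta>) * real n powr \<eta>"
    using assms ge_one_powr_ge_zero[of "real n" \<eta>] by (simp add: algebra_simps)
  finally show ?thesis by simp
qed

lemma peak_total_minus: "peak_total P L (- x) = peak_total P L x"
  by (simp add: peak_total_def)

lemma peak_total_eq:
  assumes "0 < P"
  shows "peak_total P L x = P + 2 * (\<Sum>l\<in>{1..L}. peak P (x * real l))"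
proof -
  have "{- int L..int L} = {0} \<union> ({1..int L} \<union> {- int L..-1})" by auto
  hence "peak_total P L x = (\<Sum>l\<in>{0} \<union> ({1..int L} \<union> {- int L..-1}). peak P (x * of_int l))"
    by (simp add: peak_total_def)
  also have "\<dots> = peak P 0 + ((\<Sum>l\<in>{1..int L}. peak P (x * of_int l)) + (\<Sum>l\<in>{- int L..-1}. peak P (x * of_int l)))"
    by (subst sum.union_disjoint; (subst sum.union_disjoint)?) auto
  also have "(\<Sum>l\<in>{- int L..-1}. peak P (x * of_int l)) = (\<Sum>l\<in>{1..int L}. peak P (x * of_int l))"
  proof (rule sum.reindex_bij_witness[of _ uminus uminus])
    fix l show "peak P (x * of_int (- l)) = peak P (x * of_int l)"
      using peak_minus[of P "x * of_int l"] by simp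
  qed auto
  also have "(\<Sum>l\<in>{1..int L}. peak P (x * of_int l)) = (\<Sum>l\<in>{1..L}. peak P (x * real l))"
    by (rule sum.reindex_bij_witness[of _ int nat]) auto
  finally show ?thesis using peak_zero[OF assms] by simp
qed

lemma sum_le_sum_inj:
  fixes F :: "'a \<Rightarrow> real" and G :: "'b \<Rightarrow> real"
  assumes "finite B" "inj_on \<phi> A" "\<phi> ` A \<subseteq> B" "\<And>x. x \<in> A \<Longrightarrow> F x \<le> G (\<phi> x)" "\<And>y. y \<in> B \<Longrightarrow> 0 \<le> G y"
  shows "sum F A \<le> sum G B"
proof -
  have "sum F A \<le> (\<Sum>x\<in>A. G (\<phi> x))" using assms by (intro sum_mono)
  also have "\<dots> = sum G (\<phi> ` A)" using assms by (simp add: sum.reindex)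
  also have "\<dots> \<le> sum G B" using assms by (intro sum_mono2) auto
  finally show ?thesis .
qed

context saw_fourier
begin

text \<open>Frequencies are written as \<open>j / P = h + r / P\<close> with \<open>\<bar>r\<bar> \<le> P / 2\<close>;
  \<open>h = 0\<close> contributes the first sum.\<close>
lemma weighted_sum_split:
  assumes V: "\<And>x. 0 \<le> V x" "\<And>x. V (- x) = V x"
  shows "(\<Sum>j\<in>{-(J - 1)..J - 1}. weight j * V (of_int j / P))
      \<le> (\<Sum>r\<in>{- (2 * int T)..2 * int T}. if r = 0 then 0 else 96 / P * V (of_int r / P))
        + 8 * (\<Sum>h\<in>{1..nat M}. \<Sum>r\<in>{- (2 * int T)..2 * int T}. V (real h + of_int r / P) / (real h * (\<bar>of_int r\<bar> + 1)))"
proof -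
  let ?F = "\<lambda>h r. 4 / (\<bar>of_int h\<bar> * (\<bar>of_int r\<bar> + 1)) * V (of_int h + of_int r / P)"
  let ?R = "{- (2 * int T)..2 * int T}"
  let ?A = "{j \<in> {-(J - 1)..J - 1}. \<bar>j\<bar> \<le> 2 * int T}" and ?B = "{j \<in> {-(J - 1)..J - 1}. \<not> \<bar>j\<bar> \<le> 2 * int T}"
  have "(\<Sum>j\<in>{-(J - 1)..J - 1}. weight j * V (of_int j / P))
      = (\<Sum>j\<in>?A. weight j * V (of_int j / P)) + (\<Sum>j\<in>?B. weight j * V (of_int j / P))"
  proof -
    have "finite ?A" "finite ?B" by (rule finite_subset[of _ "{-(J - 1)..J - 1}"], auto)+
    hence "sum F (?A \<union> ?B) = sum F ?A + sum F ?B" for F :: "int \<Rightarrow> real"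
      by (intro sum.union_disjoint) auto
    moreover have "?A \<union> ?B = {-(J - 1)..J - 1}" by auto
    ultimately show ?thesis by simp
  qed
  also have "(\<Sum>j\<in>?A. weight j * V (of_int j / P)) \<le> (\<Sum>r\<in>?R. if r = 0 then 0 else 96 / P * V (of_int r / P))"
  proof (rule sum_le_sum_inj[where \<phi> = id])
    fix j assume j: "j \<in> ?A"
    have "\<bar>of_int j :: real\<bar> \<le> 2 * real T" using j by (auto simp: abs_le_iff)
    hence "weight j \<le> 96 / P" using j by (intro weight_small) (auto simp: P_def)
    thus "weight j * V (of_int j / P) \<le> (if id j = 0 then 0 else 96 / P * V (of_int (id j) / P))"
      using mult_right_mono[OF _ V(1), of "weight j" "96 / P" "of_int j / P"] by (auto simp: weight_zero)
  qed (use P_pos V(1) in auto)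
  also have "(\<Sum>j\<in>?B. weight j * V (of_int j / P))
      \<le> (\<Sum>(h, r)\<in>({- M..M} - {0}) \<times> ?R. ?F h r)"
  \<comment> \<open>Adding half a period before the division gives the balanced remainder
    \<open>r\<close>. As \<open>\<bar>j\<bar>\<close> exceeds \<open>2 * T\<close> here, the
    quotient \<open>h\<close> is nonzero and
    \<open>\<bar>j\<bar> \<ge> P / 2 * \<bar>h\<bar>\<close>.\<close>
  proof (rule sum_le_sum_inj[where \<phi> = "\<lambda>j. ((j + 2 * int T) div (4 * int T), (j + 2 * int T) mod (4 * int T) - 2 * int T)"])
    let ?h = "\<lambda>j. (j + 2 * int T) div (4 * int T)" and ?r = "\<lambda>j. (j + 2 * int T) mod (4 * int T) - 2 * int T"
    have T4: "0 < 4 * int T" using T_ge by simp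
    have dec: "j = 4 * int T * ?h j + ?r j" for j
      using mult_div_mod_eq[of "4 * int T" "j + 2 * int T"] by linarith
    have r: "- (2 * int T) \<le> ?r j" "?r j \<le> 2 * int T" for j
      using pos_mod_sign[OF T4, of "j + 2 * int T"] pos_mod_bound[OF T4, of "j + 2 * int T"] by linarith+
    have h: "?h j \<noteq> 0" "\<bar>?h j\<bar> \<le> M" if "j \<in> ?B" for j
    proof -
      show "?h j \<noteq> 0" using dec[of j] r[of j] that by auto
      have "\<bar>j\<bar> < J" using that by auto
      have "\<bar>4 * int T * ?h j\<bar> < J + 2 * int T" using dec[of j] r[of j] \<open>\<bar>j\<bar> < J\<close> by linarith
      hence "4 * int T * \<bar>?h j\<bar> < 4 * int T * (M + 1)" using T_ge by (simp add: abs_mult J_def distrib_left)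
      thus "\<bar>?h j\<bar> \<le> M" using T4 by simp
    qed
    show "inj_on (\<lambda>j. (?h j, ?r j)) ?B"
    proof (rule inj_onI)
      fix i j assume "(?h i, ?r i) = (?h j, ?r j)"
      thus "i = j" using dec[of i] dec[of j] by simp
    qed
    show "(\<lambda>j. (?h j, ?r j)) ` ?B \<subseteq> ({- M..M} - {0}) \<times> ?R"
    proof
      fix p assume "p \<in> (\<lambda>j. (?h j, ?r j)) ` ?B"
      then obtain j where j: "j \<in> ?B" "p = (?h j, ?r j)" by blast
      from h[OF j(1)] r[of j] j(2) show "p \<in> ({- M..M} - {0}) \<times> ?R" by (simp add: abs_le_iff)
    qed
    fix j assume j: "j \<in> ?B"
    define h where "h = ?h j"
    define r' where "r' = ?r j"
    have jeq: "j = 4 * int T * h + r'" unfolding h_def r'_def by (rule dec)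
    have h0: "h \<noteq> 0" and rb: "\<bar>r'\<bar> \<le> 2 * int T" using h(1)[OF j] r[of j] by (auto simp: h_def r'_def)
    have "of_int j = P * of_int h + of_int r'" unfolding jeq by (simp add: P_def)
    hence jP: "of_int j / P = of_int h + of_int r' / P" using P_pos by (simp add: field_simps)
    have rb': "2 * \<bar>of_int r' :: real\<bar> \<le> P" using rb by (simp add: P_def)
    have "peak P (of_int j / P) = peak P (of_int r' / P + of_int h)" by (simp add: jP add.commute)
    hence k: "peak P (of_int j / P) = P / (1 + \<bar>of_int r'\<bar>)" using peak_fraction[OF rb'] by simp
    have "2 * int T * \<bar>h\<bar> \<le> \<bar>j\<bar>"
    proof -
      have "4 * int T * \<bar>h\<bar> \<le> \<bar>j\<bar> + \<bar>r'\<bar>" unfolding jeq using abs_triangle_ineq4[of "4 * int T * h + r'" r']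
        by (simp add: abs_mult)
      moreover have "2 * int T * 1 \<le> 2 * int T * \<bar>h\<bar>" using h0 by (intro mult_left_mono) auto
      ultimately show ?thesis using rb by linarith
    qed
    hence "of_int (2 * int T * \<bar>h\<bar>) \<le> (of_int \<bar>j\<bar> :: real)" by (simp only: of_int_le_iff)
    hence jh: "P / 2 * \<bar>of_int h\<bar> \<le> \<bar>of_int j\<bar>" by (simp add: P_def)
    have ph: "0 < P / 2 * \<bar>of_int h\<bar>" using P_pos h0 by simp
    have "weight j \<le> 2 * peak P (of_int j / P) / \<bar>of_int j\<bar>" using j by (intro weight_le) auto
    also have "\<dots> \<le> 2 * peak P (of_int j / P) / (P / 2 * \<bar>of_int h\<bar>)"
      using jh ph peak_nonneg[OF P_pos] P_pos by (intro divide_left_mono mult_pos_pos) auto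
    also have "\<dots> = 4 / (\<bar>of_int h\<bar> * (\<bar>of_int r'\<bar> + 1))"
      unfolding k using P_pos h0 by (simp add: divide_simps)
    finally have "weight j * V (of_int j / P) \<le> 4 / (\<bar>of_int h\<bar> * (\<bar>of_int r'\<bar> + 1)) * V (of_int j / P)"
      using V(1) by (intro mult_right_mono)
    thus "weight j * V (of_int j / P) \<le> (case (?h j, ?r j) of (h, r) \<Rightarrow> ?F h r)"
      unfolding jP h_def r'_def by simp
  qed (use V(1) in auto)
  also have "(\<Sum>(h, r)\<in>({- M..M} - {0}) \<times> ?R. ?F h r)
      = (\<Sum>h\<in>{- M..M} - {0}. \<Sum>r\<in>?R. ?F h r)"
    by (simp add: sum.cartesian_product)
  also have "\<dots> = (\<Sum>h\<in>{1..M} \<union> {- M..-1}. \<Sum>r\<in>?R. ?F h r)"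
    by (rule sum.cong) auto
  also have "\<dots> = (\<Sum>h\<in>{1..M}. \<Sum>r\<in>?R. ?F h r)
      + (\<Sum>h\<in>{- M..-1}. \<Sum>r\<in>?R. ?F h r)"
    by (rule sum.union_disjoint) auto
  \<comment> \<open>Evenness of \<open>V\<close> folds negative \<open>h\<close> onto positive
    \<open>h\<close>, with \<open>r\<close> replaced by \<open>- r\<close>; this doubles the
    constant 4 to 8.\<close>
  also have "(\<Sum>h\<in>{- M..-1}. \<Sum>r\<in>?R. ?F h r)
      = (\<Sum>h\<in>{1..M}. \<Sum>r\<in>?R. ?F h r)"
  proof (rule sum.reindex_bij_witness[of _ uminus uminus])
    fix h assume "h \<in> {- M..-1}"
    show "(\<Sum>r\<in>?R. 4 / (\<bar>of_int (- h)\<bar> * (\<bar>of_int r\<bar> + 1)) * V (of_int (- h) + of_int r / P))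
        = (\<Sum>r\<in>?R. ?F h r)"
    proof (rule sum.reindex_bij_witness[of _ uminus uminus])
      fix r
      have "V (of_int h + of_int (- r) / P) = V (- (of_int h + of_int (- r) / P))" by (rule V(2)[symmetric])
      thus "4 / (\<bar>of_int h\<bar> * (\<bar>of_int (- r)\<bar> + 1)) * V (of_int h + of_int (- r) / P)
          = 4 / (\<bar>of_int (- h)\<bar> * (\<bar>of_int r\<bar> + 1)) * V (of_int (- h) + of_int r / P)" by simp
    qed auto
  qed auto
  also have "(\<Sum>h\<in>{1..M}. \<Sum>r\<in>?R. ?F h r)
      = (\<Sum>h\<in>{1..nat M}. \<Sum>r\<in>?R. 4 * (V (real h + of_int r / P) / (real h * (\<bar>of_int r\<bar> + 1))))"
    by (rule sum.reindex_bij_witness[of _ int nat]) (auto intro!: sum.cong)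
  also have "\<dots> = 4 * (\<Sum>h\<in>{1..nat M}. \<Sum>r\<in>?R. V (real h + of_int r / P) / (real h * (\<bar>of_int r\<bar> + 1)))"
    by (simp only: sum_distrib_left)
  finally show ?thesis by simp
qed

text \<open>In this regime \<mu> is of order \<open>1 / P\<close> and \<open>L\<close> of order
  \<open>P\<close>. The three harmonic factors come from the window in \<open>r\<close>, the sum
  over \<open>h\<close> and the mass of a progression with step \<mu>. \<open>Z\<close> is a common
  bound for the lengths of all harmonic sums.\<close>

lemma weighted_peak_total:
  fixes L c Z :: nat and C1 \<mu> \<tau> :: real
  assumes \<mu>: "1 / C1 \<le> \<mu> * P" "\<mu> * P \<le> C1" and C1: "1 \<le> C1" and L: "real L = real c * P"
    and \<tau>: "\<And>k. 0 < k \<Longrightarrow> k \<le> nat M * L \<Longrightarrow> real (card {d. d dvd k}) \<le> \<tau>" "1 \<le> \<tau>"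
    and Z: "C1 * P\<^sup>2 \<le> real Z" "of_int M \<le> real Z" "real L \<le> real Z"
  shows "(\<Sum>j\<in>{-(J - 1)..J - 1}. weight j * peak_total P L (\<mu> * (of_int j / P)))
      \<le> 10 ^ 4 * (real c * C1 + 2) ^ 3 * C1 * (real c + 1) * P * \<tau> * harm Z ^ 3"
proof -
  let ?R = "{- (2 * int T)..2 * int T}"
  define H where "H = (harm Z :: real)"
  define b where "b = real c * C1 + 2"
  let ?X = "\<Sum>h\<in>{1..nat M}. \<Sum>l\<in>{1..L}. peak P (\<mu> * real l * real h) / real h" and ?Y = "\<tau> * (2 * H) * (b * (4 * P * C1 * H))"
  have C1P: "1 * P \<le> C1 * P" "P * 1 \<le> P * P" using C1 P_ge P_pos by (intro mult_right_mono mult_left_mono; simp)+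
  have "C1 * (P * 1) \<le> C1 * (P * P)" using C1 by (intro mult_left_mono[OF C1P(2)]) simp
  hence PZ: "C1 * P \<le> real Z" "P \<le> real Z"
    using Z(1) C1P(1) by (simp_all add: power2_eq_square)
  have Z1: "1 \<le> Z" using PZ(2) P_ge by linarith
  have H1: "1 \<le> H" using harm_mono[of 1 Z, where ?'a = real] Z1 by (simp add: H_def harm_expand)
  have harmH: "harm n \<le> H" if "real n \<le> real Z" for n
    unfolding H_def using that by (intro harm_mono) simp
  have harmfl: "harm (nat \<lfloor>x\<rfloor>) \<le> H" if "x \<le> real Z" for x
  proof (rule harmH)
    show "real (nat \<lfloor>x\<rfloor>) \<le> real Z" using that by (cases "0 \<le> x") (auto simp: of_nat_nat intro: order_trans[OF of_int_floor_le])
  qed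
  have b2: "2 \<le> b" using C1 by (simp add: b_def)
  have \<mu>0: "0 < \<mu>"
  proof (rule ccontr)
    assume "\<not> 0 < \<mu>"
    hence "\<mu> * P \<le> 0" using P_pos by (simp add: mult_nonpos_nonneg)
    moreover have "0 < 1 / C1" using C1 by simp
    ultimately show False using \<mu> by linarith
  qed
  have invmu: "1 / \<mu> \<le> C1 * P" using \<mu>(1) \<mu>0 C1 by (simp add: field_simps)
  have muL: "real L * \<mu> \<le> b - 2"
    using mult_left_mono[OF \<mu>(2), of "real c"] by (simp add: L b_def mult_ac)
  have mul: "\<mu> * real l \<le> b - 2" if "l \<in> {1..L}" for l
  proof -
    have "\<mu> * real l \<le> \<mu> * real L" using that \<mu>0 by (intro mult_left_mono) auto
    thus ?thesis using muL by (simp add: mult.commute)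
  qed
  \<comment> \<open>For fixed \<open>h\<close> and \<open>l\<close>, raising \<open>r\<close> by one
    moves the argument of the kernel by \<open>\<sigma> l\<close>; a full window in \<open>r\<close>
    covers length O(b).\<close>
  define \<sigma> where "\<sigma> l = \<mu> * real l / P" for l
  have \<sigma>0: "0 < \<sigma> l" if "l \<in> {1..L}" for l using that \<mu>0 P_pos by (simp add: \<sigma>_def)
  have \<sigma>w: "(2 * real (2 * T) + 1) * \<sigma> l + 2 \<le> 2 * b" if "l \<in> {1..L}" for l
  proof -
    have "(2 * real (2 * T) + 1) * \<sigma> l \<le> (2 * P) * \<sigma> l"
      using \<sigma>0[OF that] P_ge by (intro mult_right_mono) (auto simp: P_def)
    also have "\<dots> = 2 * (\<mu> * real l)" using P_pos by (simp add: \<sigma>_def)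
    finally show ?thesis using mul[OF that] by simp
  qed
  have inv\<sigma>: "1 / \<sigma> l \<le> C1 * P\<^sup>2 / real l" if "l \<in> {1..L}" for l
  proof -
    have "1 / \<sigma> l = 1 / \<mu> * (P / real l)" by (simp add: \<sigma>_def)
    also have "\<dots> \<le> C1 * P * (P / real l)" using P_pos by (intro mult_right_mono invmu) auto
    finally show ?thesis by (simp add: power2_eq_square)
  qed
  have inv\<sigma>Z: "1 / \<sigma> l \<le> real Z" if "l \<in> {1..L}" for l
  proof -
    have "C1 * P\<^sup>2 / real l \<le> C1 * P\<^sup>2 / 1" using that C1 by (intro divide_left_mono) auto
    thus ?thesis using inv\<sigma>[OF that] Z(1) by linarith
  qed
  have mass: "peak_mass P (\<sigma> l) \<le> 2 * (P + H * (C1 * P\<^sup>2 / real l))" if "l \<in> {1..L}" for l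
  proof -
    have "harm (nat \<lfloor>1 / \<sigma> l\<rfloor>) * (1 / \<sigma> l) \<le> H * (C1 * P\<^sup>2 / real l)"
      using \<sigma>0[OF that] harm_nonneg H1 by (intro mult_mono harmfl inv\<sigma> inv\<sigma>Z that) auto
    thus ?thesis by (simp add: peak_mass_def)
  qed
  have \<sigma>mass: "\<sigma> l * peak_mass P (\<sigma> l) \<le> 2 * (b + H)" if "l \<in> {1..L}" for l
  proof -
    have "\<sigma> l * peak_mass P (\<sigma> l) = 2 * (\<mu> * real l + harm (nat \<lfloor>1 / \<sigma> l\<rfloor>))"
      using \<sigma>0[OF that] P_pos by (simp add: peak_mass_def distrib_left) (simp add: \<sigma>_def)
    thus ?thesis using mul[OF that] harmfl[OF inv\<sigma>Z[OF that]] by simp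
  qed
  \<comment> \<open>The price of removing \<open>r\<close> by \<open>peak_weighted_window\<close>: 8
    of the 24 cover its harmonic term, 16 its mass term.\<close>
  define Q where "Q = 24 * b * (b + H)"
  have Q0: "0 \<le> Q" using b2 H1 by (simp add: Q_def)
  have harmT: "harm (2 * T + 1) \<le> H"
    using PZ(2) P_ge by (intro harmH) (simp add: P_def)
  have window: "(\<Sum>r\<in>?R. peak P (x + \<sigma> l * of_int r) / (\<bar>of_int r\<bar> + 1)) \<le> peak P x * Q" if l: "l \<in> {1..L}" for l x
  proof -
    have "(\<Sum>r\<in>?R. peak P (x + \<sigma> l * of_int r) / (\<bar>of_int r\<bar> + 1))
        \<le> peak P x * (4 * harm (2 * T + 1) + 4 * \<sigma> l * ((2 * real (2 * T) + 1) * \<sigma> l + 2) * peak_mass P (\<sigma> l))"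
      using peak_weighted_window[OF P_pos \<sigma>0[OF l], of x "2 * T"] by simp
    also have "\<dots> \<le> peak P x * Q"
    proof (rule mult_left_mono[OF _ peak_nonneg[OF P_pos]])
      have "((2 * real (2 * T) + 1) * \<sigma> l + 2) * (\<sigma> l * peak_mass P (\<sigma> l)) \<le> (2 * b) * (2 * (b + H))"
        using \<sigma>0[OF l] peak_mass_nonneg[OF P_pos \<sigma>0[OF l]] b2 by (intro mult_mono \<sigma>w \<sigma>mass l) auto
      moreover have "4 * H \<le> 8 * b * (b + H)"
      proof -
        have "1 * H \<le> b * (b + H)" using b2 H1 by (intro mult_mono) auto
        thus ?thesis using H1 by linarith
      qed
      ultimately show "4 * harm (2 * T + 1) + 4 * \<sigma> l * ((2 * real (2 * T) + 1) * \<sigma> l + 2) * peak_mass P (\<sigma> l) \<le> Q"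
      proof -
        assume w: "((2 * real (2 * T) + 1) * \<sigma> l + 2) * (\<sigma> l * peak_mass P (\<sigma> l)) \<le> (2 * b) * (2 * (b + H))"
          and h: "4 * H \<le> 8 * b * (b + H)"
        have "4 * \<sigma> l * ((2 * real (2 * T) + 1) * \<sigma> l + 2) * peak_mass P (\<sigma> l)
            = 4 * (((2 * real (2 * T) + 1) * \<sigma> l + 2) * (\<sigma> l * peak_mass P (\<sigma> l)))" by (simp only: mult_ac)
        also have "\<dots> \<le> 4 * ((2 * b) * (2 * (b + H)))" using w by (intro mult_left_mono) auto
        finally have "4 * harm (2 * T + 1) + 4 * \<sigma> l * ((2 * real (2 * T) + 1) * \<sigma> l + 2) * peak_mass P (\<sigma> l)
            \<le> 8 * b * (b + H) + 4 * ((2 * b) * (2 * (b + H)))" using h harmT by linarith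
        also have "\<dots> = Q" by (simp add: Q_def algebra_simps)
        finally show ?thesis .
      qed
    qed
    finally show ?thesis .
  qed
  let ?V = "\<lambda>x. peak_total P L (\<mu> * x)"
  have V: "?V x = P + 2 * (\<Sum>l\<in>{1..L}. peak P (\<mu> * x * real l))" for x
    by (rule peak_total_eq[OF P_pos])
  have arg: "\<mu> * (real h + of_int r / P) * real l = \<mu> * real l * real h + \<sigma> l * of_int r" for h l r
    by (simp add: \<sigma>_def algebra_simps)
  have inner: "(\<Sum>r\<in>?R. ?V (real h + of_int r / P) / (real h * (\<bar>of_int r\<bar> + 1)))
      \<le> 2 * P * H * (1 / real h) + 2 * Q * (\<Sum>l\<in>{1..L}. peak P (\<mu> * real l * real h) / real h)" if "h \<in> {1..nat M}" for h
  proof -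
    have "(\<Sum>r\<in>?R. ?V (real h + of_int r / P) / (real h * (\<bar>of_int r\<bar> + 1)))
        = (\<Sum>r\<in>?R. P / real h * (1 / (\<bar>of_int r\<bar> + 1))
          + 2 / real h * (\<Sum>l\<in>{1..L}. peak P (\<mu> * real l * real h + \<sigma> l * of_int r) / (\<bar>of_int r\<bar> + 1)))"
      unfolding V arg by (intro sum.cong refl) (simp add: add_divide_distrib sum_divide_distrib[symmetric])
    also have "\<dots> = P / real h * (\<Sum>r\<in>?R. 1 / (\<bar>of_int r\<bar> + 1))
          + 2 / real h * (\<Sum>r\<in>?R. \<Sum>l\<in>{1..L}. peak P (\<mu> * real l * real h + \<sigma> l * of_int r) / (\<bar>of_int r\<bar> + 1))"
      by (simp only: sum.distrib sum_distrib_left)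
    also have "(\<Sum>r\<in>?R. \<Sum>l\<in>{1..L}. peak P (\<mu> * real l * real h + \<sigma> l * of_int r) / (\<bar>of_int r\<bar> + 1))
        = (\<Sum>l\<in>{1..L}. \<Sum>r\<in>?R. peak P (\<mu> * real l * real h + \<sigma> l * of_int r) / (\<bar>of_int r\<bar> + 1))"
      by (rule sum.swap)
    also have "P / real h * (\<Sum>r\<in>?R. 1 / (\<bar>of_int r\<bar> + 1)) + 2 / real h * \<dots>
        \<le> P / real h * (2 * H) + 2 / real h * (\<Sum>l\<in>{1..L}. peak P (\<mu> * real l * real h) * Q)"
    proof (intro add_mono mult_left_mono sum_mono window)
      show "(\<Sum>r\<in>?R. 1 / (\<bar>of_int r\<bar> + 1)) \<le> 2 * H"
        using sum_inverse_window[of "2 * T"] harmT by simp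
    qed (use P_pos in auto)
    also have "\<dots> = 2 * P * H * (1 / real h) + 2 * Q * (\<Sum>l\<in>{1..L}. peak P (\<mu> * real l * real h) / real h)"
      by (simp add: sum_distrib_left sum_distrib_right sum_divide_distrib mult_ac)
    finally show ?thesis .
  qed
  have massmu: "peak_mass P \<mu> \<le> 4 * P * C1 * H"
  proof -
    have "harm (nat \<lfloor>1 / \<mu>\<rfloor>) * (1 / \<mu>) \<le> H * (C1 * P)"
      using \<mu>0 harm_nonneg H1 invmu PZ(1) by (intro mult_mono harmfl) auto
    moreover have "1 * P \<le> H * (C1 * P)" using H1 C1P P_pos by (intro mult_mono) auto
    ultimately have "peak_mass P \<mu> \<le> 4 * (H * (C1 * P))" by (simp add: peak_mass_def)
    thus ?thesis by (simp add: mult_ac)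
  qed
  have hyper: "?X \<le> \<tau> * (2 * H) * (b * (4 * P * C1 * H))"
  proof -
    have "?X
        \<le> \<tau> * (1 + harm (nat M)) * ((real L * \<mu> + 2) * peak_mass P \<mu>)"
      using \<tau> by (intro peak_hyperbola_sum P_pos \<mu>0) auto
    also have "\<dots> \<le> \<tau> * (2 * H) * (b * (4 * P * C1 * H))"
    proof (intro mult_mono massmu)
      have "harm (nat M) \<le> H" using Z(2) M_pos by (intro harmH) simp
      thus "1 + harm (nat M) \<le> 2 * H" using H1 by simp
    qed (use \<tau>(2) muL H1 b2 \<mu>0 harm_nonneg[of "nat M", where ?'a = real] peak_mass_nonneg[OF P_pos \<mu>0] in auto)
    finally show ?thesis .
  qed
  have far: "(\<Sum>h\<in>{1..nat M}. \<Sum>r\<in>?R. ?V (real h + of_int r / P) / (real h * (\<bar>of_int r\<bar> + 1)))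
      \<le> 2 * P * H * H + 2 * Q * ?Y"
  proof -
    have "(\<Sum>h\<in>{1..nat M}. \<Sum>r\<in>?R. ?V (real h + of_int r / P) / (real h * (\<bar>of_int r\<bar> + 1)))
        \<le> (\<Sum>h\<in>{1..nat M}. 2 * P * H * (1 / real h) + 2 * Q * (\<Sum>l\<in>{1..L}. peak P (\<mu> * real l * real h) / real h))"
      by (intro sum_mono inner)
    also have "\<dots> = 2 * P * H * (\<Sum>h\<in>{1..nat M}. 1 / real h) + 2 * Q * ?X"
      by (simp only: sum.distrib sum_distrib_left)
    also have "\<dots> \<le> 2 * P * H * H + 2 * Q * ?Y"
    proof (intro add_mono mult_left_mono hyper)
      have "harm (nat M) \<le> H" using Z(2) M_pos by (intro harmH) simp
      thus "(\<Sum>h\<in>{1..nat M}. 1 / real h) \<le> H" by (simp add: harm_def inverse_eq_divide)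
    qed (use P_pos H1 Q0 in auto)
    finally show ?thesis .
  qed
  \<comment> \<open>For \<open>h = 0\<close> the weights are flat, of size \<open>1 / P\<close>, and
    the plain count of \<open>peak_sum_window\<close> is applied for each \<open>l\<close>. Its main
    term \<open>P\<^sup>2 / l\<close> sums to a second harmonic factor, so the total is
    \<open>P\<close> times squared logarithms.\<close>
  have near: "(\<Sum>r\<in>?R. if r = 0 then 0 else 96 / P * ?V (of_int r / P)) \<le> 192 * P + 768 * b * (real c * P + H * H * C1 * P)"
  proof -
    have "(\<Sum>r\<in>?R. if r = 0 then 0 else 96 / P * ?V (of_int r / P)) \<le> (\<Sum>r\<in>?R. 96 / P * ?V (of_int r / P))"
      using P_pos peak_total_nonneg[OF P_pos] by (intro sum_mono) auto
    also have "\<dots> = 96 / P * (\<Sum>r\<in>?R. P + 2 * (\<Sum>l\<in>{1..L}. peak P (0 + \<sigma> l * of_int r)))"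
      unfolding V sum_distrib_left[symmetric] by (simp add: \<sigma>_def mult_ac)
    also have "\<dots> = 96 / P * ((4 * real T + 1) * P + 2 * (\<Sum>r\<in>?R. \<Sum>l\<in>{1..L}. peak P (0 + \<sigma> l * of_int r)))"
      by (simp only: sum.distrib sum_distrib_left[symmetric]) simp
    also have "(\<Sum>r\<in>?R. \<Sum>l\<in>{1..L}. peak P (0 + \<sigma> l * of_int r)) = (\<Sum>l\<in>{1..L}. \<Sum>r\<in>?R. peak P (0 + \<sigma> l * of_int r))"
      by (rule sum.swap)
    also have "96 / P * ((4 * real T + 1) * P + 2 * \<dots>)
        \<le> 96 / P * ((2 * P) * P + 2 * (\<Sum>l\<in>{1..L}. (2 * b) * (2 * (P + H * (C1 * P\<^sup>2 / real l)))))"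
    proof (intro mult_left_mono add_mono mult_right_mono sum_mono)
      fix l assume l: "l \<in> {1..L}"
      have "(\<Sum>r\<in>?R. peak P (0 + \<sigma> l * of_int r)) \<le> ((2 * real (2 * T) + 1) * \<sigma> l + 2) * peak_mass P (\<sigma> l)"
        using peak_sum_window[OF P_pos \<sigma>0[OF l], of 0 "2 * T"] by simp
      also have "\<dots> \<le> (2 * b) * (2 * (P + H * (C1 * P\<^sup>2 / real l)))"
        using b2 peak_mass_nonneg[OF P_pos \<sigma>0[OF l]] by (intro mult_mono \<sigma>w mass l) auto
      finally show "(\<Sum>r\<in>?R. peak P (0 + \<sigma> l * of_int r)) \<le> (2 * b) * (2 * (P + H * (C1 * P\<^sup>2 / real l)))" .
    qed (use P_pos P_ge in \<open>auto simp: P_def\<close>)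
    also have "(\<Sum>l\<in>{1..L}. (2 * b) * (2 * (P + H * (C1 * P\<^sup>2 / real l)))) = 4 * b * (real L * P + H * (C1 * P\<^sup>2) * harm L)"
    proof -
      have "(2 * b) * (2 * (P + H * (C1 * P\<^sup>2 / real l))) = 4 * b * P + 4 * b * H * (C1 * P\<^sup>2) * inverse (real l)" for l
        unfolding divide_inverse distrib_left by (simp add: mult_ac)
      hence "(\<Sum>l\<in>{1..L}. (2 * b) * (2 * (P + H * (C1 * P\<^sup>2 / real l)))) = real L * (4 * b * P) + 4 * b * H * (C1 * P\<^sup>2) * harm L"
        by (simp only: sum.distrib harm_def sum_distrib_left[symmetric] sum_constant card_atLeastAtMost) simp
      thus ?thesis by (simp add: distrib_left)
    qed
    also have "96 / P * ((2 * P) * P + 2 * (4 * b * (real L * P + H * (C1 * P\<^sup>2) * harm L)))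
        = 192 * P + 768 * b * (real c * P + H * harm L * C1 * P)"
      using P_pos by (simp add: L field_simps power2_eq_square)
    also have "\<dots> \<le> 192 * P + 768 * b * (real c * P + H * H * C1 * P)"
    proof -
      have "harm L \<le> H" using Z(3) by (rule harmH)
      thus ?thesis using P_pos H1 C1 b2 by (intro add_left_mono mult_left_mono add_left_mono mult_right_mono) auto
    qed
    finally show ?thesis .
  qed
  have "Q \<le> 48 * b\<^sup>2 * H"
  proof -
    have "b * 1 \<le> b * H" "2 * H \<le> b * H" using b2 H1 by (intro mult_left_mono mult_right_mono; simp)+
    hence "b + H \<le> 2 * (b * H)" using H1 by linarith
    hence "24 * b * (b + H) \<le> 24 * b * (2 * (b * H))" using b2 by (intro mult_left_mono) auto
    thus ?thesis by (simp add: Q_def power2_eq_square mult_ac)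
  qed
  hence "2 * Q * ?Y \<le> 2 * (48 * b\<^sup>2 * H) * ?Y"
    using \<tau>(2) H1 b2 P_pos C1 by (intro mult_right_mono mult_left_mono) auto
  also have "\<dots> = 768 * b ^ 3 * (P * C1 * \<tau> * H ^ 3)" by (simp add: power2_eq_square power3_eq_cube)
  finally have f: "2 * Q * ?Y \<le> 768 * b ^ 3 * (P * C1 * \<tau> * H ^ 3)" .
  have "(\<Sum>j\<in>{-(J - 1)..J - 1}. weight j * ?V (of_int j / P))
      \<le> (\<Sum>r\<in>?R. if r = 0 then 0 else 96 / P * ?V (of_int r / P))
        + 8 * (\<Sum>h\<in>{1..nat M}. \<Sum>r\<in>?R. ?V (real h + of_int r / P) / (real h * (\<bar>of_int r\<bar> + 1)))"
  proof (rule weighted_sum_split)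
    show "0 \<le> ?V x" for x by (rule peak_total_nonneg[OF P_pos])
    show "?V (- x) = ?V x" for x using peak_total_minus[of P L "\<mu> * x"] by simp
  qed
  also have "\<dots> \<le> 192 * P + 768 * b * (real c * P + H * H * C1 * P)
      + 8 * (2 * P * H * H + 768 * b ^ 3 * (P * C1 * \<tau> * H ^ 3))"
    by (rule add_mono[OF near mult_left_mono[OF order_trans[OF far add_left_mono[OF f]]]]) simp
  also have "\<dots> = 192 * P + 768 * b * (real c * P) + 768 * b * (H\<^sup>2 * C1 * P) + 16 * (P * H\<^sup>2) + 6144 * b ^ 3 * (P * C1 * \<tau> * H ^ 3)"
    by (simp add: power2_eq_square algebra_simps)
  also have "\<dots> \<le> 10 ^ 4 * b ^ 3 * C1 * (real c + 1) * P * \<tau> * H ^ 3"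
  proof -
    define u where "u = P * C1 * \<tau> * H ^ 3"
    have H23: "1 \<le> H\<^sup>2" "H\<^sup>2 \<le> H ^ 3" using H1 by (auto intro: power_increasing one_le_power)
    have b3: "8 \<le> b ^ 3" "4 * b \<le> b ^ 3"
    proof -
      show "8 \<le> b ^ 3" using power_mono[OF b2, of 3] by simp
      have "2 * 2 * b \<le> b * b * b" using b2 by (intro mult_mono) auto
      thus "4 * b \<le> b ^ 3" by (simp add: power3_eq_cube)
    qed
    have u0: "0 \<le> u" using P_pos C1 \<tau>(2) H1 by (simp add: u_def)
    have CT: "1 \<le> C1 * \<tau>" using C1 \<tau>(2) mult_mono[of 1 C1 1 \<tau>] by simp
    have 1: "P * H\<^sup>2 \<le> u"
    proof -
      have "P * 1 * H\<^sup>2 \<le> P * (C1 * \<tau>) * H ^ 3" using CT H23 P_pos by (intro mult_mono) auto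
      thus ?thesis by (simp add: u_def mult_ac)
    qed
    have "P * 1 \<le> P * H\<^sup>2" using H23 P_pos by (intro mult_left_mono) auto
    hence 2: "P \<le> u" using 1 by linarith
    have 3: "H\<^sup>2 * C1 * P \<le> u"
    proof -
      have "H\<^sup>2 * C1 * P * 1 \<le> H ^ 3 * C1 * P * \<tau>" using \<tau>(2) H1 H23 P_pos C1 by (intro mult_mono) auto
      thus ?thesis by (simp add: u_def mult_ac)
    qed
    have b4: "b \<le> b ^ 3 / 4" using b3 by simp
    have 4: "b * (real c * P) \<le> b ^ 3 / 4 * (real c * u)"
      using b2 2 P_pos by (intro mult_mono[OF b4]) (auto intro: mult_left_mono)
    have 5: "b * (H\<^sup>2 * C1 * P) \<le> b ^ 3 / 4 * u"
      using b2 P_pos C1 H1 by (intro mult_mono[OF b4 3]) auto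
    have 6: "u \<le> b ^ 3 / 8 * u" using b3 u0 mult_right_mono[of 1 "b ^ 3 / 8" u] by simp
    have 7: "0 \<le> b ^ 3 * (real c * u)" "0 \<le> b ^ 3 * u" using b2 u0 by auto
    have "4 * (b * (real c * P)) \<le> b ^ 3 * (real c * u)" "4 * (b * (H\<^sup>2 * C1 * P)) \<le> b ^ 3 * u" "8 * u \<le> b ^ 3 * u"
      using 4 5 6 by simp_all
    hence "192 * P + 768 * (b * (real c * P)) + 768 * (b * (H\<^sup>2 * C1 * P)) + 16 * (P * H\<^sup>2) + 6144 * (b ^ 3 * u)
        \<le> 10000 * (b ^ 3 * u) + 10000 * (b ^ 3 * (real c * u))"
      using 1 2 7 by linarith
    thus ?thesis unfolding u_def by (simp add: algebra_simps)
  qed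
  finally show ?thesis by (simp add: b_def H_def)
qed

end

context saw_fourier
begin

lemma saw_sum_quad2:
  fixes D B E :: int and N c Z :: nat and C1 \<mu> \<tau> :: real
  assumes nd: "D * E \<noteq> B\<^sup>2" and N: "2 * real N + 1 \<le> P"
    and c: "\<bar>D\<bar> + 2 * \<bar>B\<bar> + \<bar>E\<bar> \<le> int c"
    and \<mu>: "1 / C1 \<le> \<mu> * P" "\<mu> * P \<le> C1" and C1: "1 \<le> C1"
    and \<tau>: "\<And>k. 0 < k \<Longrightarrow> k \<le> nat M * (c * (4 * T)) \<Longrightarrow> real (card {d. d dvd k}) \<le> \<tau>" "1 \<le> \<tau>"
    and Z: "C1 * P\<^sup>2 \<le> real Z" "of_int M \<le> real Z" "real (c * (4 * T)) \<le> real Z"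
    and wide: "P ^ 8 \<le> of_int J"
    and f: "\<And>z1 z2. z1 \<in> {- int N..int N} \<Longrightarrow> z2 \<in> {- int N..int N} \<Longrightarrow> \<bar>quad2 D B E \<mu> g0 g1 g2 z1 z2\<bar> \<le> real T"
  shows "\<bar>\<Sum>z\<in>{- int N..int N} \<times> {- int N..int N}. saw \<delta> T (quad2 D B E \<mu> g0 g1 g2 (fst z) (snd z))\<bar>
      \<le> 2 * (10 ^ 4 * (real c * C1 + 2) ^ 3 * C1 * (real c + 1) * P * \<tau> * harm Z ^ 3) + 3 * P"
proof -
  let ?B = "{- int N..int N} \<times> {- int N..int N}" and ?f = "\<lambda>z. quad2 D B E \<mu> g0 g1 g2 (fst z) (snd z)"
  let ?L = "c * (4 * T)"
  have NT: "2 * int N \<le> 4 * int T" using N by (simp add: P_def)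
  have L: "(\<bar>D\<bar> + \<bar>B\<bar>) * (2 * int N) \<le> int ?L" "(\<bar>B\<bar> + \<bar>E\<bar>) * (2 * int N) \<le> int ?L"
  proof -
    have "(\<bar>D\<bar> + \<bar>B\<bar>) * (2 * int N) \<le> int c * (4 * int T)" using c by (intro mult_mono[OF _ NT]) auto
    thus "(\<bar>D\<bar> + \<bar>B\<bar>) * (2 * int N) \<le> int ?L" by simp
    have "(\<bar>B\<bar> + \<bar>E\<bar>) * (2 * int N) \<le> int c * (4 * int T)" using c by (intro mult_mono[OF _ NT]) auto
    thus "(\<bar>B\<bar> + \<bar>E\<bar>) * (2 * int N) \<le> int ?L" by simp
  qed
  have weyl: "norm (\<Sum>z\<in>?B. echar (of_int j / P * ?f z)) \<le> 2 * peak_total P ?L (\<mu> * (of_int j / P))" for j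
    using weyl_quad2[OF nd P_pos N L, of "of_int j / P" \<mu> g0 g1 g2]
    by (simp add: sum.cartesian_product case_prod_unfold)
  have "\<bar>\<Sum>z\<in>?B. saw \<delta> T (?f z)\<bar>
      \<le> (\<Sum>j\<in>{-(J - 1)..J - 1}. weight j * norm (\<Sum>z\<in>?B. echar (of_int j / P * ?f z)))
        + real (card ?B) * (3 * P ^ 3 / sqrt (of_int J))"
    using f by (intro saw_sum_le) auto
  also have "\<dots> \<le> (\<Sum>j\<in>{-(J - 1)..J - 1}. weight j * (2 * peak_total P ?L (\<mu> * (of_int j / P))))
        + P\<^sup>2 * (3 * P ^ 3 / P ^ 4)"
  proof (intro add_mono sum_mono mult_left_mono weyl weight_nonneg mult_mono)
    have "real (card ?B) = (2 * real N + 1)\<^sup>2" by (simp add: power2_eq_square)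
    also have "\<dots> \<le> P\<^sup>2" using N by (intro power_mono) auto
    finally show "real (card ?B) \<le> P\<^sup>2" .
    \<comment> \<open>This is the role of \<open>wide\<close>: with
      \<open>sqrt J \<ge> P ^ 4\<close> the grid error is at most \<open>3 / P\<close> per point,
      hence \<open>3 * P\<close> over the square.\<close>
    have "P ^ 4 = sqrt ((P ^ 4)\<^sup>2)" using P_pos by (intro real_sqrt_unique[symmetric]) auto
    also have "(P ^ 4)\<^sup>2 = P ^ 8" by (simp flip: power_mult)
    also have "sqrt (P ^ 8) \<le> sqrt (of_int J)" using wide by simp
    finally show "3 * P ^ 3 / sqrt (of_int J) \<le> 3 * P ^ 3 / P ^ 4"
      using P_pos J_pos by (intro divide_left_mono) auto
  qed (use P_pos J_pos in auto)
  also have "(\<Sum>j\<in>{-(J - 1)..J - 1}. weight j * (2 * peak_total P ?L (\<mu> * (of_int j / P))))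
      = 2 * (\<Sum>j\<in>{-(J - 1)..J - 1}. weight j * peak_total P ?L (\<mu> * (of_int j / P)))"
    by (simp add: sum_distrib_left mult_ac)
  also have "\<dots> \<le> 2 * (10 ^ 4 * (real c * C1 + 2) ^ 3 * C1 * (real c + 1) * P * \<tau> * harm Z ^ 3)"
  proof (rule mult_left_mono)
    have "real ?L = real c * P" by (simp add: P_def)
    from weighted_peak_total[OF \<mu> C1 this \<tau> Z]
    show "(\<Sum>j\<in>{-(J - 1)..J - 1}. weight j * peak_total P ?L (\<mu> * (of_int j / P)))
        \<le> 10 ^ 4 * (real c * C1 + 2) ^ 3 * C1 * (real c + 1) * P * \<tau> * harm Z ^ 3" by simp
  qed simp
  also have "P\<^sup>2 * (3 * P ^ 3 / P ^ 4) = 3 * P" using P_pos by (simp add: power_numeral_reduce)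
  finally show ?thesis by simp
qed

end

lemma defect_sum_quad2:
  fixes D B E :: int and C1 \<epsilon> :: real
  assumes nd: "D * E \<noteq> B\<^sup>2" and \<epsilon>: "0 < \<epsilon>" and C1: "1 \<le> C1"
  obtains K where "0 \<le> K"
    "\<And>(T::nat) (N::nat) \<mu> g0 g1 g2. 2 \<le> T \<Longrightarrow> 2 * real N + 1 \<le> 4 * real T \<Longrightarrow>
      1 / C1 \<le> \<mu> * (4 * real T) \<Longrightarrow> \<mu> * (4 * real T) \<le> C1 \<Longrightarrow>
      (\<And>z1 z2. z1 \<in> {- int N..int N} \<Longrightarrow> z2 \<in> {- int N..int N} \<Longrightarrow> \<bar>quad2 D B E \<mu> g0 g1 g2 z1 z2\<bar> \<le> real T - 2) \<Longrightarrow>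
      \<bar>\<Sum>z1\<in>{- int N..int N}. \<Sum>z2\<in>{- int N..int N}. defect (quad2 D B E \<mu> g0 g1 g2 z1 z2)\<bar> \<le> K * (4 * real T) powr (1 + \<epsilon>)"
proof -
  define c where "c = nat (\<bar>D\<bar> + 2 * \<bar>B\<bar> + \<bar>E\<bar>)"
  \<comment> \<open>Divisors are counted for numbers up to \<open>a * P ^ 8\<close>, so the exponent
    \<open>\<epsilon> / 16\<close> costs \<open>P powr (\<epsilon> / 2)\<close>.\<close>
  obtain Cd where Cd: "1 \<le> Cd" "\<And>n::nat. 0 < n \<Longrightarrow> real (card {d. d dvd n}) \<le> Cd * real n powr (\<epsilon> / 16)"
    using card_divisors_le[of "\<epsilon> / 16"] \<epsilon> by auto
  \<comment> \<open>The other half of \<epsilon>: \<open>harm Z ^ 3\<close> with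
    \<open>Z = a * P ^ 7\<close> costs \<open>P powr (3 * 7 * \<eta>)\<close>.\<close>
  define \<eta> where "\<eta> = \<epsilon> / 42"
  have \<eta>: "0 < \<eta>" using \<epsilon> by (simp add: \<eta>_def)
  define K2 where "K2 = 10 ^ 4 * (real c * C1 + 2) ^ 3 * C1 * (real c + 1)"
  have K2: "0 \<le> K2" using C1 by (simp add: K2_def)
  define a where "a = nat \<lceil>C1\<rceil> * (c + 1)"
  have a: "C1 \<le> real a" "real c + 1 \<le> real a" "1 \<le> a"
  proof -
    have "C1 \<le> real (nat \<lceil>C1\<rceil>)" by (rule of_nat_ceiling)
    hence n: "1 \<le> real (nat \<lceil>C1\<rceil>)" using C1 by linarith
    have "C1 * 1 \<le> real (nat \<lceil>C1\<rceil>) * (real c + 1)"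
      using \<open>C1 \<le> real (nat \<lceil>C1\<rceil>)\<close> C1 by (intro mult_mono) auto
    thus "C1 \<le> real a" by (simp add: a_def algebra_simps)
    have "1 * (real c + 1) \<le> real (nat \<lceil>C1\<rceil>) * (real c + 1)" using n by (intro mult_right_mono) auto
    thus ac: "real c + 1 \<le> real a" by (simp add: a_def algebra_simps)
    thus "1 \<le> a" by linarith
  qed
  define K3 where "K3 = Cd * real a powr (\<epsilon> / 16) * ((1 + 1 / \<eta>) * real a powr \<eta>) ^ 3"
  have K3: "0 \<le> K3" using Cd \<eta> by (simp add: K3_def)
  show ?thesis
  proof (rule that[of "2 * K2 * K3 + 5"])
    show "0 \<le> 2 * K2 * K3 + 5" using K2 K3 by simp
    fix T N :: nat and \<mu> g0 g1 g2 :: real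
    assume T: "2 \<le> T" and N: "2 * real N + 1 \<le> 4 * real T"
      and \<mu>: "1 / C1 \<le> \<mu> * (4 * real T)" "\<mu> * (4 * real T) \<le> C1"
      and f: "\<And>z1 z2. z1 \<in> {- int N..int N} \<Longrightarrow> z2 \<in> {- int N..int N} \<Longrightarrow> \<bar>quad2 D B E \<mu> g0 g1 g2 z1 z2\<bar> \<le> real T - 2"
    \<comment> \<open>With this \<open>w\<close> one has \<open>M = P ^ 7\<close> and
      \<open>J = P ^ 8\<close>, the size demanded by \<open>wide\<close>.\<close>
    define W where "W = (4 * int T) ^ 6"
    interpret saw_fourier T W
      by standard (use T in \<open>auto simp: W_def\<close>)
    let ?B = "{- int N..int N} \<times> {- int N..int N}"
    let ?f = "\<lambda>z. quad2 D B E \<mu> g0 g1 g2 (fst z) (snd z)"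
    have PT: "P = 4 * real T" by (simp add: P_def)
    have M: "M = (4 * int T) ^ 7" unfolding M_def unfolding W_def by (simp add: power_numeral_reduce)
    have MP: "of_int M = P ^ 7" unfolding M PT by simp
    have JP: "of_int J = P ^ 8" unfolding J_eq MP by (simp add: power_numeral_reduce)
    have P1: "1 \<le> P" using P_ge by simp
    define \<tau> where "\<tau> = Cd * (real a * P ^ 8) powr (\<epsilon> / 16)"
    define Z where "Z = a * (4 * T) ^ 7"
    have Z: "real Z = real a * P ^ 7" by (simp add: Z_def PT)
    have aP: "1 \<le> real a * P ^ n" for n
      using a(3) one_le_power[OF P1, of n] mult_mono[of 1 "real a" 1 "P ^ n"] by simp
    have Z1: "1 \<le> Z" using aP[of 7] Z by linarith
    have \<tau>1: "1 \<le> \<tau>"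
      using mult_mono[of 1 Cd 1 "(real a * P ^ 8) powr (\<epsilon> / 16)"] Cd(1) ge_one_powr_ge_zero[OF aP, of "\<epsilon> / 16"] \<epsilon>
      by (simp add: \<tau>_def)
    \<comment> \<open>The constant term stays free because the lower bound needs \<open>saw\<close>
      delayed by \<delta>, that is, \<open>g0 - \<delta>\<close> in place of \<open>g0\<close>. The
      margin in \<open>real T - 2\<close> pays for the change.\<close>
    have saw: "\<bar>\<Sum>z\<in>?B. saw \<delta> T (quad2 D B E \<mu> g g1 g2 (fst z) (snd z))\<bar> \<le> 2 * (K2 * P * \<tau> * harm Z ^ 3) + 3 * P"
      if g: "\<bar>g - g0\<bar> \<le> 2" for g
      unfolding K2_def
    proof (rule saw_sum_quad2[OF nd])
      show "2 * real N + 1 \<le> P" "1 / C1 \<le> \<mu> * P" "\<mu> * P \<le> C1" using N \<mu> by (simp_all add: PT)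
      show "\<bar>D\<bar> + 2 * \<bar>B\<bar> + \<bar>E\<bar> \<le> int c" by (simp add: c_def)
      show "1 \<le> C1" by (rule C1)
      show "1 \<le> \<tau>" by (rule \<tau>1)
      show "C1 * P\<^sup>2 \<le> real Z"
        unfolding Z using a C1 P1 by (intro mult_mono power_increasing) auto
      show "of_int M \<le> real Z"
        unfolding Z MP using a P1 mult_right_mono[of 1 "real a" "P ^ 7"] by simp
      show "real (c * (4 * T)) \<le> real Z"
      proof -
        have "real c * P ^ 1 \<le> real a * P ^ 7" using a P1 by (intro mult_mono power_increasing) auto
        thus ?thesis unfolding Z by (simp add: PT)
      qed
      show "P ^ 8 \<le> of_int J" by (simp add: JP)
      show "\<bar>quad2 D B E \<mu> g g1 g2 z1 z2\<bar> \<le> real T" if "z1 \<in> {- int N..int N}" "z2 \<in> {- int N..int N}" for z1 z2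
      proof -
        have "quad2 D B E \<mu> g g1 g2 z1 z2 = quad2 D B E \<mu> g0 g1 g2 z1 z2 + (g - g0)" by (simp add: quad2_def)
        thus ?thesis using f[OF that] g by linarith
      qed
      fix k :: nat assume k: "0 < k" "k \<le> nat M * (c * (4 * T))"
      have "real k \<le> real (nat M * (c * (4 * T)))" using k(2) by (simp only: of_nat_le_iff)
      also have "\<dots> = real c * P ^ 8" unfolding M PT by (simp add: nat_power_eq power_numeral_reduce)
      also have "\<dots> \<le> real a * P ^ 8" using a P1 by (intro mult_right_mono) auto
      finally have "real k powr (\<epsilon> / 16) \<le> (real a * P ^ 8) powr (\<epsilon> / 16)" using \<epsilon> by (intro powr_mono2) auto
      thus "real (card {d. d dvd k}) \<le> \<tau>"
        unfolding \<tau>_def using Cd(2)[OF k(1)] Cd(1) by (meson mult_left_mono order_trans zero_le_one)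
    qed
    have fT: "?f z < real T - 1" if "z \<in> ?B" for z
      using f[of "fst z" "snd z"] that by (auto simp: abs_le_iff)
    have card: "real (card ?B) * (2 * \<delta>) \<le> 2 * P"
    proof -
      have "real (card ?B) = (2 * real N + 1)\<^sup>2" by (simp add: power2_eq_square)
      also have "\<dots> \<le> P\<^sup>2" using N by (intro power_mono) (auto simp: PT)
      finally have "real (card ?B) * (2 * \<delta>) \<le> P\<^sup>2 * (2 * \<delta>)" using delta by (intro mult_right_mono) auto
      also have "\<dots> = 2 * P" using P_pos by (simp add: \<delta>_def power2_eq_square)
      finally show ?thesis .
    qed
    define S where "S = (\<Sum>z\<in>?B. defect (?f z))"
    have "S \<le> (\<Sum>z\<in>?B. saw \<delta> T (?f z) + 2 * \<delta>)"
      unfolding S_def by (intro sum_mono defect_le_saw delta fT)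
    also have "\<dots> = (\<Sum>z\<in>?B. saw \<delta> T (?f z)) + real (card ?B) * (2 * \<delta>)" by (simp add: sum.distrib)
    finally have up: "S \<le> 2 * (K2 * P * \<tau> * harm Z ^ 3) + 5 * P" using saw[of g0] card by simp
    have "(\<Sum>z\<in>?B. saw \<delta> T (?f z - \<delta>) - 2 * \<delta>) \<le> S"
      unfolding S_def using saw_le_defect[OF delta fT] by (intro sum_mono) (simp add: diff_le_eq)
    moreover have "(\<Sum>z\<in>?B. saw \<delta> T (?f z - \<delta>) - 2 * \<delta>)
        = (\<Sum>z\<in>?B. saw \<delta> T (quad2 D B E \<mu> (g0 - \<delta>) g1 g2 (fst z) (snd z))) - real (card ?B) * (2 * \<delta>)"
      by (simp add: sum_subtractf quad2_def algebra_simps)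
    ultimately have lo: "- (2 * (K2 * P * \<tau> * harm Z ^ 3) + 5 * P) \<le> S"
      using saw[of "g0 - \<delta>"] card delta by simp
    have "harm Z ^ 3 \<le> ((1 + 1 / \<eta>) * real Z powr \<eta>) ^ 3"
      using harm_le_powr[OF \<eta> Z1] harm_nonneg[of Z, where ?'a = real] by (intro power_mono) auto
    hence "\<tau> * harm Z ^ 3 \<le> \<tau> * ((1 + 1 / \<eta>) * real Z powr \<eta>) ^ 3" using \<tau>1 by (intro mult_left_mono) auto
    also have "\<dots> = K3 * P powr \<epsilon>"
    proof -
      have pw: "(P ^ n) powr e = P powr (real n * e)" for n e
        using P_pos by (simp only: powr_realpow[symmetric] powr_powr)
      have e1: "(real a * P ^ 8) powr (\<epsilon> / 16) = real a powr (\<epsilon> / 16) * P powr (\<epsilon> / 2)"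
        using pw[of 8 "\<epsilon> / 16"] P_pos by (simp add: powr_mult)
      have e2: "real Z powr \<eta> = real a powr \<eta> * P powr (\<epsilon> / 6)"
        using pw[of 7 \<eta>] P_pos by (simp add: Z powr_mult) (simp add: \<eta>_def)
      have "(P powr (\<epsilon> / 6)) ^ 3 = P powr (\<epsilon> / 2)"
      proof -
        have "(P powr (\<epsilon> / 6)) ^ 3 = (P powr (\<epsilon> / 6)) powr real 3"
          using P_pos by (intro powr_realpow[symmetric]) simp
        thus ?thesis by (simp only: powr_powr) simp
      qed
      moreover have "P powr (\<epsilon> / 2) * P powr (\<epsilon> / 2) = P powr \<epsilon>" by (simp flip: powr_add)
      ultimately show ?thesis
        by (simp add: \<tau>_def K3_def e1 e2 power_mult_distrib mult_ac)
    qed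
    finally have "K2 * P * (\<tau> * harm Z ^ 3) \<le> K2 * P * (K3 * P powr \<epsilon>)"
      using K2 P_pos by (intro mult_left_mono) auto
    moreover have "P \<le> P * P powr \<epsilon>"
      using ge_one_powr_ge_zero[OF P1, of \<epsilon>] \<epsilon> P_pos mult_left_mono[of 1 "P powr \<epsilon>" P] by simp
    moreover have "P powr (1 + \<epsilon>) = P * P powr \<epsilon>" using P_pos by (simp add: powr_add)
    ultimately have "2 * (K2 * P * \<tau> * harm Z ^ 3) + 5 * P \<le> (2 * K2 * K3 + 5) * P powr (1 + \<epsilon>)"
      by (simp add: algebra_simps)
    hence "\<bar>S\<bar> \<le> (2 * K2 * K3 + 5) * P powr (1 + \<epsilon>)" using up lo by linarith
    thus "\<bar>\<Sum>z1\<in>{- int N..int N}. \<Sum>z2\<in>{- int N..int N}. defect (quad2 D B E \<mu> g0 g1 g2 z1 z2)\<bar>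
        \<le> (2 * K2 * K3 + 5) * (4 * real T) powr (1 + \<epsilon>)"
      by (simp add: S_def PT sum.cartesian_product case_prod_unfold)
  qed
qed

section \<open>Sums of the cap height over lattice translates\<close>

definition ivec :: "('n::finite \<Rightarrow> int) \<Rightarrow> real ^ 'n"
  where "ivec n = (\<chi> i. of_int (n i))"

lemma ivec_nth [simp]: "ivec n $ i = of_int (n i)"
  by (simp add: ivec_def)

definition ibox :: "nat \<Rightarrow> ('n::finite \<Rightarrow> int) set"
  where "ibox N = {n. \<forall>i. n i \<in> {- int N..int N}}"

lemma ibox_eq_PiE: "ibox N = PiE UNIV (\<lambda>_. {- int N..int N})"
  unfolding PiE_UNIV_domain by (auto simp: ibox_def)

lemma finite_ibox [simp]: "finite (ibox N :: ('n::finite \<Rightarrow> int) set)"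
  unfolding ibox_eq_PiE by (intro finite_PiE) auto

lemma card_ibox_slice:
  "card {n \<in> ibox N. \<forall>i\<in>K. n i = 0} = (2 * N + 1) ^ (CARD('n) - card (K :: 'n::finite set))"
proof -
  have "{n \<in> ibox N. \<forall>i\<in>K. n i = 0} = PiE UNIV (\<lambda>i. if i \<in> K then {0} else {- int N..int N})"
  proof (intro set_eqI iffI)
    fix n assume "n \<in> {n \<in> ibox N. \<forall>i\<in>K. n i = 0}"
    hence "n i \<in> (if i \<in> K then {0} else {- int N..int N})" for i
      by (cases "i \<in> K") (simp_all add: ibox_def)
    thus "n \<in> PiE UNIV (\<lambda>i. if i \<in> K then {0} else {- int N..int N})"
      unfolding PiE_UNIV_domain by blast
  next
    fix n assume "n \<in> PiE UNIV (\<lambda>i. if i \<in> K then {0} else {- int N..int N})"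
    hence n: "n i \<in> (if i \<in> K then {0} else {- int N..int N})" for i by blast
    have "n i = 0" if "i \<in> K" for i using n[of i] that by simp
    moreover have "n i \<in> {- int N..int N}" for i using n[of i] by (cases "i \<in> K") simp_all
    ultimately show "n \<in> {n \<in> ibox N. \<forall>i\<in>K. n i = 0}" by (simp add: ibox_def)
  qed
  hence "card {n \<in> ibox N. \<forall>i\<in>K. n i = 0} = (\<Prod>i\<in>UNIV. if i \<in> K then 1 else 2 * N + 1)"
    by (simp add: card_PiE if_distrib cong: if_cong) (intro prod.cong refl, auto)
  also have "\<dots> = (2 * N + 1) ^ card (- K)"
    by (simp add: prod.If_cases)
  finally show ?thesis by (simp add: Compl_eq_Diff_UNIV card_Diff_subset)
qed

section \<open>The bilinear form, and the height function with its lattice sums\<close>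

definition bil :: "real ^ 'n ^ 'n \<Rightarrow> real ^ 'n \<Rightarrow> real ^ 'n \<Rightarrow> real"
  where "bil A x y = (\<Sum>i\<in>UNIV. \<Sum>j\<in>UNIV. A $ i $ j * x $ i * y $ j)"

lemma quad_form_bil: "quad_form A x = bil A x x"
  by (simp add: quad_form_def bil_def)

lemma bil_add_left: "bil A (x + y) z = bil A x z + bil A y z"
  and bil_add_right: "bil A z (x + y) = bil A z x + bil A z y"
  and bil_scale_left: "bil A (c *\<^sub>R x) z = c * bil A x z"
  and bil_scale_right: "bil A z (c *\<^sub>R x) = c * bil A z x"
  by (simp_all add: bil_def algebra_simps sum.distrib sum_distrib_left)

lemma bil_sym: "transpose A = A \<Longrightarrow> bil A x y = bil A y x"
proof -
  assume "transpose A = A"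
  hence "transpose A $ j $ i = A $ j $ i" for i j by (simp only:)
  hence s: "A $ i $ j = A $ j $ i" for i j by (simp add: transpose_def)
  show ?thesis unfolding bil_def by (subst sum.swap) (simp add: s mult_ac)
qed

lemma bil_axis: "bil A (axis k 1) (axis l 1) = A $ k $ l"
  by (simp add: bil_def axis_def if_distrib[where f = "\<lambda>x. _ * x"] if_distrib[where f = "\<lambda>x. x * _"] cong: if_cong)

lemma quad_form_add: "transpose A = A \<Longrightarrow> quad_form A (x + y) = quad_form A x + 2 * bil A x y + quad_form A y"
  using bil_sym[of A x y] by (simp add: quad_form_bil bil_add_left bil_add_right)

lemma quad_form_scale: "quad_form A (c *\<^sub>R x) = c\<^sup>2 * quad_form A x"
  by (simp add: quad_form_bil bil_scale_left bil_scale_right power2_eq_square)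

lemma quad_form_zero [simp]: "quad_form A 0 = 0"
  by (simp add: quad_form_def)

definition abs_sum :: "real ^ 'n ^ 'n \<Rightarrow> real"
  where "abs_sum A = (\<Sum>i\<in>UNIV. \<Sum>j\<in>UNIV. \<bar>A $ i $ j\<bar>)"

lemma abs_sum_nonneg: "0 \<le> abs_sum A"
  unfolding abs_sum_def by (intro sum_nonneg) auto

lemma abs_bil_le:
  assumes "\<And>i. \<bar>x $ i\<bar> \<le> X" "\<And>i. \<bar>y $ i\<bar> \<le> Y"
  shows "\<bar>bil A x y\<bar> \<le> abs_sum A * (X * Y)"
proof -
  have "\<bar>bil A x y\<bar> \<le> (\<Sum>i\<in>UNIV. \<Sum>j\<in>UNIV. \<bar>A $ i $ j * x $ i * y $ j\<bar>)"
    unfolding bil_def by (intro order_trans[OF sum_abs] sum_mono order_refl)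
  also have "\<dots> \<le> (\<Sum>i\<in>UNIV. \<Sum>j\<in>UNIV. \<bar>A $ i $ j\<bar> * (X * Y))"
  proof (intro sum_mono)
    fix i j
    have "\<bar>x $ i\<bar> * \<bar>y $ j\<bar> \<le> X * Y"
      using assms(1)[of i] assms(2)[of j] by (intro mult_mono) auto
    thus "\<bar>A $ i $ j * x $ i * y $ j\<bar> \<le> \<bar>A $ i $ j\<bar> * (X * Y)"
      by (simp add: abs_mult mult.assoc mult_left_mono)
  qed
  also have "\<dots> = abs_sum A * (X * Y)"
    by (simp add: abs_sum_def sum_distrib_right)
  finally show ?thesis .
qed

lemma continuous_quad_form [continuous_intros]: "continuous_on S (quad_form A)"
  unfolding quad_form_def[abs_def] by (intro continuous_intros)

text \<open>\<kappa> is the minimum of the form on the compact unit sphere; homogeneity carries the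
  bound to all vectors, and a coordinate is at most the norm.\<close>

lemma pos_def_lower_bound:
  fixes A :: "real ^ 'n ^ 'n"
  assumes "pos_def_form A"
  obtains \<kappa> where "0 < \<kappa>" "\<And>x i. \<kappa> * (x $ i)\<^sup>2 \<le> quad_form A x"
proof -
  let ?S = "sphere (0::real ^ 'n) 1"
  have "axis undefined 1 \<in> ?S" by (simp add: norm_axis_1)
  hence "?S \<noteq> {}" by blast
  then obtain u where u: "u \<in> ?S" "\<And>x. x \<in> ?S \<Longrightarrow> quad_form A u \<le> quad_form A x"
    using continuous_attains_inf[OF compact_sphere _ continuous_quad_form[of ?S A]] by blast
  have "u \<noteq> 0" using u(1) by auto
  hence pos: "0 < quad_form A u" using assms by (simp add: pos_def_form_def)
  show ?thesis
  proof (rule that[OF pos])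
    fix x :: "real ^ 'n" and i
    show "quad_form A u * (x $ i)\<^sup>2 \<le> quad_form A x"
    proof (cases "x = 0")
      case False
      define y where "y = (1 / norm x) *\<^sub>R x"
      have "y \<in> ?S" using False by (simp add: y_def)
      hence "quad_form A u \<le> quad_form A y" by (rule u)
      have xy: "x = norm x *\<^sub>R y" using False by (simp add: y_def)
      have "(x $ i)\<^sup>2 \<le> (norm x)\<^sup>2" using component_le_norm_cart[of x i] by (intro abs_le_square_iff[THEN iffD1]) auto
      hence "quad_form A u * (x $ i)\<^sup>2 \<le> quad_form A u * (norm x)\<^sup>2" using pos by (intro mult_left_mono) auto
      also have "\<dots> \<le> quad_form A y * (norm x)\<^sup>2" using \<open>quad_form A u \<le> quad_form A y\<close> by (intro mult_right_mono) auto
      also have "\<dots> = quad_form A x" by (subst (2) xy) (simp only: quad_form_scale mult.commute)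
      finally show ?thesis .
    qed simp
  qed
qed

text \<open>The scaled body: with \<open>W = c * R\<close> the height at \<open>x\<close> is
  \<open>R\<close> times the height of the original body at \<open>x / R\<close>. The margin 4 in
  \<open>support\<close> keeps the cap inside the summation box when it is translated by coordinates
  up to 2 or by a unit step.\<close>

locale cap =
  fixes A :: "real ^ 'n ^ 'n" and W R :: real and N :: nat
  assumes sym: "transpose A = A" and psd: "\<And>x. 0 \<le> quad_form A x" and R_pos: "0 < R"
    and support: "\<And>x i. 0 \<le> W - quad_form A x / R \<Longrightarrow> \<bar>x $ i\<bar> \<le> real N - 4"
begin

definition ht :: "real ^ 'n \<Rightarrow> real"
  where "ht x = W - quad_form A x / R"

definition S :: "real ^ 'n \<Rightarrow> real"
  where "S t = (\<Sum>n\<in>ibox N. max 0 (ht (ivec n + t)))"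

text \<open>Bounds the change of the height under a unit step; \<open>2 * N + 7\<close> is
  \<open>2 * (N + 3)\<close> from the bilinear term plus 1 from the quadratic one. It is O(1) when
  \<open>N\<close> is of order \<open>R\<close>.\<close>

definition \<Lambda> :: real where "\<Lambda> = abs_sum A * (2 * real N + 7) / R"

lemma ht_outside: "real N - 4 < \<bar>x $ i\<bar> \<Longrightarrow> ht x < 0"
  using support[of x i] by (force simp: ht_def not_le[symmetric])

lemma ht_line:
  assumes "0 \<le> s" "s \<le> 1"
  shows "(1 - s) * ht x + s * ht (x + e) \<le> ht (x + s *\<^sub>R e)"
proof -
  have "ht (x + s *\<^sub>R e) - ((1 - s) * ht x + s * ht (x + e)) = s * (1 - s) * (quad_form A e / R)"
    using R_pos by (simp add: ht_def quad_form_add[OF sym] quad_form_scale bil_scale_right)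
      (simp add: field_simps power2_eq_square)
  also have "\<dots> \<ge> 0" using assms psd[of e] R_pos by simp
  finally show ?thesis by simp
qed

lemma ht_nonneg_between:
  assumes "0 \<le> ht x" "0 \<le> ht (x + e)" "0 \<le> s" "s \<le> 1"
  shows "0 \<le> ht (x + s *\<^sub>R e)"
proof -
  have "0 \<le> (1 - s) * ht x + s * ht (x + e)"
    using assms by (intro add_nonneg_nonneg mult_nonneg_nonneg) auto
  also have "\<dots> \<le> ht (x + s *\<^sub>R e)" using assms by (intro ht_line)
  finally show ?thesis .
qed

lemma ht_step:
  assumes "\<And>i. \<bar>x $ i\<bar> \<le> real N + 3"
  shows "\<bar>ht x - ht (x + axis k 1)\<bar> \<le> \<Lambda>"
proof -
  have a: "\<bar>axis k 1 $ i\<bar> \<le> (1::real)" for i by (simp add: axis_def)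
  have "ht x - ht (x + axis k 1) = (2 * bil A x (axis k 1) + quad_form A (axis k 1)) / R"
    using R_pos by (simp add: ht_def quad_form_add[OF sym] field_simps)
  hence "\<bar>ht x - ht (x + axis k 1)\<bar> = \<bar>2 * bil A x (axis k 1) + bil A (axis k 1) (axis k 1)\<bar> / R"
    using R_pos by (simp add: quad_form_bil)
  also have "\<dots> \<le> (2 * (abs_sum A * ((real N + 3) * 1)) + abs_sum A * (1 * 1)) / R"
    using abs_bil_le[OF assms a, of A] abs_bil_le[OF a a, of A] R_pos
    by (intro divide_right_mono) linarith+
  finally show ?thesis by (simp add: \<Lambda>_def algebra_simps)
qed

text \<open>By concavity the height is nonnegative on an interval of each line in direction
  \<open>k\<close>, so a line leaves the cap at most once and enters it at most once. Setting
  coordinate \<open>k\<close> to 0 labels the lines.\<close>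

lemma boundary_count:
  fixes k :: 'n
  shows "card {n \<in> ibox N. 0 \<le> ht (ivec n + t) \<and> ht (ivec n + t + axis k 1) < 0} \<le> (2 * N + 1) ^ (CARD('n) - 1)" (is "card ?B1 \<le> _")
    and "card {n \<in> ibox N. ht (ivec n + t) < 0 \<and> 0 \<le> ht (ivec n + t + axis k 1)} \<le> (2 * N + 1) ^ (CARD('n) - 1)" (is "card ?B2 \<le> _")
proof -
  let ?z = "\<lambda>n::'n \<Rightarrow> int. n(k := 0)"
  have line: "ivec n' = ivec n + of_int (n' k - n k) *\<^sub>R axis k 1" if "?z n = ?z n'" for n n'
  proof -
    have "n' i = n i" if "i \<noteq> k" for i using fun_cong[OF \<open>?z n = ?z n'\<close>, of i] that by simp
    thus ?thesis by (simp add: vec_eq_iff axis_def)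
  qed
  have im: "card (?z ` B) \<le> (2 * N + 1) ^ (CARD('n) - 1)" if "B \<subseteq> ibox N" for B
  proof -
    have "?z ` B \<subseteq> {n \<in> ibox N. \<forall>i\<in>{k}. n i = 0}" using that by (auto simp: ibox_def)
    hence "card (?z ` B) \<le> card {n \<in> ibox N. \<forall>i\<in>{k}. n i = 0}" by (intro card_mono) auto
    also have "\<dots> = (2 * N + 1) ^ (CARD('n) - 1)" by (subst card_ibox_slice) simp
    finally show ?thesis .
  qed
  have inj: "inj_on ?z B" if "\<And>n n'. n \<in> B \<Longrightarrow> n' \<in> B \<Longrightarrow> ?z n = ?z n' \<Longrightarrow> \<not> n k < n' k" for B
  proof (rule inj_onI)
    fix n n' assume *: "n \<in> B" "n' \<in> B" "?z n = ?z n'"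
    have "n k = n' k" using that[OF *(1,2,3)] that[OF *(2,1) *(3)[symmetric]] by linarith
    thus "n = n'" using *(3) by (metis fun_upd_triv fun_upd_upd)
  qed
  show "card ?B1 \<le> (2 * N + 1) ^ (CARD('n) - 1)"
  proof -
    have "inj_on ?z ?B1"
    proof (rule inj, rule notI)
      fix n n' assume n: "n \<in> ?B1" "n' \<in> ?B1" "?z n = ?z n'" "n k < n' k"
      define d where "d = real_of_int (n' k - n k)"
      have d: "1 \<le> d" using n(4) unfolding d_def by linarith
      have "ivec n' = ivec n + d *\<^sub>R axis k 1" using line[OF n(3)] by (simp add: d_def)
      hence "0 \<le> ht (ivec n + t + d *\<^sub>R axis k 1)" using n(2) by (simp add: add_ac)
      from ht_nonneg_between[OF _ this, of "1 / d"] have "0 \<le> ht (ivec n + t + axis k 1)" using n(1) d by simp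
      thus False using n(1) by simp
    qed
    thus ?thesis using im[of ?B1] by (simp add: card_image)
  qed
  show "card ?B2 \<le> (2 * N + 1) ^ (CARD('n) - 1)"
  proof -
    have "inj_on ?z ?B2"
    proof (rule inj, rule notI)
      fix n n' assume n: "n \<in> ?B2" "n' \<in> ?B2" "?z n = ?z n'" "n k < n' k"
      define d where "d = real_of_int (n' k - n k)"
      have d: "1 \<le> d" using n(4) unfolding d_def by linarith
      have e: "ivec n' = ivec n + d *\<^sub>R axis k 1" using line[OF n(3)] by (simp add: d_def)
      hence "0 \<le> ht (ivec n + t + axis k 1 + d *\<^sub>R axis k 1)" using n(2) by (simp add: add_ac)
      from ht_nonneg_between[OF _ this, of "(d - 1) / d"]
      have "0 \<le> ht (ivec n + t + axis k 1 + (d - 1) *\<^sub>R axis k 1)" using n(1) d by simp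
      also have "ivec n + t + axis k 1 + (d - 1) *\<^sub>R axis k 1 = ivec n' + t" unfolding e by (simp add: scaleR_left_diff_distrib)
      finally show False using n(2) by simp
    qed
    thus ?thesis using im[of ?B2] by (simp add: card_image)
  qed
qed

definition err :: real where "err = 2 * \<Lambda> * real ((2 * N + 1) ^ (CARD('n) - 1))"

lemma \<Lambda>_nonneg: "0 \<le> \<Lambda>"
  using abs_sum_nonneg[of A] R_pos by (simp add: \<Lambda>_def)

lemma err_nonneg: "0 \<le> err"
  using \<Lambda>_nonneg by (simp add: err_def)

text \<open>The step only relabels lattice points; the layers that enter or leave the box lie
  outside the cap by the margin in \<open>support\<close>.\<close>

lemma S_shift:
  assumes "\<And>i. 0 \<le> t $ i \<and> t $ i \<le> 2"
  shows "S (t + axis k 1) = S t"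
proof -
  have "S (t + axis k 1) = (\<Sum>n\<in>(\<lambda>n. n(k := n k + 1)) ` ibox N. max 0 (ht (ivec n + t)))"
  proof (subst sum.reindex)
    show "inj_on (\<lambda>n. n(k := n k + 1)) (ibox N)"
      by (rule inj_onI) (metis add_right_cancel fun_upd_same fun_upd_triv fun_upd_upd)
    have "ivec n + (t + axis k 1) = ivec (n(k := n k + 1)) + t" for n
      by (simp add: vec_eq_iff axis_def)
    thus "S (t + axis k 1) = (\<Sum>n\<in>ibox N. ((\<lambda>n. max 0 (ht (ivec n + t))) \<circ> (\<lambda>n. n(k := n k + 1))) n)"
      by (simp only: S_def o_def)
  qed
  also have "\<dots> = (\<Sum>n\<in>(\<lambda>n. n(k := n k + 1)) ` ibox N \<inter> ibox N. max 0 (ht (ivec n + t)))"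
  proof (rule sum.mono_neutral_right)
    show "\<forall>n\<in>(\<lambda>n. n(k := n k + 1)) ` ibox N - (\<lambda>n. n(k := n k + 1)) ` ibox N \<inter> ibox N. max 0 (ht (ivec n + t)) = 0"
    proof
      fix n assume "n \<in> (\<lambda>n. n(k := n k + 1)) ` ibox N - (\<lambda>n. n(k := n k + 1)) ` ibox N \<inter> ibox N"
      then obtain n' where n': "n' \<in> ibox N" "n = n'(k := n' k + 1)" "n \<notin> ibox N" by auto
      obtain i where i: "n i \<notin> {- int N..int N}" using n'(3) by (auto simp: ibox_def)
      have "i = k" using i n' by (auto simp: ibox_def split: if_splits)
      moreover have "n' k \<in> {- int N..int N}" "n k = n' k + 1" using n'(1,2) by (simp_all add: ibox_def)
      ultimately have "n k = int N + 1" using i by auto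
      hence "ht (ivec n + t) < 0" using assms[of k] by (intro ht_outside[of _ k]) simp
      thus "max 0 (ht (ivec n + t)) = 0" by simp
    qed
  qed auto
  also have "\<dots> = S t"
    unfolding S_def
  proof (rule sum.mono_neutral_left)
    show "\<forall>n\<in>ibox N - (\<lambda>n. n(k := n k + 1)) ` ibox N \<inter> ibox N. max 0 (ht (ivec n + t)) = 0"
    proof
      fix n assume n: "n \<in> ibox N - (\<lambda>n. n(k := n k + 1)) ` ibox N \<inter> ibox N"
      have "n = (n(k := n k - 1))(k := (n(k := n k - 1)) k + 1)" by auto
      hence "n(k := n k - 1) \<notin> ibox N" using n by blast
      then obtain i where i: "(n(k := n k - 1)) i \<notin> {- int N..int N}" by (auto simp: ibox_def)
      have "i = k" using i n by (auto simp: ibox_def split: if_splits)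
      moreover have "n k \<in> {- int N..int N}" using n by (auto simp: ibox_def)
      ultimately have "n k = - int N" using i by auto
      hence "ht (ivec n + t) < 0" using assms[of k] by (intro ht_outside[of _ k]) (simp, linarith)
      thus "max 0 (ht (ivec n + t)) = 0" by simp
    qed
  qed auto
  finally show ?thesis .
qed

text \<open>Concavity of the height along a lattice line compares the sum over \<open>n + s\<close> with the
  interpolation of two copies of the sum over \<open>n\<close>; only boundary points contribute an error.\<close>
lemma S_lower:
  assumes t: "\<And>i. 0 \<le> t $ i \<and> t $ i \<le> 2" and s: "0 \<le> s" "s \<le> 1"
  shows "S t - err \<le> S (t + s *\<^sub>R axis k 1)"
proof -
  let ?x = "\<lambda>n. ivec n + t" and ?e = "axis k 1 :: real ^ 'n"
  let ?B1 = "{n \<in> ibox N. 0 \<le> ht (?x n) \<and> ht (?x n + ?e) < 0}"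
  let ?B2 = "{n \<in> ibox N. ht (?x n) < 0 \<and> 0 \<le> ht (?x n + ?e)}"
  \<comment> \<open>Truncation at 0 breaks concavity only if exactly one endpoint has nonnegative
    height. That height is then at most the difference of the two, hence at most \<Lambda>.\<close>
  have pt: "(1 - s) * max 0 (ht (?x n)) + s * max 0 (ht (?x n + ?e)) - \<Lambda> * (of_bool (n \<in> ?B1) + of_bool (n \<in> ?B2))
      \<le> max 0 (ht (?x n + s *\<^sub>R ?e))" if n: "n \<in> ibox N" for n
  proof -
    have step: "\<bar>ht (?x n) - ht (?x n + ?e)\<bar> \<le> \<Lambda>"
    proof (rule ht_step)
      fix i
      have "n i \<in> {- int N..int N}" using n by (simp add: ibox_def)
      hence "\<bar>real_of_int (n i)\<bar> \<le> real N" by (auto simp: abs_le_iff)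
      thus "\<bar>?x n $ i\<bar> \<le> real N + 3" using t[of i] by simp linarith
    qed
    show ?thesis
    proof (cases "0 \<le> ht (?x n)"; cases "0 \<le> ht (?x n + ?e)")
      assume "0 \<le> ht (?x n)" "0 \<le> ht (?x n + ?e)"
      thus ?thesis using ht_line[OF s, of "?x n" ?e] by simp
    next
      assume *: "0 \<le> ht (?x n)" "\<not> 0 \<le> ht (?x n + ?e)"
      hence "n \<in> ?B1" "n \<notin> ?B2" using n by auto
      moreover have "(1 - s) * ht (?x n) \<le> ht (?x n)" using * s by (intro mult_left_le_one_le) auto
      ultimately show ?thesis using * step by (simp add: max_def)
    next
      assume *: "\<not> 0 \<le> ht (?x n)" "0 \<le> ht (?x n + ?e)"
      hence "n \<in> ?B2" "n \<notin> ?B1" using n by auto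
      moreover have "s * ht (?x n + ?e) \<le> ht (?x n + ?e)" using * s by (intro mult_left_le_one_le) auto
      ultimately show ?thesis using * step by (simp add: max_def)
    next
      assume *: "\<not> 0 \<le> ht (?x n)" "\<not> 0 \<le> ht (?x n + ?e)"
      thus ?thesis using \<Lambda>_nonneg by (simp add: max_def)
    qed
  qed
  have "S t = (1 - s) * S t + s * S (t + ?e)" unfolding S_shift[OF t] by (simp add: algebra_simps)
  also have "\<dots> = (\<Sum>n\<in>ibox N. (1 - s) * max 0 (ht (?x n)) + s * max 0 (ht (?x n + ?e)))"
    by (simp add: S_def sum.distrib sum_distrib_left add.assoc)
  finally have S: "S t = \<dots>" .
  have "(\<Sum>n\<in>ibox N. \<Lambda> * (of_bool (n \<in> ?B1) + of_bool (n \<in> ?B2))) = \<Lambda> * (real (card ?B1) + real (card ?B2))"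
  proof -
    have "(\<Sum>n\<in>ibox N. of_bool (n \<in> B)) = real (card B)" if "B \<subseteq> ibox N" for B
      using that by (simp add: sum_of_bool_eq Int_absorb1)
    from this[of ?B1] this[of ?B2]
    have "(\<Sum>n\<in>ibox N. of_bool (n \<in> ?B1)) = real (card ?B1)" "(\<Sum>n\<in>ibox N. of_bool (n \<in> ?B2)) = real (card ?B2)"
      by blast+
    thus ?thesis by (simp only: sum_distrib_left[symmetric] sum.distrib)
  qed
  also have "\<dots> \<le> err"
    unfolding err_def using boundary_count[of t k] \<Lambda>_nonneg
    by (simp only: mult_2 distrib_right distrib_left) (intro add_mono mult_left_mono, simp_all only: of_nat_le_iff)
  finally have "S t - err \<le> (\<Sum>n\<in>ibox N. (1 - s) * max 0 (ht (?x n)) + s * max 0 (ht (?x n + ?e)) - \<Lambda> * (of_bool (n \<in> ?B1) + of_bool (n \<in> ?B2)))"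
    unfolding S sum_subtractf by simp
  also have "\<dots> \<le> (\<Sum>n\<in>ibox N. max 0 (ht (?x n + s *\<^sub>R ?e)))" by (rule sum_mono[OF pt])
  finally show ?thesis by (simp add: S_def add.assoc)
qed

text \<open>Concavity yields lower bounds only. The upper bound for \<open>S t'\<close> is the lower
  bound for the rest of the step, from \<open>t'\<close> to \<open>t + axis k 1\<close>, where
  \<open>S\<close> has returned to \<open>S t\<close>.\<close>

lemma S_coordinate:
  assumes t: "\<And>i. 0 \<le> t $ i \<and> t $ i \<le> 1" and t': "\<And>i. 0 \<le> t' $ i \<and> t' $ i \<le> 1"
    and eq: "\<And>i. i \<noteq> k \<Longrightarrow> t' $ i = t $ i"
  shows "\<bar>S t' - S t\<bar> \<le> err"
proof -
  have *: "\<bar>S t' - S t\<bar> \<le> err"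
    if t: "\<And>i. 0 \<le> t $ i \<and> t $ i \<le> 1" and t': "\<And>i. 0 \<le> t' $ i \<and> t' $ i \<le> 1"
    and eq: "\<And>i. i \<noteq> k \<Longrightarrow> t' $ i = t $ i" and le: "t $ k \<le> t' $ k" for t t' :: "real ^ 'n"
  proof -
    define s where "s = t' $ k - t $ k"
    have s: "0 \<le> s" "s \<le> 1" using t[of k] t'[of k] le by (auto simp: s_def)
    have e1: "t' = t + s *\<^sub>R axis k 1" using eq by (simp add: vec_eq_iff axis_def s_def)
    have e2: "t + axis k 1 = t' + (1 - s) *\<^sub>R axis k 1" unfolding e1 by (simp add: algebra_simps)
    have b: "\<And>i. 0 \<le> t $ i \<and> t $ i \<le> 2" "\<And>i. 0 \<le> t' $ i \<and> t' $ i \<le> 2" using t t' by (meson one_le_numeral order_trans)+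
    have "S t - err \<le> S t'" unfolding e1 by (rule S_lower[OF b(1) s])
    moreover have "S t' - err \<le> S (t + axis k 1)" unfolding e2 using s by (intro S_lower b) auto
    ultimately show ?thesis using S_shift[OF b(1), of k] by linarith
  qed
  show ?thesis
  proof (cases "t $ k \<le> t' $ k")
    case True
    thus ?thesis using * t t' eq by blast
  next
    case False
    have "\<bar>S t - S t'\<bar> \<le> err" using False eq by (intro *[OF t' t]) auto
    thus ?thesis by linarith
  qed
qed

lemma S_almost_constant:
  assumes t: "\<And>i. 0 \<le> t $ i \<and> t $ i \<le> 1" and t': "\<And>i. 0 \<le> t' $ i \<and> t' $ i \<le> 1"
  shows "\<bar>S t' - S t\<bar> \<le> real CARD('n) * err"
proof -
  define mix where "mix F = (\<chi> i. if i \<in> F then t' $ i else t $ i)" for F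
  have "\<bar>S (mix F) - S t\<bar> \<le> real (card F) * err" if "finite F" for F
    using that
  proof (induction F)
    case empty
    have "mix {} = t" by (simp add: mix_def vec_eq_iff)
    thus ?case by simp
  next
    case (insert k F)
    have "\<bar>S (mix (insert k F)) - S (mix F)\<bar> \<le> err"
      using t t' by (intro S_coordinate[where k = k]) (auto simp: mix_def)
    thus ?case using insert by (simp add: algebra_simps)
  qed
  from this[of UNIV] have "\<bar>S (mix UNIV) - S t\<bar> \<le> real CARD('n) * err" by simp
  moreover have "mix UNIV = t'" by (simp add: mix_def vec_eq_iff)
  ultimately show ?thesis by simp
qed

end

section \<open>Volume and lattice points of the cap\<close>

lemma emeasure_unit_cube: "emeasure lborel {x :: real ^ 'n. \<forall>i. 0 \<le> x $ i \<and> x $ i < 1} = 1"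
  and unit_cube_borel [measurable]: "{x :: real ^ 'n. \<forall>i. 0 \<le> x $ i \<and> x $ i < 1} \<in> sets borel"
proof -
  let ?C = "{x :: real ^ 'n. \<forall>i. 0 \<le> x $ i \<and> x $ i < 1}" and ?u = "(\<chi> i. 1) :: real ^ 'n"
  have "?C = (\<Inter>i. {x. 0 \<le> x $ i} \<inter> {x. x $ i < 1})" by auto
  also have "\<dots> \<in> sets borel"
    by (intro sets.finite_INT sets.Int borel_closed borel_open closed_Collect_le open_Collect_less continuous_intros) auto
  finally show meas: "?C \<in> sets borel" .
  have u: "(?u - 0) \<bullet> b = 1" if "b \<in> Basis" for b
    using that by (auto simp: Basis_vec_def inner_axis)
  hence le: "0 \<bullet> b \<le> ?u \<bullet> b" if "b \<in> Basis" for b using that by simp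
  have one: "(\<Prod>b\<in>Basis. ennreal ((?u - 0) \<bullet> b)) = 1" using u by simp
  have "emeasure lborel (box 0 ?u) \<le> emeasure lborel ?C"
    using meas by (intro emeasure_mono) (auto simp: mem_box_cart less_imp_le)
  moreover have "emeasure lborel ?C \<le> emeasure lborel (cbox 0 ?u)"
    by (intro emeasure_mono) (auto simp: mem_box_cart less_imp_le)
  moreover have "emeasure lborel (box 0 ?u) = 1" "emeasure lborel (cbox 0 ?u) = 1"
    using le u by (simp_all add: emeasure_lborel_box emeasure_lborel_cbox)
  ultimately show "emeasure lborel ?C = 1" by simp
qed

context cap
begin

definition body :: "((real ^ 'n) \<times> real) set"
  where "body = {(x, y). \<bar>y\<bar> \<le> ht x}"

lemma continuous_ht: "continuous_on UNIV ht"
  unfolding ht_def[abs_def] using R_pos by (intro continuous_intros) auto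

lemma ht_borel [measurable]: "ht \<in> borel_measurable borel"
  by (rule borel_measurable_continuous_onI[OF continuous_ht])

lemma body_borel: "body \<in> sets borel"
proof -
  have "body = {z. \<bar>snd z\<bar> \<le> ht (fst z)}" by (auto simp: body_def)
  also have "closed \<dots>"
    by (intro closed_Collect_le continuous_intros continuous_on_compose2[OF continuous_ht]) auto
  hence "{z. \<bar>snd z\<bar> \<le> ht (fst z)} \<in> sets borel" by (rule borel_closed)
  finally show ?thesis .
qed

lemma emeasure_body: "emeasure lborel body = (\<integral>\<^sup>+x. ennreal (2 * max 0 (ht x)) \<partial>lborel)"
proof -
  have "emeasure lborel body = emeasure (lborel \<Otimes>\<^sub>M lborel) body" by (simp add: lborel_prod)
  also have "\<dots> = (\<integral>\<^sup>+x. emeasure lborel (Pair x -` body) \<partial>lborel)"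
    using body_borel by (intro lborel.emeasure_pair_measure_alt) (simp only: lborel_prod sets_lborel)
  also have "\<dots> = (\<integral>\<^sup>+x. ennreal (2 * max 0 (ht x)) \<partial>lborel)"
  proof (rule nn_integral_cong)
    fix x
    have "Pair x -` body = {- ht x..ht x}" by (auto simp: body_def)
    thus "emeasure lborel (Pair x -` body) = ennreal (2 * max 0 (ht x))"
      by (simp only: emeasure_lborel_Icc_eq) (auto simp: max_def)
  qed
  finally show ?thesis .
qed

text \<open>Half-open unit cubes at lattice points tile the space, and by \<open>support\<close>
  those indexed by \<open>ibox N\<close> cover the cap. Moving every piece back to one cube adds the
  heights up to \<open>S\<close>.\<close>

lemma emeasure_body_periodized:
  "emeasure lborel body = (\<integral>\<^sup>+x. indicator {x. \<forall>i. 0 \<le> x $ i \<and> x $ i < 1} x * ennreal (2 * S x) \<partial>lborel)"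
proof -
  let ?C = "{x :: real ^ 'n. \<forall>i. 0 \<le> x $ i \<and> x $ i < 1}"
  define h where "h x = ennreal (2 * max 0 (ht x))" for x
  have hm [measurable]: "h \<in> borel_measurable borel" unfolding h_def[abs_def] by measurable
  have cube: "h x = (\<Sum>n\<in>ibox N. indicator ?C (- ivec n + x) * h x)" for x
  proof (cases "0 \<le> ht x")
    case False
    thus ?thesis by (simp add: h_def)
  next
    case True
    define f where "f i = \<lfloor>x $ i\<rfloor>" for i
    have f: "f \<in> ibox N"
      unfolding ibox_def
    proof (clarify)
      fix i
      have "\<bar>x $ i\<bar> \<le> real N - 4" using support[of x i] True by (simp add: ht_def)
      thus "f i \<in> {- int N..int N}" unfolding f_def by (auto simp: le_floor_iff floor_le_iff abs_le_iff)
    qed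
    have "(\<Sum>n\<in>ibox N. indicator ?C (- ivec n + x) * h x) = (\<Sum>n\<in>{f}. indicator ?C (- ivec n + x) * h x)"
    proof (rule sum.mono_neutral_right)
      show "\<forall>n\<in>ibox N - {f}. indicator ?C (- ivec n + x) * h x = 0"
      proof
        fix n assume n: "n \<in> ibox N - {f}"
        have "\<not> (\<forall>i. 0 \<le> (- ivec n + x) $ i \<and> (- ivec n + x) $ i < 1)"
        proof
          assume a: "\<forall>i. 0 \<le> (- ivec n + x) $ i \<and> (- ivec n + x) $ i < 1"
          have "n i = f i" for i
            using a[rule_format, of i] unfolding f_def by (intro floor_unique[symmetric]) auto
          thus False using n by auto
        qed
        thus "indicator ?C (- ivec n + x) * h x = 0" by simp
      qed
    qed (use f in auto)
    also have "\<dots> = h x"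
    proof -
      have "0 \<le> (- ivec f + x) $ i \<and> (- ivec f + x) $ i < 1" for i unfolding f_def by simp linarith
      hence "- ivec f + x \<in> ?C" by blast
      thus ?thesis by simp
    qed
    finally show ?thesis ..
  qed
  have "emeasure lborel body = (\<integral>\<^sup>+x. (\<Sum>n\<in>ibox N. indicator ?C (- ivec n + x) * h x) \<partial>lborel)"
    unfolding emeasure_body h_def[symmetric] using cube by (intro nn_integral_cong)
  also have "\<dots> = (\<Sum>n\<in>ibox N. \<integral>\<^sup>+x. indicator ?C (- ivec n + x) * h x \<partial>lborel)"
    by (intro nn_integral_sum) measurable
  also have "\<dots> = (\<Sum>n\<in>ibox N. \<integral>\<^sup>+x. indicator ?C x * h (ivec n + x) \<partial>lborel)"
  proof (rule sum.cong[OF refl])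
    fix n :: "'n \<Rightarrow> int"
    have "(\<integral>\<^sup>+x. indicator ?C (- ivec n + x) * h x \<partial>lborel)
        = (\<integral>\<^sup>+x. indicator ?C (- ivec n + x) * h x \<partial>distr lborel borel ((+) (ivec n)))"
      by (simp only: lborel_distr_plus)
    also have "\<dots> = (\<integral>\<^sup>+x. indicator ?C (- ivec n + (ivec n + x)) * h (ivec n + x) \<partial>lborel)"
      by (rule nn_integral_distr) measurable
    finally show "(\<integral>\<^sup>+x. indicator ?C (- ivec n + x) * h x \<partial>lborel) = (\<integral>\<^sup>+x. indicator ?C x * h (ivec n + x) \<partial>lborel)"
      by simp
  qed
  also have "\<dots> = (\<integral>\<^sup>+x. (\<Sum>n\<in>ibox N. indicator ?C x * h (ivec n + x)) \<partial>lborel)"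
    by (intro nn_integral_sum[symmetric]) measurable
  also have "\<dots> = (\<integral>\<^sup>+x. indicator ?C x * ennreal (2 * S x) \<partial>lborel)"
  proof (rule nn_integral_cong)
    fix x
    have "(\<Sum>n\<in>ibox N. h (ivec n + x)) = ennreal (\<Sum>n\<in>ibox N. 2 * max 0 (ht (ivec n + x)))"
      unfolding h_def by (rule sum_ennreal) auto
    thus "(\<Sum>n\<in>ibox N. indicator ?C x * h (ivec n + x)) = indicator ?C x * ennreal (2 * S x)"
      by (simp add: S_def sum_distrib_left[symmetric])
  qed
  finally show ?thesis .
qed

lemma body_volume:
  assumes t: "\<And>i. 0 \<le> t $ i \<and> t $ i \<le> 1"
  shows "\<bar>measure lborel body - 2 * S t\<bar> \<le> 2 * real CARD('n) * err"
proof -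
  let ?C = "{x :: real ^ 'n. \<forall>i. 0 \<le> x $ i \<and> x $ i < 1}"
  let ?b = "real CARD('n) * err"
  have b0: "0 \<le> ?b" using err_nonneg by simp
  have S0: "0 \<le> S t" by (simp add: S_def sum_nonneg)
  have const: "(\<integral>\<^sup>+x. indicator ?C x * ennreal u \<partial>lborel) = ennreal u" for u
    using emeasure_unit_cube[where ?'n = 'n] by (subst mult.commute, subst nn_integral_cmult_indicator) auto
  have near: "\<bar>S x - S t\<bar> \<le> ?b" if "x \<in> ?C" for x
    using that t by (intro S_almost_constant) (auto simp: less_imp_le)
  have "emeasure lborel body \<le> (\<integral>\<^sup>+x. indicator ?C x * ennreal (2 * (S t + ?b)) \<partial>lborel)"
    unfolding emeasure_body_periodized
    by (intro nn_integral_mono) (auto simp: indicator_def intro!: ennreal_leI dest: near[unfolded mem_Collect_eq])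
  hence up: "emeasure lborel body \<le> ennreal (2 * (S t + ?b))" by (simp only: const)
  \<comment> \<open>The constant may be negative; \<open>ennreal\<close> then turns it into 0, and
    the comparison remains correct because the volume is nonnegative.\<close>
  have "(\<integral>\<^sup>+x. indicator ?C x * ennreal (2 * (S t - ?b)) \<partial>lborel) \<le> emeasure lborel body"
    unfolding emeasure_body_periodized
    by (intro nn_integral_mono) (auto simp: indicator_def intro!: ennreal_leI dest: near[unfolded mem_Collect_eq])
  hence lo: "ennreal (2 * (S t - ?b)) \<le> emeasure lborel body" by (simp only: const)
  have fin: "emeasure lborel body = ennreal (measure lborel body)"
    using up by (intro emeasure_eq_ennreal_measure) (auto simp: top_unique)
  have "measure lborel body \<le> 2 * (S t + ?b)"
    using up S0 b0 unfolding fin by (subst (asm) ennreal_le_iff) auto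
  moreover have "2 * (S t - ?b) \<le> measure lborel body"
    using lo unfolding fin by (subst (asm) ennreal_le_iff) auto
  ultimately show ?thesis by (simp add: abs_le_iff algebra_simps)
qed

end

section \<open>Passing between the original body and the scaled cap\<close>

lemma measure_parab_body:
  fixes A :: "real ^ 'n ^ 'n"
  assumes "cap A W R N" and W: "W = c * R"
  shows "measure lborel (parab_body A c \<beta>) * R ^ (CARD('n) + 1) = measure lborel (cap.body A W R)"
proof -
  interpret cap A W R N by (rule assms)
  have ht_eq: "ht x = c * R - quad_form A x / R" for x unfolding ht_def by (simp add: W)
  have body_iff: "(x, y) \<in> body \<longleftrightarrow> \<bar>y\<bar> \<le> c * R - quad_form A x / R" for x y
    by (simp only: body_def ht_eq mem_Collect_eq split)
  have eq: "parab_body A c \<beta> = (\<lambda>z. (1 / R) *\<^sub>R z + (- \<beta>, 0)) ` body"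
  proof (intro set_eqI iffI)
    fix z assume "z \<in> parab_body A c \<beta>"
    then obtain x y where z: "z = (x, y)" "\<bar>y\<bar> \<le> c - quad_form A (x + \<beta>)" by (auto simp: parab_body_def)
    have "R * \<bar>y\<bar> \<le> R * (c - quad_form A (x + \<beta>))" using z R_pos by (intro mult_left_mono) auto
    moreover have "quad_form A (R *\<^sub>R (x + \<beta>)) / R = R * quad_form A (x + \<beta>)"
      unfolding quad_form_scale using R_pos by (simp add: power2_eq_square)
    ultimately have "(R *\<^sub>R (x + \<beta>), R * y) \<in> body"
      unfolding body_iff using R_pos by (simp add: abs_mult algebra_simps)
    moreover have "z = (1 / R) *\<^sub>R (R *\<^sub>R (x + \<beta>), R * y) + (- \<beta>, 0)" using z R_pos by simp
    ultimately show "z \<in> (\<lambda>z. (1 / R) *\<^sub>R z + (- \<beta>, 0)) ` body" by blast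
  next
    fix z assume "z \<in> (\<lambda>z. (1 / R) *\<^sub>R z + (- \<beta>, 0)) ` body"
    then obtain x y where z: "(x, y) \<in> body" "z = (1 / R) *\<^sub>R (x, y) + (- \<beta>, 0)" by auto
    have "\<bar>y\<bar> \<le> c * R - quad_form A x / R" using z(1) by (simp add: body_iff)
    hence "\<bar>y\<bar> / R \<le> (c * R - quad_form A x / R) / R" using R_pos by (intro divide_right_mono) auto
    hence "\<bar>y / R\<bar> \<le> c - (1 / R)\<^sup>2 * quad_form A x"
      using R_pos by (simp add: field_simps power2_eq_square)
    thus "z \<in> parab_body A c \<beta>" unfolding z(2) using R_pos by (simp add: parab_body_def quad_form_scale)
  qed
  have "closed (parab_body A c \<beta>)"
  proof -
    have "parab_body A c \<beta> = {z. \<bar>snd z\<bar> \<le> c - quad_form A (fst z + \<beta>)}" by (auto simp: parab_body_def)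
    also have "closed \<dots>"
      by (intro closed_Collect_le continuous_intros continuous_on_compose2[OF continuous_quad_form[of UNIV A]]) auto
    finally show ?thesis .
  qed
  hence "measure lborel (parab_body A c \<beta>) = measure lebesgue (parab_body A c \<beta>)"
    by (simp add: borel_closed)
  also have "\<dots> = \<bar>1 / R\<bar> ^ DIM((real ^ 'n) \<times> real) * measure lebesgue body"
    unfolding eq by (rule measure_lebesgue_affine)
  also have "measure lebesgue body = measure lborel body" using body_borel by simp
  finally show ?thesis using R_pos by (simp add: power_one_over field_simps)
qed

lemma card_int_interval: "card {y::int. \<bar>of_int y\<bar> \<le> (u::real)} = (if 0 \<le> u then nat (2 * \<lfloor>u\<rfloor> + 1) else 0)"
proof (cases "0 \<le> u")
  case True
  have "{y::int. \<bar>of_int y\<bar> \<le> u} = {- \<lfloor>u\<rfloor>..\<lfloor>u\<rfloor>}" by (auto simp: abs_le_iff le_floor_iff) (simp add: minus_le_iff le_floor_iff)+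
  thus ?thesis using True by (simp add: algebra_simps)
next
  case False
  hence "{y::int. \<bar>of_int y\<bar> \<le> u} = {}" by auto
  thus ?thesis using False by simp
qed

text \<open>The integer part of \<open>R *\<^sub>R \<beta>\<close> merely relabels the lattice, so
  \<beta> enters through a translation in the unit cube; this makes all later bounds uniform in
  \<beta>. Each fibre over \<open>n\<close> is then counted as its length plus
  \<open>defect\<close>.\<close>

lemma lattice_count_eq:
  fixes A :: "real ^ 'n ^ 'n" and \<beta> :: "real ^ 'n"
  assumes "cap A W R N" and W: "W = c * R"
  defines "t \<equiv> (\<chi> i. frac (R * \<beta> $ i))"
  shows "real (lattice_count A c \<beta> R) = (\<Sum>n\<in>ibox N. defect (cap.ht A W R (ivec n + t))) + 2 * cap.S A W R N t"
proof -
  interpret cap A W R N by (rule assms)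
  have ht_eq: "ht x = c * R - quad_form A x / R" for x unfolding ht_def by (simp add: W)
  define f where "f i = \<lfloor>R * \<beta> $ i\<rfloor>" for i
  have Rb: "R *\<^sub>R \<beta> = ivec f + t" by (simp add: vec_eq_iff f_def t_def frac_def)
  have t: "0 \<le> t $ i" "t $ i < 1" for i by (simp_all add: t_def frac_lt_1)
  let ?L = "{n \<in> int_points. inverse R *\<^sub>R n \<in> parab_body A c \<beta>}"
  let ?Y = "\<lambda>n. {y::int. \<bar>of_int y\<bar> \<le> ht (ivec n + t)}"
  let ?g = "\<lambda>(n, y). (ivec (\<lambda>i. n i - f i), real_of_int y)"
  have body: "inverse R *\<^sub>R (x, y) \<in> parab_body A c \<beta> \<longleftrightarrow> \<bar>y\<bar> \<le> ht (x + R *\<^sub>R \<beta>)" for x y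
  proof -
    have "inverse R *\<^sub>R x + \<beta> = inverse R *\<^sub>R (x + R *\<^sub>R \<beta>)" using R_pos by (simp add: scaleR_add_right)
    hence "quad_form A (inverse R *\<^sub>R x + \<beta>) = (inverse R)\<^sup>2 * quad_form A (x + R *\<^sub>R \<beta>)" by (simp only: quad_form_scale)
    hence Q: "quad_form A (x + R *\<^sub>R \<beta>) / R = R * quad_form A (inverse R *\<^sub>R x + \<beta>)"
      using R_pos by (simp add: field_simps power2_eq_square)
    have "inverse R *\<^sub>R (x, y) \<in> parab_body A c \<beta> \<longleftrightarrow> \<bar>inverse R * y\<bar> \<le> c - quad_form A (inverse R *\<^sub>R x + \<beta>)"
      by (simp only: parab_body_def scaleR_Pair real_scaleR_def mem_Collect_eq split)
    also have "\<dots> \<longleftrightarrow> \<bar>y\<bar> \<le> ht (x + R *\<^sub>R \<beta>)"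
      unfolding ht_eq Q using R_pos by (simp add: abs_mult field_simps)
    finally show ?thesis .
  qed
  have "bij_betw ?g (Sigma (ibox N) ?Y) ?L"
  proof (rule bij_betwI')
    fix p p' :: "('n \<Rightarrow> int) \<times> int"
    show "?g p = ?g p' \<longleftrightarrow> p = p'" by (cases p; cases p') (auto simp: vec_eq_iff fun_eq_iff)
  next
    fix p assume "p \<in> Sigma (ibox N) ?Y"
    then obtain n y where p: "p = (n, y)" "\<bar>of_int y\<bar> \<le> ht (ivec n + t)" by auto
    have "ivec (\<lambda>i. n i - f i) + R *\<^sub>R \<beta> = ivec n + t" unfolding Rb by (simp add: vec_eq_iff)
    hence "inverse R *\<^sub>R (ivec (\<lambda>i. n i - f i), real_of_int y) \<in> parab_body A c \<beta>"
      using p(2) by (simp only: body)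
    thus "?g p \<in> ?L" unfolding p by (simp add: int_points_def)
  next
    fix q assume q: "q \<in> ?L"
    obtain x y where xy: "q = (x, y)" by (cases q)
    have ints: "x $ i \<in> \<int>" "y \<in> \<int>" for i using q by (simp_all add: xy int_points_def)
    have "inverse R *\<^sub>R (x, y) \<in> parab_body A c \<beta>" using q by (simp add: xy)
    hence le: "\<bar>y\<bar> \<le> ht (x + R *\<^sub>R \<beta>)" by (simp only: body)
    define n where "n i = \<lfloor>x $ i\<rfloor> + f i" for i
    have x: "x = ivec (\<lambda>i. n i - f i)" using ints(1) by (simp add: vec_eq_iff n_def)
    have y: "y = of_int \<lfloor>y\<rfloor>" using ints(2) by simp
    have xn: "x + R *\<^sub>R \<beta> = ivec n + t" unfolding Rb x by (simp add: vec_eq_iff)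
    have "n \<in> ibox N"
      unfolding ibox_def
    proof (clarify)
      fix i
      have "0 \<le> ht (ivec n + t)" using le unfolding xn by linarith
      hence "\<bar>(ivec n + t) $ i\<bar> \<le> real N - 4" using support[of "ivec n + t" i] by (simp only: ht_def)
      hence "\<bar>real_of_int (n i)\<bar> \<le> real N" using t[of i] by simp
      thus "n i \<in> {- int N..int N}" by (auto simp: abs_le_iff)
    qed
    moreover have "\<lfloor>y\<rfloor> \<in> ?Y n" using le y unfolding xn by simp
    moreover have "q = ?g (n, \<lfloor>y\<rfloor>)" using xy x y by simp
    ultimately show "\<exists>p\<in>Sigma (ibox N) ?Y. q = ?g p" by blast
  qed
  from bij_betw_same_card[OF this, symmetric]
  have "lattice_count A c \<beta> R = card (Sigma (ibox N) ?Y)"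
    unfolding lattice_count_def .
  also have "\<dots> = (\<Sum>n\<in>ibox N. card (?Y n))"
  proof (rule card_SigmaI)
    have "finite (?Y n)" for n
      by (rule finite_subset[of _ "{- \<lfloor>ht (ivec n + t)\<rfloor>..\<lfloor>ht (ivec n + t)\<rfloor>}"])
         (auto simp: abs_le_iff le_floor_iff minus_le_iff)
    thus "\<forall>n\<in>ibox N. finite (?Y n)" by blast
  qed simp
  finally have "real (lattice_count A c \<beta> R) = (\<Sum>n\<in>ibox N. real (card (?Y n)))" by simp
  also have "\<dots> = (\<Sum>n\<in>ibox N. defect (ht (ivec n + t)) + 2 * max 0 (ht (ivec n + t)))"
    by (intro sum.cong refl) (simp add: card_int_interval defect_def max_def)
  finally show ?thesis by (simp add: S_def sum.distrib sum_distrib_left)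
qed

section \<open>Reduction to planes\<close>

lemma sum_ibox_planes:
  fixes f :: "('n::finite \<Rightarrow> int) \<Rightarrow> real" and i1 i2 :: 'n
  assumes "i1 \<noteq> i2"
  shows "(\<Sum>n\<in>ibox N. f n)
    = (\<Sum>n\<in>{n \<in> ibox N. \<forall>i\<in>{i1, i2}. n i = 0}. \<Sum>z1\<in>{- int N..int N}. \<Sum>z2\<in>{- int N..int N}. f (n(i1 := z1, i2 := z2)))"
proof -
  let ?I = "{- int N..int N}" and ?Z = "{n \<in> ibox N. \<forall>i\<in>{i1, i2}. n i = 0}"
  have "(\<Sum>n\<in>ibox N. f n) = (\<Sum>(n, z1, z2)\<in>?Z \<times> ?I \<times> ?I. f (n(i1 := z1, i2 := z2)))"
  proof (rule sum.reindex_bij_witness[of _ "\<lambda>(n, z1, z2). n(i1 := z1, i2 := z2)" "\<lambda>n. (n(i1 := 0, i2 := 0), n i1, n i2)"])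
    fix n :: "'n \<Rightarrow> int" assume "n \<in> ibox N"
    thus "(n(i1 := 0, i2 := 0), n i1, n i2) \<in> ?Z \<times> ?I \<times> ?I" using assms by (auto simp: ibox_def)
    show "(case (n(i1 := 0, i2 := 0), n i1, n i2) of (n, z1, z2) \<Rightarrow> n(i1 := z1, i2 := z2)) = n"
      by (auto simp: fun_eq_iff)
    thus "(case (n(i1 := 0, i2 := 0), n i1, n i2) of (n, z1, z2) \<Rightarrow> f (n(i1 := z1, i2 := z2))) = f n" by simp
  next
    fix p assume "p \<in> ?Z \<times> ?I \<times> ?I"
    then obtain n z1 z2 where p: "p = (n, z1, z2)" "n \<in> ?Z" "z1 \<in> ?I" "z2 \<in> ?I" by (cases p) auto
    have "n(i1 := 0, i2 := 0) = n" using p(2) by (auto simp: fun_eq_iff)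
    hence "n(i1 := z1, i2 := z2, i1 := 0, i2 := 0) = n" using assms by (auto simp: fun_eq_iff)
    thus "((case p of (n, z1, z2) \<Rightarrow> n(i1 := z1, i2 := z2))(i1 := 0, i2 := 0),
        (case p of (n, z1, z2) \<Rightarrow> n(i1 := z1, i2 := z2)) i1, (case p of (n, z1, z2) \<Rightarrow> n(i1 := z1, i2 := z2)) i2) = p"
      using assms by (simp add: p(1))
    show "(case p of (n, z1, z2) \<Rightarrow> n(i1 := z1, i2 := z2)) \<in> ibox N"
      using p by (simp add: ibox_def)
  qed
  thus ?thesis by (simp add: sum.cartesian_product case_prod_unfold)
qed

lemma pos_def_minor:
  fixes A :: "real ^ 'n ^ 'n"
  assumes "pos_def_form A" "transpose A = A" "i1 \<noteq> i2"
  shows "0 < A $ i1 $ i1" "0 < A $ i1 $ i1 * A $ i2 $ i2 - (A $ i1 $ i2)\<^sup>2"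
proof -
  have ax: "axis i1 1 \<noteq> (0 :: real ^ 'n)" by (simp add: axis_eq_0_iff)
  have "quad_form A (axis i1 1) = A $ i1 $ i1" by (simp add: quad_form_bil bil_axis)
  thus a: "0 < A $ i1 $ i1" using assms(1) ax by (metis pos_def_form_def)
  \<comment> \<open>Chosen so that the form at \<open>v\<close> is the leading entry times the 2 by
    2 minor.\<close>
  define v where "v = (A $ i1 $ i2) *\<^sub>R axis i1 1 + (- (A $ i1 $ i1)) *\<^sub>R (axis i2 1 :: real ^ 'n)"
  have "v $ i2 \<noteq> 0" using a assms(3) by (simp add: v_def axis_def)
  hence "v \<noteq> 0" by auto
  hence "0 < quad_form A v" using assms(1) by (simp add: pos_def_form_def)
  also have "quad_form A v = A $ i1 $ i1 * (A $ i1 $ i1 * A $ i2 $ i2 - (A $ i1 $ i2)\<^sup>2)"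
    unfolding v_def quad_form_add[OF assms(2)]
    by (simp only: quad_form_bil bil_scale_left bil_scale_right bil_axis) (simp add: power2_eq_square algebra_simps)
  finally show "0 < A $ i1 $ i1 * A $ i2 $ i2 - (A $ i1 $ i2)\<^sup>2" using a by (simp add: zero_less_mult_iff)
qed

text \<open>Dividing the leading entry by the product of the two denominators gives a common unit
  \<open>a\<close> for all three entries. Nondegeneracy of the integer block is inherited from the
  positive minor.\<close>

lemma rational_block:
  fixes A :: "real ^ 'n ^ 'n"
  assumes "pos_def_form A" "transpose A = A" "i1 \<noteq> i2"
    and "A $ i1 $ i2 / A $ i1 $ i1 \<in> \<rat>" "A $ i2 $ i2 / A $ i1 $ i1 \<in> \<rat>"
  obtains a :: real and D B E :: int where "0 < a" "A $ i1 $ i1 = a * of_int D" "A $ i1 $ i2 = a * of_int B"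
    "A $ i2 $ i2 = a * of_int E" "D * E \<noteq> B\<^sup>2"
proof -
  note pos = pos_def_minor[OF assms(1-3)]
  obtain p1 q1 where 1: "0 < q1" "A $ i1 $ i2 / A $ i1 $ i1 = of_int p1 / of_int q1"
    using assms(4) by (elim Rats_cases') auto
  obtain p2 q2 where 2: "0 < q2" "A $ i2 $ i2 / A $ i1 $ i1 = of_int p2 / of_int q2"
    using assms(5) by (elim Rats_cases') auto
  define a where "a = A $ i1 $ i1 / (of_int q1 * of_int q2)"
  have a: "0 < a" using pos(1) 1(1) 2(1) by (simp add: a_def)
  have e: "A $ i1 $ i1 = a * of_int (q1 * q2)" "A $ i1 $ i2 = a * of_int (p1 * q2)" "A $ i2 $ i2 = a * of_int (p2 * q1)"
    using 1 2 pos(1) by (simp_all add: a_def field_simps)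
  have "(q1 * q2) * (p2 * q1) \<noteq> (p1 * q2)\<^sup>2"
  proof
    assume eq: "(q1 * q2) * (p2 * q1) = (p1 * q2)\<^sup>2"
    have "A $ i1 $ i1 * A $ i2 $ i2 - (A $ i1 $ i2)\<^sup>2 = a\<^sup>2 * of_int ((q1 * q2) * (p2 * q1) - (p1 * q2)\<^sup>2)"
      unfolding e by (simp add: power2_eq_square algebra_simps)
    thus False using pos(2) eq by simp
  qed
  thus ?thesis using that[of a "q1 * q2" "p1 * q2" "p2 * q1"] a e by blast
qed

lemma (in cap) ht_plane:
  assumes "A $ i1 $ i1 = a * of_int D" "A $ i1 $ i2 = a * of_int B" "A $ i2 $ i2 = a * of_int E" "i1 \<noteq> i2"
    and n: "\<forall>i\<in>{i1, i2}. n i = 0"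
  obtains g0 g1 g2 where "\<And>z1 z2. ht (ivec (n(i1 := z1, i2 := z2)) + t) = quad2 D B E (2 * a / R) g0 g1 g2 z1 z2"
proof (rule that)
  fix z1 z2 :: int
  define x where "x = ivec n + t"
  let ?e1 = "axis i1 1 :: real ^ 'n" and ?e2 = "axis i2 1 :: real ^ 'n"
  have "ivec (n(i1 := z1, i2 := z2)) + t = x + (of_int z1 *\<^sub>R ?e1 + of_int z2 *\<^sub>R ?e2)"
    using n assms(4) by (simp add: vec_eq_iff x_def axis_def)
  hence "quad_form A (ivec (n(i1 := z1, i2 := z2)) + t)
      = quad_form A x + 2 * (of_int z1 * bil A x ?e1 + of_int z2 * bil A x ?e2)
        + ((of_int z1)\<^sup>2 * A $ i1 $ i1 + 2 * (of_int z1 * of_int z2 * A $ i1 $ i2) + (of_int z2)\<^sup>2 * A $ i2 $ i2)"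
    by (simp only: quad_form_add[OF sym] quad_form_scale bil_add_right bil_scale_left bil_scale_right)
      (simp add: quad_form_bil bil_axis algebra_simps)
  hence "quad_form A (ivec (n(i1 := z1, i2 := z2)) + t)
      = quad_form A x + 2 * (of_int z1 * bil A x ?e1 + of_int z2 * bil A x ?e2)
        + a * of_int (D * z1\<^sup>2 + 2 * B * z1 * z2 + E * z2\<^sup>2)"
    unfolding assms(1-3) by (simp add: algebra_simps)
  thus "ht (ivec (n(i1 := z1, i2 := z2)) + t)
      = quad2 D B E (2 * a / R) (W - quad_form A x / R) (- 2 * bil A x ?e1 / R) (- 2 * bil A x ?e2 / R) z1 z2"
    unfolding ht_def quad2_def using R_pos by (simp only:) (simp add: field_simps)
qed

theorem theorem3:
  fixes A :: "real ^ 'n ^ 'n" and i1 i2 :: 'n and d :: nat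
  assumes "d \<ge> 3" and "CARD('n) = d - 1"
    and "i1 \<noteq> i2"
    and "transpose A = A" and "pos_def_form A"
    and "A $ i1 $ i2 / A $ i1 $ i1 \<in> \<rat>"
    and "A $ i2 $ i2 / A $ i1 $ i1 \<in> \<rat>"
  shows "\<forall>C>0. \<forall>\<epsilon>>0::real. \<exists>K::real. \<forall>c R. \<forall>\<beta> :: real ^ 'n. 0 < c \<and> c \<le> C \<and> R > 1 \<longrightarrow>
    \<bar>real (lattice_count A c \<beta> R) - measure lborel (parab_body A c \<beta>) * R ^ d\<bar>
      \<le> K * R powr (real d - 2 + \<epsilon>)"
proof (intro allI impI)
  fix C \<epsilon> :: real
  assume C: "0 < C" and \<epsilon>: "0 < \<epsilon>"
  define m where "m = CARD('n)"
  have m: "2 \<le> m" "d = m + 1" using assms(1,2) by (auto simp: m_def)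
  obtain \<kappa> where \<kappa>: "0 < \<kappa>" "\<And>x i. \<kappa> * (x $ i)\<^sup>2 \<le> quad_form A x"
    using pos_def_lower_bound[OF assms(5)] by blast
  obtain a D B E where block: "0 < a" "A $ i1 $ i1 = a * of_int D" "A $ i1 $ i2 = a * of_int B"
    "A $ i2 $ i2 = a * of_int E" "D * E \<noteq> B\<^sup>2"
    using rational_block[OF assms(5,4,3,6,7)] by blast
  \<comment> \<open>Constants independent of \<open>c\<close>, \<open>R\<close> and \<beta>: the cap
    has coordinates at most \<open>c4 * R\<close>, the summation box stays within
    \<open>c5 * R\<close>, heights over it are at most \<open>c6 * R\<close>, and the period
    \<open>4 * T\<close> is at most \<open>c7 * R\<close>. The summand \<open>c5\<close> in
    \<open>c6\<close> makes the period exceed the side of the box.\<close>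
  define c4 where "c4 = sqrt (C / \<kappa>)"
  define c5 where "c5 = c4 + 10"
  define c6 where "c6 = C + abs_sum A * c5\<^sup>2 + c5"
  define c7 where "c7 = 4 * (c6 + 3)"
  \<comment> \<open>With \<open>\<mu> = 2 * a / R\<close> the product of \<mu> and the period is
    \<open>8 * a * T / R\<close>, which lies between \<open>8 * a * c6\<close> and
    \<open>8 * a * (c6 + 3) = 2 * a * c7\<close>.\<close>
  define C1 where "C1 = max 1 (max (2 * a * c7) (1 / (8 * a * c6)))"
  have c4: "0 \<le> c4" using C \<kappa>(1) by (simp add: c4_def)
  have c5: "9 \<le> c5" using c4 by (simp add: c5_def)
  have c6: "9 \<le> c6" using c5 C abs_sum_nonneg[of A] by (simp add: c6_def add_increasing)
  have c7: "0 \<le> c7" using c6 by (simp add: c7_def)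
  obtain K where K: "0 \<le> K"
    "\<And>(T::nat) (N::nat) \<mu> g0 g1 g2. 2 \<le> T \<Longrightarrow> 2 * real N + 1 \<le> 4 * real T \<Longrightarrow>
      1 / C1 \<le> \<mu> * (4 * real T) \<Longrightarrow> \<mu> * (4 * real T) \<le> C1 \<Longrightarrow>
      (\<And>z1 z2. z1 \<in> {- int N..int N} \<Longrightarrow> z2 \<in> {- int N..int N} \<Longrightarrow> \<bar>quad2 D B E \<mu> g0 g1 g2 z1 z2\<bar> \<le> real T - 2) \<Longrightarrow>
      \<bar>\<Sum>z1\<in>{- int N..int N}. \<Sum>z2\<in>{- int N..int N}. defect (quad2 D B E \<mu> g0 g1 g2 z1 z2)\<bar> \<le> K * (4 * real T) powr (1 + \<epsilon>)"
    using defect_sum_quad2[OF block(5) \<epsilon>, of C1] by (auto simp: C1_def)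
  \<comment> \<open>\<open>K1\<close> bounds the difference between volume and translated lattice
    sum; \<open>K2\<close> is the number of planes, O(\<open>R ^ (m - 2)\<close>), times the bound
    on each plane.\<close>
  define K1 where "K1 = 2 * real m * (2 * (abs_sum A * (2 * c5)) * (2 * c5) ^ (m - 1))"
  define K2 where "K2 = (2 * c5) ^ (m - 2) * (K * c7 powr (1 + \<epsilon>))"
  show "\<exists>K::real. \<forall>c R. \<forall>\<beta> :: real ^ 'n. 0 < c \<and> c \<le> C \<and> R > 1 \<longrightarrow>
    \<bar>real (lattice_count A c \<beta> R) - measure lborel (parab_body A c \<beta>) * R ^ d\<bar> \<le> K * R powr (real d - 2 + \<epsilon>)"
  proof (intro exI[of _ "K1 + K2"] allI impI, elim conjE)
    fix c R :: real and \<beta> :: "real ^ 'n"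
    assume c: "0 < c" "c \<le> C" and R: "1 < R"
    define N where "N = nat \<lceil>c4 * R\<rceil> + 5"
    define W where "W = c * R"
    have N: "c4 * R + 5 \<le> real N" "real N \<le> c4 * R + 6"
      using c4 R unfolding N_def by (auto simp: ceiling_le_iff of_nat_nat) linarith+
    have N5: "real N + 4 \<le> c5 * R" using N(2) R by (simp add: c5_def distrib_right)
    interpret cap A W R N
    proof
      show "transpose A = A" by (rule assms)
      show "0 < R" using R by simp
      show "0 \<le> quad_form A x" for x
        using assms(5) by (cases "x = 0") (auto simp: pos_def_form_def less_imp_le)
      fix x i assume "0 \<le> W - quad_form A x / R"
      hence "quad_form A x \<le> c * R * R" using R by (simp add: W_def field_simps)
      also have "\<dots> \<le> C * R * R" using c R by (intro mult_right_mono) auto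
      finally have "\<kappa> * (x $ i)\<^sup>2 \<le> C * R * R" using \<kappa>(2)[of x i] by linarith
      hence "(x $ i)\<^sup>2 \<le> C / \<kappa> * R\<^sup>2" using \<kappa>(1) by (simp add: field_simps power2_eq_square)
      also have "\<dots> = (c4 * R)\<^sup>2" using C \<kappa>(1) by (simp add: c4_def power_mult_distrib)
      finally have "\<bar>x $ i\<bar> \<le> c4 * R" using c4 R by (simp add: abs_le_square_iff[symmetric])
      thus "\<bar>x $ i\<bar> \<le> real N - 4" using N(1) by linarith
    qed
    have cap: "cap A W R N" by unfold_locales
    define t where "t = (\<chi> i. frac (R * \<beta> $ i))"
    have t: "0 \<le> t $ i \<and> t $ i \<le> 1" for i by (simp add: t_def less_imp_le[OF frac_lt_1])
    have count: "real (lattice_count A c \<beta> R) = (\<Sum>n\<in>ibox N. defect (ht (ivec n + t))) + 2 * S t"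
      unfolding t_def by (rule lattice_count_eq[OF cap W_def])
    have vol: "measure lborel (parab_body A c \<beta>) * R ^ d = measure lborel body"
      using measure_parab_body[OF cap W_def, of \<beta>] m(2) by (simp add: m_def)
    have pow: "real (2 * N + 1) ^ k \<le> (2 * c5) ^ k * R ^ k" for k
    proof -
      have "real (2 * N + 1) \<le> 2 * c5 * R" using N5 by simp
      hence "real (2 * N + 1) ^ k \<le> (2 * c5 * R) ^ k" by (intro power_mono) auto
      thus ?thesis by (simp add: power_mult_distrib)
    qed
    have Rd: "R powr (real d - 2 + \<epsilon>) = R ^ (m - 1) * R powr \<epsilon>"
      using m R by (simp add: powr_add[symmetric] of_nat_diff flip: powr_realpow)
    have Re: "1 \<le> R powr \<epsilon>" using R \<epsilon> by (simp add: ge_one_powr_ge_zero)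
    have "\<Lambda> \<le> abs_sum A * (2 * c5)"
    proof -
      have "abs_sum A * (2 * real N + 7) \<le> abs_sum A * (2 * (c5 * R))"
        using N5 abs_sum_nonneg[of A] by (intro mult_left_mono) auto
      hence "\<Lambda> \<le> abs_sum A * (2 * (c5 * R)) / R" unfolding \<Lambda>_def using R by (intro divide_right_mono) auto
      thus ?thesis using R by simp
    qed
    hence prod: "\<Lambda> * real (2 * N + 1) ^ (m - 1) \<le> (abs_sum A * (2 * c5)) * ((2 * c5) ^ (m - 1) * R ^ (m - 1))"
      using abs_sum_nonneg[of A] c5 by (intro mult_mono pow) simp_all
    have "2 * real m * (2 * (\<Lambda> * real (2 * N + 1) ^ (m - 1)))
        \<le> 2 * real m * (2 * ((abs_sum A * (2 * c5)) * ((2 * c5) ^ (m - 1) * R ^ (m - 1))))"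
      by (intro mult_left_mono prod) simp_all
    hence "2 * real CARD('n) * err \<le> K1 * R ^ (m - 1)"
      unfolding err_def K1_def by (simp add: m_def mult_ac)
    moreover have "\<bar>measure lborel body - 2 * S t\<bar> \<le> 2 * real CARD('n) * err"
      by (rule body_volume[OF t])
    ultimately have main: "\<bar>2 * S t - measure lborel body\<bar> \<le> K1 * R ^ (m - 1)" by linarith
    \<comment> \<open>The 2 added here is the margin \<open>real T - 2\<close> required of the
      heights in \<open>defect_sum_quad2\<close>.\<close>
    define T where "T = nat \<lceil>c6 * R\<rceil> + 2"
    have T: "c6 * R + 2 \<le> real T" "real T \<le> (c6 + 3) * R"
    proof -
      have c6R: "0 \<le> c6 * R" using c6 R by simp
      have "real T = of_int \<lceil>c6 * R\<rceil> + 2" using c6R by (simp add: T_def)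
      thus "c6 * R + 2 \<le> real T" "real T \<le> (c6 + 3) * R"
        using R by (simp_all add: distrib_right) linarith
    qed
    have "c6 * R \<ge> c5 * R" using C abs_sum_nonneg[of A] R by (intro mult_right_mono) (auto simp: c6_def)
    have "4 * real T \<le> 4 * ((c6 + 3) * R)" by (rule mult_left_mono[OF T(2)]) simp
    hence T4: "4 * real T \<le> c7 * R" unfolding c7_def by (simp only: mult.assoc)
    have TR: "c6 \<le> real T / R" "real T / R \<le> c6 + 3" using T R by (simp_all add: field_simps)
    have plane: "\<bar>\<Sum>z1\<in>{- int N..int N}. \<Sum>z2\<in>{- int N..int N}. defect (ht (ivec (n(i1 := z1, i2 := z2)) + t))\<bar>
        \<le> K * c7 powr (1 + \<epsilon>) * R powr (1 + \<epsilon>)"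
      if n: "n \<in> {n \<in> ibox N. \<forall>i\<in>{i1, i2}. n i = 0}" for n
    proof -
      obtain g0 g1 g2 where g: "\<And>z1 z2. ht (ivec (n(i1 := z1, i2 := z2)) + t) = quad2 D B E (2 * a / R) g0 g1 g2 z1 z2"
        using ht_plane[OF block(2-4) assms(3), of n t] n by blast
      have "\<bar>\<Sum>z1\<in>{- int N..int N}. \<Sum>z2\<in>{- int N..int N}. defect (quad2 D B E (2 * a / R) g0 g1 g2 z1 z2)\<bar>
          \<le> K * (4 * real T) powr (1 + \<epsilon>)"
      proof (rule K(2))
        show "2 \<le> T" by (simp add: T_def)
        show "2 * real N + 1 \<le> 4 * real T" using N5 T(1) \<open>c6 * R \<ge> c5 * R\<close> by linarith
        have "1 / (8 * a * c6) \<le> C1" by (simp add: C1_def)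
        moreover have "0 < 8 * a * c6" "0 < C1" using block(1) c6 by (auto simp: C1_def)
        ultimately have "1 / C1 \<le> 8 * a * c6" by (simp add: field_simps)
        also have "\<dots> \<le> 8 * a * (real T / R)" using TR(1) block(1) by (intro mult_left_mono) auto
        finally show "1 / C1 \<le> 2 * a / R * (4 * real T)" by simp
        have "8 * a * (real T / R) \<le> 8 * a * (c6 + 3)" using TR(2) block(1) by (intro mult_left_mono) auto
        also have "8 * a * (c6 + 3) = 2 * a * c7" by (simp add: c7_def)
        also have "\<dots> \<le> C1" by (simp add: C1_def)
        finally show "2 * a / R * (4 * real T) \<le> C1" by simp
        fix z1 z2 assume z: "z1 \<in> {- int N..int N}" "z2 \<in> {- int N..int N}"
        show "\<bar>quad2 D B E (2 * a / R) g0 g1 g2 z1 z2\<bar> \<le> real T - 2"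
          unfolding g[symmetric]
        proof -
          let ?x = "ivec (n(i1 := z1, i2 := z2)) + t"
          have x: "\<bar>?x $ i\<bar> \<le> c5 * R" for i
          proof -
            have "(n(i1 := z1, i2 := z2)) i \<in> {- int N..int N}" using n z by (auto simp: ibox_def)
            hence "\<bar>real_of_int ((n(i1 := z1, i2 := z2)) i)\<bar> \<le> real N" by (auto simp: abs_le_iff)
            thus ?thesis using t[of i] N5 unfolding vector_add_component ivec_nth by linarith
          qed
          have "\<bar>quad_form A ?x\<bar> / R \<le> abs_sum A * (c5 * R * (c5 * R)) / R"
            unfolding quad_form_bil using abs_bil_le[OF x x] R by (intro divide_right_mono) auto
          also have "\<dots> = abs_sum A * c5\<^sup>2 * R" using R by (simp add: power2_eq_square)
          finally have q: "\<bar>quad_form A ?x / R\<bar> \<le> abs_sum A * c5\<^sup>2 * R" using R by simp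
          have "0 \<le> W" "W \<le> C * R" using c R by (auto simp: W_def intro: mult_right_mono)
          hence "\<bar>ht ?x\<bar> \<le> C * R + abs_sum A * c5\<^sup>2 * R" using q unfolding ht_def by linarith
          also have "\<dots> \<le> c6 * R" using c5 R by (simp add: c6_def distrib_right)
          finally show "\<bar>ht ?x\<bar> \<le> real T - 2" using T(1) by linarith
        qed
      qed
      also have "K * (4 * real T) powr (1 + \<epsilon>) \<le> K * (c7 * R) powr (1 + \<epsilon>)"
        using T4 \<epsilon> K(1) by (intro mult_left_mono powr_mono2) simp_all
      also have "\<dots> = K * c7 powr (1 + \<epsilon>) * R powr (1 + \<epsilon>)" using c7 R by (simp add: powr_mult)
      finally show ?thesis by (simp only: g)
    qed
    have "\<bar>\<Sum>n\<in>ibox N. defect (ht (ivec n + t))\<bar>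
        \<le> real (card {n \<in> ibox N. \<forall>i\<in>{i1, i2}. n i = 0}) * (K * c7 powr (1 + \<epsilon>) * R powr (1 + \<epsilon>))"
      unfolding sum_ibox_planes[OF assms(3)]
      by (rule order_trans[OF sum_abs]) (rule sum_bounded_above[OF plane])
    also have "card {n \<in> ibox N. \<forall>i\<in>{i1, i2}. n i = 0} = (2 * N + 1) ^ (m - 2)"
      using assms(3) by (subst card_ibox_slice) (simp add: m_def numeral_2_eq_2)
    also have "real ((2 * N + 1) ^ (m - 2)) * (K * c7 powr (1 + \<epsilon>) * R powr (1 + \<epsilon>))
        \<le> ((2 * c5) ^ (m - 2) * R ^ (m - 2)) * (K * c7 powr (1 + \<epsilon>) * R powr (1 + \<epsilon>))"
      using pow[of "m - 2"] K(1) by (intro mult_right_mono) auto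
    also have "\<dots> = K2 * (R ^ (m - 2) * R) * R powr \<epsilon>"
      using R by (simp add: K2_def powr_add)
    also have "R ^ (m - 2) * R = R ^ (m - 1)"
      using m(1) by (metis One_nat_def Suc_diff_Suc Suc_1 less_eq_Suc_le power_Suc2)
    finally have "\<bar>\<Sum>n\<in>ibox N. defect (ht (ivec n + t))\<bar> \<le> K2 * R ^ (m - 1) * R powr \<epsilon>" .
    hence "\<bar>real (lattice_count A c \<beta> R) - measure lborel (parab_body A c \<beta>) * R ^ d\<bar>
        \<le> K2 * R ^ (m - 1) * R powr \<epsilon> + K1 * R ^ (m - 1)"
      using main unfolding count vol by linarith
    also have "\<dots> \<le> K2 * R ^ (m - 1) * R powr \<epsilon> + K1 * R ^ (m - 1) * R powr \<epsilon>"
    proof -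
      have "0 \<le> K1 * R ^ (m - 1)" using c5 R abs_sum_nonneg[of A] by (simp add: K1_def)
      from mult_left_mono[OF Re this] show ?thesis by simp
    qed
    also have "\<dots> = (K1 + K2) * R powr (real d - 2 + \<epsilon>)" unfolding Rd by (simp add: algebra_simps)
    finally show "\<bar>real (lattice_count A c \<beta> R) - measure lborel (parab_body A c \<beta>) * R ^ d\<bar>
        \<le> (K1 + K2) * R powr (real d - 2 + \<epsilon>)" .
  qed
qed

end
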